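(* Let $\alpha\in(0,\pi)$, let $\nu$ be a compactly supported probability measure on $\mathbb{R}$ symmetric about $0$, let $(\sigma_N)$ be a sequence of positive reals and $(M_N)$ a sequence of positive integers, and for each $N$ let $(\mathbf{Z},\mathbf{X})$ be sampled from $\mathrm{GLMM}_N(\alpha,\nu,\sigma_N)$. Assume there is $\rho\in(0,1]$ such that both $\liminf_{u\downarrow0}\nu([-u,u])/u^{\rho}>0$ and $\sup_{I}\nu(I)/|I|^{\rho}<\infty$, the supremum being over all bounded intervals $I\subset\mathbb{R}$ of length $|I|>0$. Fix $\varepsilon>0$. If $$\sigma_N\ll1\qquad\text{and}\qquad 1\ll M_N\ll N^{1/2},$$ then the Spectral Method with Threshold Selection with input parameters $M_N$, $\theta=1/4$ and $\varepsilon$, applied to $\mathbf{X}$, achieves almost exact recovery.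
   Context: Model: let $L_1,L_2\subset\mathbb{R}^2$ be lines through the origin intersecting at angle $\alpha$, and let $\mathbf{v}_1,\mathbf{v}_2$ be unit vectors spanning $L_1,L_2$. $(\mathbf{Z},\mathbf{X})\sim\mathrm{GLMM}_N(\alpha,\nu,\sigma)$ means: $\mathbf{Z}=(Z_1,\dots,Z_N)$ with $Z_i$ uniform on $\{1,2\}$, and $\mathbf{X}=(\mathbf{X}_1,\dots,\mathbf{X}_N)$ with $\mathbf{X}_i=V_i\mathbf{v}_{Z_i}+\sigma\mathbf{Y}_i\in\mathbb{R}^2$, where $V_i\sim\nu$, $\mathbf{Y}_i\sim N(0,I_2)$, and all $Z_i,V_i,\mathbf{Y}_i$ are mutually independent. TLS residual: for three points in $\mathbb{R}^2$, $\sigma_{\mathrm{TLS}}\ge0$ is defined by $\sigma_{\mathrm{TLS}}^2(\mathbf{x}_1,\mathbf{x}_2,\mathbf{x}_3)=\min_{\mathcal{L}}\sum_{i=1}^3 d(\mathbf{x}_i,\mathcal{L})^2$, the minimum over all lines $\mathcal{L}\subset\mathbb{R}^2$, $d$ being Euclidean (perpendicular) distance. For a triple $\tau=\{i,j,k\}$ of indices, $\sigma_{\mathrm{TLS}}(\tau)=\sigma_{\mathrm{TLS}}(\mathbf{X}_i,\mathbf{X}_j,\mathbf{X}_k)$. The TLS hypergraph with threshold $t>0$ on a finite index set $S$ has vertex set $S$ and as hyperedges the 3-element subsets $\tau\subset S$ with $\sigma_{\mathrm{TLS}}(\tau)\le t$. Spectral Method on points indexed by a set $S$ of size $n$, with parameters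 $t>0$, $\varepsilon>0$: (1) construct the TLS hypergraph $H$ on $S$ with threshold $t$; (2) form the symmetric matrix $\mathbf{W}$ with $W_{ij}=$ number of hyperedges of $H$ containing both $i$ and $j$ for $i\ne j$, and $W_{ii}=0$; (3) let $\mathbf{U}\in\mathbb{R}^{n\times2}$ have as columns orthonormal eigenvectors of $\mathbf{W}$ for its two largest eigenvalues; (4) run $(1+\varepsilon)$-approximate $K$-means with $K=2$ on the rows of $\mathbf{U}$, i.e. any procedure producing $(\hat{\mathcal{Z}},\hat{\mathcal{X}})$ with $\hat{\mathcal{Z}}\in\mathbb{Z}_{n,2}$, $\hat{\mathcal{X}}\in\mathbb{R}^{2\times2}$ and $\|\hat{\mathcal{Z}}\hat{\mathcal{X}}-\mathbf{U}\|_F^2\le(1+\varepsilon)\min_{\mathcal{Z}\in\mathbb{Z}_{n,2},\,\mathcal{X}\in\mathbb{R}^{2\times2}}\|\mathcal{Z}\mathcal{X}-\mathbf{U}\|_F^2$, where $\mathbb{Z}_{n,2}$ is the set of $n\times2$ matrices with entries in $\{0,1\}$ and exactly one nonzero entry per row; output label $k$ for $i$ iff $\hat{\mathcal{Z}}_{ik}=1$. Spectral Method with Threshold Selection with parameters $M\ge1$ (integer), $\theta\in[0,1]$, $\varepsilon>0$: (1) sample unordered triples $\tau_1,\dots,\tau_M$ independently and uniformly at random from $\binom{[N]}{3}$ (independently of $(\mathbf{Z},\mathbf{X})$); (2) let $\mathcal{M}=\bigcup_{m=1}^M\tau_m$ and $\mathcal{M}^c=[N]\setminus\mathcal{M}$;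 (3) compute $s_i=\sigma_{\mathrm{TLS}}(\tau_i)$ and sort them as $s_{(1)}\le\dots\le s_{(M)}$; (4) let $k$ be $\theta M$ rounded to the nearest integer and set $t^*=s_{(k)}$ if $1\le k\le M$ and $t^*=s_{(1)}$ if $k=0$; (5) obtain labels $\hat Z_i$, $i\in\mathcal{M}^c$, from the Spectral Method on $\mathcal{M}^c$ with parameters $t^*$ and $\varepsilon$; (6) assign labels on $\mathcal{M}$ arbitrarily (for example uniformly at random). Output $\hat{\mathbf{Z}}=(\hat Z_1,\dots,\hat Z_N)\in\{1,2\}^N$. $\mathrm{Ham}(\mathbf{z},\mathbf{w})=\sum_{i=1}^N1(z_i\ne w_i)$, $\mathrm{Ham}^*(\mathbf{z},\mathbf{w})=\min\{\mathrm{Ham}(\mathbf{z},\mathbf{w}),N-\mathrm{Ham}(\mathbf{z},\mathbf{w})\}$. Almost exact recovery: $\lim_{N\to\infty}N^{-1}\mathbb{E}[\mathrm{Ham}^*(\hat{\mathbf{Z}},\mathbf{Z})]=0$. For positive sequences, $a_N\ll b_N$ means $a_N/b_N\to0$ as $N\to\infty$. *)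

theory Defs
  imports "HOL-Probability.Probability" "Jordan_Normal_Form.Char_Poly"
begin

text \<open>
  Points of the plane live in \<^typ>\<open>real ^ 2\<close>; matrices whose size depends on the data are those of
  \<^theory>\<open>Jordan_Normal_Form.Matrix\<close>. Both theories use the same infix symbols for component
  access and inner product, so \<^const>\<open>vec_nth\<close> and \<^const>\<open>inner\<close> are written out for the plane.
\<close>

definition much_less :: "(nat \<Rightarrow> real) \<Rightarrow> (nat \<Rightarrow> real) \<Rightarrow> bool" where
  "much_less a b \<longleftrightarrow> (\<lambda>N. a N / b N) \<longlonglongrightarrow> 0"

definition has_law :: "'w measure \<Rightarrow> ('w \<Rightarrow> 'b) \<Rightarrow> 'b measure \<Rightarrow> bool" where
  "has_law P X D \<longleftrightarrow> X \<in> P \<rightarrow>\<^sub>M D \<and> distr P D X = D"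


subsection \<open>The Gaussian line mixture model\<close>

definition meet_at_angle :: "real \<Rightarrow> (real ^ 2) set \<Rightarrow> (real ^ 2) set \<Rightarrow> bool" where
  "meet_at_angle \<alpha> L1 L2 \<longleftrightarrow>
     (\<exists>u1 u2. norm u1 = 1 \<and> norm u2 = 1 \<and> L1 = span {u1} \<and> L2 = span {u2} \<and> inner u1 u2 = cos \<alpha>)"

definition std_gaussian :: "(real ^ 2) measure" where
  "std_gaussian = density lborel (\<lambda>y. ennreal (\<Prod>i\<in>UNIV. std_normal_density (vec_nth y i)))"

text \<open>
  The joint law of \<open>(Z, X)\<close>. Both components are functions on \<open>{1..N}\<close>, extended by
  \<^const>\<open>undefined\<close> as is customary for \<^const>\<open>PiM\<close>. Only \<open>v 1\<close> and \<open>v 2\<close> matter.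
\<close>

definition GLMM :: "nat \<Rightarrow> (nat \<Rightarrow> real ^ 2) \<Rightarrow> real measure \<Rightarrow> real
    \<Rightarrow> ((nat \<Rightarrow> nat) \<times> (nat \<Rightarrow> real ^ 2)) measure" where
  "GLMM N v \<nu> \<sigma> =
     distr (PiM {1..N} (\<lambda>_. measure_pmf (pmf_of_set {1, 2}))
              \<Otimes>\<^sub>M PiM {1..N} (\<lambda>_. \<nu>)
              \<Otimes>\<^sub>M PiM {1..N} (\<lambda>_. std_gaussian))
           (PiM {1..N} (\<lambda>_. count_space UNIV) \<Otimes>\<^sub>M PiM {1..N} (\<lambda>_. borel))
           (\<lambda>(z, w, y). (z, \<lambda>i\<in>{1..N}. w i *\<^sub>R v (z i) + \<sigma> *\<^sub>R y i))"

definition random_triples :: "nat \<Rightarrow> nat \<Rightarrow> (nat \<Rightarrow> nat set) measure" where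
  "random_triples N M =
     PiM {1..M} (\<lambda>_. measure_pmf (pmf_of_set {\<tau>. \<tau> \<subseteq> {1..N} \<and> card \<tau> = 3}))"


subsection \<open>The TLS hypergraph\<close>

definition plane_lines :: "(real ^ 2) set set" where
  "plane_lines = {L. affine L \<and> aff_dim L = 1}"

definition tls_residual :: "('i \<Rightarrow> real ^ 2) \<Rightarrow> 'i set \<Rightarrow> real" where
  "tls_residual x \<tau> = sqrt (INF L\<in>plane_lines. \<Sum>i\<in>\<tau>. (infdist (x i) L)\<^sup>2)"

definition tls_hyperedges :: "('i \<Rightarrow> real ^ 2) \<Rightarrow> real \<Rightarrow> 'i set \<Rightarrow> 'i set set" where
  "tls_hyperedges x t S = {\<tau>. \<tau> \<subseteq> S \<and> card \<tau> = 3 \<and> tls_residual x \<tau> \<le> t}"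


subsection \<open>The spectral method\<close>

text \<open>Row and column \<open>a\<close> of the matrices below belong to the \<open>a\<close>-th smallest element of \<open>S\<close>.\<close>

definition vertex :: "nat set \<Rightarrow> nat \<Rightarrow> nat" where
  "vertex S a = sorted_list_of_set S ! a"

definition similarity_matrix :: "nat set set \<Rightarrow> nat set \<Rightarrow> real mat" where
  "similarity_matrix H S = mat (card S) (card S)
     (\<lambda>(a, b). if a = b then 0 else real (card {\<tau> \<in> H. vertex S a \<in> \<tau> \<and> vertex S b \<in> \<tau>}))"

text \<open>The list \<open>ls\<close> enumerates the eigenvalues with multiplicity, in decreasing order.\<close>

definition eigenvalue_list :: "real mat \<Rightarrow> real list \<Rightarrow> bool" where
  "eigenvalue_list A ls \<longleftrightarrow> char_poly A = (\<Prod>l\<leftarrow>ls. [:- l, 1:]) \<and> sorted_wrt (\<ge>) ls"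

definition leading_eigenvectors :: "real mat \<Rightarrow> real mat \<Rightarrow> bool" where
  "leading_eigenvectors W U \<longleftrightarrow>
     U \<in> carrier_mat (dim_row W) 2 \<and> transpose_mat U * U = 1\<^sub>m 2 \<and>
     (\<exists>ls. eigenvalue_list W ls \<and> (\<forall>k<2. eigenvector W (col U k) (ls ! k)))"

definition frobenius_sq :: "real mat \<Rightarrow> real" where
  "frobenius_sq A = (\<Sum>i<dim_row A. \<Sum>j<dim_col A. (A $$ (i, j))\<^sup>2)"

definition membership_matrices :: "nat \<Rightarrow> real mat set" where
  "membership_matrices n =
     {A \<in> carrier_mat n 2. (\<forall>i<n. \<forall>j<2. A $$ (i, j) \<in> {0, 1}) \<and> (\<forall>i<n. \<exists>!j. j < 2 \<and> A $$ (i, j) \<noteq> 0)}"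

definition approx_2means :: "real \<Rightarrow> real mat \<Rightarrow> real mat \<Rightarrow> real mat \<Rightarrow> bool" where
  "approx_2means \<epsilon> U A B \<longleftrightarrow>
     A \<in> membership_matrices (dim_row U) \<and> B \<in> carrier_mat 2 2 \<and>
     frobenius_sq (A * B - U) \<le>
       (1 + \<epsilon>) * (INF (A', B')\<in>membership_matrices (dim_row U) \<times> carrier_mat 2 2.
                    frobenius_sq (A' * B' - U))"

text \<open>
  The eigenvectors and the approximate 2-means solution are not unique, so the algorithms are
  relations between the input and the admissible labellings. Matrix columns are numbered from 0,
  labels from 1.
\<close>

definition spectral_method :: "(nat \<Rightarrow> real ^ 2) \<Rightarrow> nat set \<Rightarrow> real \<Rightarrow> real \<Rightarrow> (nat \<Rightarrow> nat) \<Rightarrow> bool" where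
  "spectral_method x S t \<epsilon> lab \<longleftrightarrow>
     (\<exists>U A B. leading_eigenvectors (similarity_matrix (tls_hyperedges x t S) S) U \<and>
        approx_2means \<epsilon> U A B \<and>
        (\<forall>a<card S. \<forall>k\<in>{1, 2}. lab (vertex S a) = k \<longleftrightarrow> A $$ (a, k - 1) = 1))"


subsection \<open>Threshold selection\<close>

text \<open>Ties in rounding \<open>\<theta> * M\<close> to the nearest integer are resolved upwards by \<^const>\<open>round\<close>.\<close>

definition selected_threshold :: "(nat \<Rightarrow> real ^ 2) \<Rightarrow> (nat \<Rightarrow> nat set) \<Rightarrow> nat \<Rightarrow> real \<Rightarrow> real" where
  "selected_threshold x \<tau> M \<theta> =
     (let s = sort (map (\<lambda>m. tls_residual x (\<tau> m)) [1..<M + 1]);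
          k = nat (round (\<theta> * real M))
      in if 1 \<le> k \<and> k \<le> M then s ! (k - 1) else s ! 0)"

text \<open>
  The spectral method needs two orthonormal eigenvectors, hence at least two vertices; with fewer
  unsampled vertices the labelling is left unconstrained.
\<close>

definition spectral_method_threshold_selection :: "nat \<Rightarrow> (nat \<Rightarrow> real ^ 2) \<Rightarrow> (nat \<Rightarrow> nat set)
    \<Rightarrow> nat \<Rightarrow> real \<Rightarrow> real \<Rightarrow> (nat \<Rightarrow> nat) \<Rightarrow> bool" where
  "spectral_method_threshold_selection N x \<tau> M \<theta> \<epsilon> lab \<longleftrightarrow>
     (\<forall>i\<in>{1..N}. lab i \<in> {1, 2}) \<and>
     (let S = {1..N} - (\<Union>m\<in>{1..M}. \<tau> m)
      in 2 \<le> card S \<longrightarrow> spectral_method x S (selected_threshold x \<tau> M \<theta>) \<epsilon> lab)"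


subsection \<open>Recovery\<close>

definition ham :: "nat \<Rightarrow> (nat \<Rightarrow> nat) \<Rightarrow> (nat \<Rightarrow> nat) \<Rightarrow> nat" where
  "ham N z w = (\<Sum>i=1..N. of_bool (z i \<noteq> w i))"

definition ham_star :: "nat \<Rightarrow> (nat \<Rightarrow> nat) \<Rightarrow> (nat \<Rightarrow> nat) \<Rightarrow> nat" where
  "ham_star N z w = min (ham N z w) (N - ham N z w)"

definition almost_exact_recovery :: "(nat \<Rightarrow> 'w measure) \<Rightarrow> (nat \<Rightarrow> 'w \<Rightarrow> nat \<Rightarrow> nat)
    \<Rightarrow> (nat \<Rightarrow> 'w \<Rightarrow> nat \<Rightarrow> nat) \<Rightarrow> bool" where
  "almost_exact_recovery P Zhat Z \<longleftrightarrow>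
     (\<lambda>N. (\<integral>\<omega>. real (ham_star N (Zhat N \<omega>) (Z N \<omega>)) \<partial>P N) / real N) \<longlonglongrightarrow> 0"

end

theory Submission
  imports Defs "Jordan_Normal_Form.Schur_Decomposition"
begin

text \<open>
  Why the spectral method recovers almost all labels. Call a triple of indices \<^emph>\<open>pure\<close> if its
  three labels agree and \<^emph>\<open>mixed\<close> otherwise; a random triple is pure with probability \<open>1/4\<close>, which
  is where the choice of the quantile \<open>1/4\<close> comes from. As the noise vanishes, the TLS residual of a
  pure triple tends to \<open>0\<close>, while that of a mixed triple stays away from \<open>0\<close> except with small
  probability: three points \<open>w\<^sub>1 u\<close>, \<open>w\<^sub>2 u\<close>, \<open>w\<^sub>3 u'\<close> on two different lines span a triangle of area
  proportional to \<open>\<bar>w\<^sub>2 - w\<^sub>1\<bar> * \<bar>w\<^sub>3\<bar>\<close>, and \<open>\<nu>\<close> puts little mass on short intervals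
  (\<open>pure_residual_small\<close>, \<open>mixed_residual_large\<close>).

  Fix a small \<open>\<eta>\<close>. There are a fixed level \<open>t\<close> and levels \<open>T\<close>, depending on the noise, such that a random
  triple has residual less than \<open>T\<close> with probability at most \<open>1/4 - \<eta>\<close>, residual at most \<open>t\<close> with
  probability at least \<open>1/4 + c\<close>, and yet is pure above \<open>T\<close> or mixed below \<open>t\<close> with probability at
  most \<open>3 * \<eta>\<close> (\<open>threshold_window\<close>).
  The gap \<open>c > 0\<close> comes from the mass of \<open>\<nu>\<close> near the origin, where triples of any labels look collinear.
  Hence, as soon as the sampled quantile falls between \<open>T\<close> and \<open>t\<close>, the TLS hypergraph misjudges few
  triples, whatever the exact value of the threshold. The counts of sampled residuals concentrate
  by Chebyshev's inequality, since two random triples rarely share an index and residuals of disjoint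
  triples are independent (\<open>sample_deviation\<close>); a first moment bounds the number of misjudged triples.
  The triples that are pure above \<open>T\<close> or mixed below \<open>t\<close> are counted in all of \<open>{1..N}\<close>, so that their
  number does not depend on the sample, and discarding the \<open>3 * M\<close> sampled vertices changes nothing at the scale \<open>N\<close>.

  The rest is deterministic. If few triples are misjudged, then the similarity matrix is close, in the
  entrywise \<open>L\<^sup>1\<close> norm, to \<open>n/2\<close> times the block indicator of the labels, whose nonzero eigenvalues are
  about \<open>n\<^sup>2/4\<close>, twice. The sums of squares and of cubes of the eigenvalues are traces, hence
  continuous in this norm, and they force the second eigenvalue to be of order \<open>n\<^sup>2\<close>
  (\<open>eigenvalue_lower\<close>). An eigenvector with such an eigenvalue is nearly constant on the blocks,
  because \<open>u = W u / \<lambda>\<close>. So the rows of \<open>U\<close> cluster at two points, which are far apart because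
  the two columns are orthonormal, and approximate 2-means finds the two clusters up to few errors
  (\<open>spectral_clustering_near_block\<close>, \<open>spectral_method_recovers\<close>).
\<close>

section \<open>Eigenvalue moments and the second eigenvalue\<close>

lemma mat_mult_index_sum:
  assumes "A \<in> carrier_mat n m" "B \<in> carrier_mat m k" "i < n" "j < k"
  shows "(A * B) $$ (i, j) = (\<Sum>l<m. A $$ (i, l) * B $$ (l, j))"
  using assms by (auto simp: scalar_prod_def lessThan_atLeast0)

lemma trace_mult_commute:
  fixes A B :: "real mat"
  assumes "A \<in> carrier_mat n n" "B \<in> carrier_mat n n"
  shows "(\<Sum>i<n. (A * B) $$ (i, i)) = (\<Sum>i<n. (B * A) $$ (i, i))"
proof -
  have "(\<Sum>i<n. (A * B) $$ (i, i)) = (\<Sum>i<n. \<Sum>l<n. A $$ (i, l) * B $$ (l, i))"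
    using assms by (intro sum.cong refl mat_mult_index_sum) auto
  also have "\<dots> = (\<Sum>l<n. \<Sum>i<n. B $$ (l, i) * A $$ (i, l))"
    by (subst sum.swap) (simp add: mult.commute)
  also have "\<dots> = (\<Sum>i<n. (B * A) $$ (i, i))"
    using assms by (intro sum.cong refl mat_mult_index_sum[symmetric]) auto
  finally show ?thesis .
qed

lemma upper_triangular_power:
  fixes B :: "real mat"
  assumes B: "B \<in> carrier_mat n n" and ut: "upper_triangular B"
  shows "(\<forall>i<n. \<forall>j<i. (B ^\<^sub>m k) $$ (i, j) = 0) \<and> (\<forall>i<n. (B ^\<^sub>m k) $$ (i, i) = (B $$ (i, i)) ^ k)"
proof (induction k)
  case 0
  then show ?case using B by auto
next
  case (Suc k)
  have C: "B ^\<^sub>m k \<in> carrier_mat n n" using B by simp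
  have low: "B $$ (i, j) = 0" if "j < i" "i < n" for i j
    using ut B that by (auto simp: upper_triangular_def)
  have entry: "(B ^\<^sub>m Suc k) $$ (i, j) = (\<Sum>l<n. (B ^\<^sub>m k) $$ (i, l) * B $$ (l, j))" if "i < n" "j < n" for i j
    using mat_mult_index_sum[OF C B that] by simp
  show ?case
  proof (intro conjI allI impI)
    fix i j assume ij: "i < n" "j < i"
    have "(B ^\<^sub>m k) $$ (i, l) * B $$ (l, j) = 0" if "l < n" for l
      using Suc.IH ij that low[of j l] by (cases "l < i") auto
    then have "(\<Sum>l<n. (B ^\<^sub>m k) $$ (i, l) * B $$ (l, j)) = 0" by (intro sum.neutral) auto
    then show "(B ^\<^sub>m Suc k) $$ (i, j) = 0" using entry[of i j] ij by simp
  next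
    fix i assume i: "i < n"
    have "(\<Sum>l<n. (B ^\<^sub>m k) $$ (i, l) * B $$ (l, i)) = (\<Sum>l<n. if l = i then (B ^\<^sub>m k) $$ (i, i) * B $$ (i, i) else 0)"
    proof (intro sum.cong refl)
      fix l assume "l \<in> {..<n}"
      then show "(B ^\<^sub>m k) $$ (i, l) * B $$ (l, i) = (if l = i then (B ^\<^sub>m k) $$ (i, i) * B $$ (i, i) else 0)"
        using Suc.IH i low[of i l] by (cases "l < i"; cases "l = i") auto
    qed
    then show "(B ^\<^sub>m Suc k) $$ (i, i) = (B $$ (i, i)) ^ Suc k"
      using entry[of i i] i Suc.IH by (simp add: mult.commute)
  qed
qed

text \<open>
  The factorisation of the characteristic polynomial makes \<open>A\<close> similar to an upper triangular
  matrix with diagonal \<open>ls\<close>, and traces of powers are invariant under similarity.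
\<close>

lemma trace_power_eigenvalues:
  fixes A :: "real mat"
  assumes A: "A \<in> carrier_mat n n" and cp: "char_poly A = (\<Prod>l\<leftarrow>ls. [:- l, 1:])"
  shows "(\<Sum>i<n. (A ^\<^sub>m k) $$ (i, i)) = (\<Sum>l\<leftarrow>ls. l ^ k)"
proof -
  obtain B P Q where d: "schur_decomposition A ls = (B, P, Q)" by (metis prod_cases3)
  from schur_decomposition[OF A cp d] have sim: "similar_mat_wit A B P Q"
    and ut: "upper_triangular B" and diag: "diag_mat B = ls" by auto
  from similar_mat_witD2[OF A sim] have PQ: "Q * P = 1\<^sub>m n" "B \<in> carrier_mat n n"
    "P \<in> carrier_mat n n" "Q \<in> carrier_mat n n" by auto
  have Ak: "A ^\<^sub>m k = P * B ^\<^sub>m k * Q"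
    using similar_mat_wit_pow[OF sim, of k] unfolding similar_mat_wit_def Let_def by auto
  have Bk: "B ^\<^sub>m k \<in> carrier_mat n n" using PQ by simp
  have "(\<Sum>i<n. (A ^\<^sub>m k) $$ (i, i)) = (\<Sum>i<n. (Q * (P * B ^\<^sub>m k)) $$ (i, i))"
    unfolding Ak by (rule trace_mult_commute) (use PQ Bk in auto)
  also have "Q * (P * B ^\<^sub>m k) = (Q * P) * B ^\<^sub>m k"
    using PQ Bk by (metis assoc_mult_mat)
  also have "\<dots> = B ^\<^sub>m k" using PQ Bk by simp
  also have "(\<Sum>i<n. (B ^\<^sub>m k) $$ (i, i)) = (\<Sum>i<n. (B $$ (i, i)) ^ k)"
    using upper_triangular_power[OF PQ(2) ut, of k] by simp
  also have "\<dots> = (\<Sum>l\<leftarrow>ls. l ^ k)"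
    unfolding diag[symmetric] diag_mat_def using PQ(2)
    by (simp add: o_def sum_list_distinct_conv_sum_set lessThan_atLeast0 interv_sum_list_conv_sum_set_nat)
  finally show ?thesis .
qed

text \<open>
  Writing the moments as polynomials in the entries makes them comparable for two matrices that are
  close entry by entry.
\<close>

lemma eigenvalue_moments:
  fixes A :: "real mat"
  assumes A: "A \<in> carrier_mat n n" and cp: "char_poly A = (\<Prod>l\<leftarrow>ls. [:- l, 1:])"
  shows "(\<Sum>l\<leftarrow>ls. l ^ 2) = (\<Sum>i<n. \<Sum>j<n. A $$ (i, j) * A $$ (j, i))"
    and "(\<Sum>l\<leftarrow>ls. l ^ 3) = (\<Sum>i<n. \<Sum>j<n. \<Sum>k<n. A $$ (i, j) * A $$ (j, k) * A $$ (k, i))"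
proof -
  have AA: "A * A \<in> carrier_mat n n" using A by simp
  have p2: "A ^\<^sub>m 2 = A * A" using A by (simp add: numeral_2_eq_2)
  have p3: "A ^\<^sub>m 3 = A * A * A" using A by (simp add: numeral_3_eq_3)
  show "(\<Sum>l\<leftarrow>ls. l ^ 2) = (\<Sum>i<n. \<Sum>j<n. A $$ (i, j) * A $$ (j, i))"
    unfolding trace_power_eigenvalues[OF A cp, symmetric] p2
    by (intro sum.cong refl mat_mult_index_sum[OF A A]) auto
  have "(A * A * A) $$ (i, i) = (\<Sum>j<n. \<Sum>k<n. A $$ (i, j) * A $$ (j, k) * A $$ (k, i))" if "i < n" for i
  proof -
    have "(A * A * A) $$ (i, i) = (\<Sum>k<n. (\<Sum>j<n. A $$ (i, j) * A $$ (j, k)) * A $$ (k, i))"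
      using mat_mult_index_sum[OF AA A that that] mat_mult_index_sum[OF A A that] by simp
    also have "\<dots> = (\<Sum>k<n. \<Sum>j<n. A $$ (i, j) * A $$ (j, k) * A $$ (k, i))"
      by (simp add: sum_distrib_right)
    also have "\<dots> = (\<Sum>j<n. \<Sum>k<n. A $$ (i, j) * A $$ (j, k) * A $$ (k, i))"
      by (rule sum.swap)
    finally show ?thesis .
  qed
  then show "(\<Sum>l\<leftarrow>ls. l ^ 3) = (\<Sum>i<n. \<Sum>j<n. \<Sum>k<n. A $$ (i, j) * A $$ (j, k) * A $$ (k, i))"
    unfolding trace_power_eigenvalues[OF A cp, symmetric] p3 by simp
qed

lemma length_eigenvalue_list:
  assumes "A \<in> carrier_mat n n" "char_poly A = (\<Prod>l\<leftarrow>ls. [:- l, 1:])"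
  shows "length ls = n"
proof -
  have "degree (char_poly A) = length ls"
    unfolding assms(2) by (subst degree_linear_factors) simp
  then show ?thesis using degree_monic_char_poly[OF assms(1)] by simp
qed

text \<open>
  Every eigenvalue but the first is at most the second one, so \<open>l ^ 3 \<le> (ls ! 1) * l ^ 2\<close> for it. A large
  third moment that the first eigenvalue alone cannot explain therefore bounds \<open>ls ! 1\<close> from below.
\<close>

lemma third_moment_le:
  fixes ls :: "real list"
  assumes "sorted_wrt (\<ge>) ls" "2 \<le> length ls"
  shows "(\<Sum>l\<leftarrow>ls. l ^ 3) \<le> (ls ! 0) ^ 3 + (ls ! 1) * ((\<Sum>l\<leftarrow>ls. l ^ 2) - (ls ! 0) ^ 2)"
    and "(ls ! 0) ^ 2 \<le> (\<Sum>l\<leftarrow>ls. l ^ 2)"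
proof -
  obtain a b r where ls: "ls = a # b # r"
    using assms(2) by (metis One_nat_def Suc_1 Suc_le_length_iff)
  have "l ^ 3 \<le> b * l ^ 2" if "l \<in> set (b # r)" for l
  proof -
    have "l \<le> b" using assms(1) that by (auto simp: ls)
    then have "l * l ^ 2 \<le> b * l ^ 2" by (intro mult_right_mono) auto
    then show ?thesis by (simp add: power3_eq_cube power2_eq_square)
  qed
  then have "(\<Sum>l\<leftarrow>b # r. l ^ 3) \<le> (\<Sum>l\<leftarrow>b # r. b * l ^ 2)"
    by (intro sum_list_mono) auto
  also have "\<dots> = b * (\<Sum>l\<leftarrow>b # r. l ^ 2)" by (rule sum_list_const_mult)
  finally show "(\<Sum>l\<leftarrow>ls. l ^ 3) \<le> (ls ! 0) ^ 3 + (ls ! 1) * ((\<Sum>l\<leftarrow>ls. l ^ 2) - (ls ! 0) ^ 2)"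
    by (simp add: ls)
  have "0 \<le> (\<Sum>l\<leftarrow>b # r. l ^ 2)" by (intro sum_list_nonneg) auto
  then show "(ls ! 0) ^ 2 \<le> (\<Sum>l\<leftarrow>ls. l ^ 2)" by (simp add: ls)
qed

section \<open>Matrices close to two equal blocks\<close>

text \<open>
  \<open>z\<close> is a labelling by two blocks of nearly equal size, and \<open>W\<close> is close to \<open>n/2\<close> times its block
  indicator. The error is measured by the sum of absolute values because it will be a number of
  misjudged triples; the bound \<open>W a b \<le> n\<close> turns it into a bound in the Frobenius norm.
\<close>

locale near_block =
  fixes n :: nat and W :: "nat \<Rightarrow> nat \<Rightarrow> real" and z :: "nat \<Rightarrow> bool" and \<eta> :: real
  assumes npos: "0 < n" and W_ge: "\<And>a b. a < n \<Longrightarrow> b < n \<Longrightarrow> 0 \<le> W a b"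
    and W_le: "\<And>a b. a < n \<Longrightarrow> b < n \<Longrightarrow> W a b \<le> n"
    and close: "(\<Sum>a<n. \<Sum>b<n. \<bar>W a b - n / 2 * of_bool (z a = z b)\<bar>) \<le> \<eta> * real n ^ 3"
    and balanced: "\<bar>real (card {a. a < n \<and> z a}) - n / 2\<bar> \<le> \<eta> * n"
    and eta: "0 \<le> \<eta>" "\<eta> \<le> 1 / 10000"
begin

definition "block a b = n / 2 * of_bool (z a = z b)"
definition "err a b = W a b - block a b"
definition "block_size t = real (card {a. a < n \<and> z a = t})"

lemma block_bounds: "0 \<le> block a b" "block a b \<le> n"
  by (auto simp: block_def)

lemma err_sum: "(\<Sum>a<n. \<Sum>b<n. \<bar>err a b\<bar>) \<le> \<eta> * real n ^ 3"
  using close by (simp add: err_def block_def)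

lemma err_le: "a < n \<Longrightarrow> b < n \<Longrightarrow> \<bar>err a b\<bar> \<le> n"
  using W_ge[of a b] W_le[of a b] block_bounds[of a b] by (auto simp: err_def)

lemma err_square_sum: "(\<Sum>a<n. \<Sum>b<n. (err a b)\<^sup>2) \<le> \<eta> * real n ^ 4"
proof -
  have "(\<Sum>a<n. \<Sum>b<n. (err a b)\<^sup>2) \<le> (\<Sum>a<n. \<Sum>b<n. n * \<bar>err a b\<bar>)"
  proof (intro sum_mono)
    fix a b assume "a \<in> {..<n}" "b \<in> {..<n}"
    then have "\<bar>err a b\<bar> * \<bar>err a b\<bar> \<le> n * \<bar>err a b\<bar>" by (intro mult_right_mono err_le) auto
    then show "(err a b)\<^sup>2 \<le> n * \<bar>err a b\<bar>" by (simp add: power2_eq_square)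
  qed
  also have "\<dots> = n * (\<Sum>a<n. \<Sum>b<n. \<bar>err a b\<bar>)" by (simp add: sum_distrib_left)
  also have "\<dots> \<le> n * (\<eta> * real n ^ 3)" by (intro mult_left_mono err_sum) auto
  finally show ?thesis by (simp add: power4_eq_xxxx power3_eq_cube algebra_simps)
qed

lemma block_size_sum: "block_size True + block_size False = n"
proof -
  have "card ({a. a < n \<and> z a} \<union> {a. a < n \<and> \<not> z a}) = card {a. a < n \<and> z a} + card {a. a < n \<and> \<not> z a}"
    by (intro card_Un_disjoint) auto
  moreover have "{a. a < n \<and> z a} \<union> {a. a < n \<and> \<not> z a} = {..<n}" by auto
  ultimately show ?thesis by (simp add: block_size_def flip: of_nat_add)
qed

lemma block_size_near: "\<bar>block_size t - n / 2\<bar> \<le> \<eta> * n"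
  using balanced block_size_sum by (cases t) (auto simp: block_size_def)

lemma sum_by_block:
  fixes f :: "bool \<Rightarrow> real"
  shows "(\<Sum>a<n. f (z a)) = block_size True * f True + block_size False * f False"
proof -
  have "(\<Sum>a<n. f (z a)) = (\<Sum>a | a < n \<and> z a. f (z a)) + (\<Sum>a | a < n \<and> \<not> z a. f (z a))"
    by (subst sum.union_disjoint[symmetric]) (auto intro!: sum.cong)
  also have "(\<Sum>a | a < n \<and> z a. f (z a)) = (\<Sum>a | a < n \<and> z a. f True)" by (intro sum.cong) auto
  also have "(\<Sum>a | a < n \<and> \<not> z a. f (z a)) = (\<Sum>a | a < n \<and> \<not> z a. f False)" by (intro sum.cong) auto
  finally show ?thesis by (simp add: block_size_def)
qed

lemma row_sum: "(\<Sum>b<n. of_bool (t = z b) :: real) = block_size t"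
  using sum_by_block[of "\<lambda>s. of_bool (t = s)"] by (cases t) auto

text \<open>
  For blocks of size exactly \<open>n/2\<close> the sum is \<open>n ^ 4 / 8\<close>, as the eigenvalues of \<^const>\<open>block\<close>
  are \<open>n\<^sup>2/4\<close>, twice, and \<open>0\<close>; the slack absorbs the imbalance.
\<close>

lemma block_second_moment: "(\<Sum>a<n. \<Sum>b<n. block a b * block b a) \<le> (1 / 8 + 1/1000) * real n ^ 4"
proof -
  have "(\<Sum>a<n. \<Sum>b<n. block a b * block b a) = (\<Sum>a<n. (n / 2)\<^sup>2 * (\<Sum>b<n. of_bool (z a = z b)))"
    unfolding sum_distrib_left by (intro sum.cong refl) (auto simp: block_def power2_eq_square)
  also have "\<dots> = (n / 2)\<^sup>2 * ((block_size True)\<^sup>2 + (block_size False)\<^sup>2)"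
    unfolding row_sum sum_by_block[of "\<lambda>t. (n/2)\<^sup>2 * block_size t"] by (simp add: power2_eq_square algebra_simps)
  also have "\<dots> \<le> (n / 2)\<^sup>2 * ((1/2 + 1/250) * (real n)\<^sup>2)"
  proof (intro mult_left_mono)
    define d where "d = block_size True - n / 2"
    have T: "block_size True = n / 2 + d" and F: "block_size False = n / 2 - d"
      using block_size_sum by (auto simp: d_def)
    have "\<bar>d\<bar> \<le> n / 1000"
      using block_size_near[of True] mult_right_mono[OF eta(2), of n] by (simp add: d_def)
    then have "d\<^sup>2 \<le> (n / 1000)\<^sup>2" by (simp add: abs_le_square_iff[symmetric])
    moreover have "(n/2 + d)\<^sup>2 + (n/2 - d)\<^sup>2 = (real n)\<^sup>2 / 2 + 2 * d\<^sup>2" by (simp add: power2_eq_square algebra_simps)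
    ultimately show "(block_size True)\<^sup>2 + (block_size False)\<^sup>2 \<le> (1/2 + 1/250) * (real n)\<^sup>2"
      unfolding T F by (simp add: power_divide) (use zero_le_power2[of "real n"] in linarith)
  qed auto
  also have "\<dots> = (1 / 8 + 1/1000) * real n ^ 4" by (simp add: power2_eq_square power4_eq_xxxx)
  finally show ?thesis .
qed

text \<open>
  By convexity of the cube, equal blocks are the worst case.
\<close>

lemma block_third_moment: "real n ^ 6 / 32 \<le> (\<Sum>a<n. \<Sum>b<n. \<Sum>c<n. block a b * block b c * block c a)"
proof -
  have "(\<Sum>c<n. block a b * block b c * block c a) = (n / 2) ^ 3 * (of_bool (z a = z b) * block_size (z a))" for a b
  proof -
    have "(\<Sum>c<n. block a b * block b c * block c a) = (\<Sum>c<n. (n / 2) ^ 3 * of_bool (z a = z b) * of_bool (z a = z c))"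
      by (intro sum.cong refl) (auto simp: block_def power3_eq_cube)
    then show ?thesis by (simp add: sum_distrib_left[symmetric] row_sum)
  qed
  then have "(\<Sum>a<n. \<Sum>b<n. \<Sum>c<n. block a b * block b c * block c a)
      = (\<Sum>a<n. (n / 2) ^ 3 * (block_size (z a) * (\<Sum>b<n. of_bool (z a = z b))))"
    by (simp only: sum_distrib_left mult_ac)
  also have "\<dots> = (n / 2) ^ 3 * ((block_size True) ^ 3 + (block_size False) ^ 3)"
    unfolding row_sum sum_by_block[of "\<lambda>t. (n/2)^3 * (block_size t * block_size t)"] by (simp add: power3_eq_cube algebra_simps)
  also have "\<dots> \<ge> (n / 2) ^ 3 * (real n ^ 3 / 4)"
  proof (intro mult_left_mono)
    define d where "d = block_size True - n / 2"
    have T: "block_size True = n / 2 + d" and F: "block_size False = n / 2 - d"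
      using block_size_sum by (auto simp: d_def)
    have "(n/2 + d)^3 + (n/2 - d)^3 = real n ^ 3 / 4 + 3 * n * d\<^sup>2"
      by (simp add: power2_eq_square power3_eq_cube field_simps)
    then show "real n ^ 3 / 4 \<le> (block_size True) ^ 3 + (block_size False) ^ 3"
      unfolding T F by simp
  qed auto
  also have "(n / 2) ^ 3 * (real n ^ 3 / 4) = real n ^ 6 / 32" by (simp add: power_divide flip: power_add)
  finally show ?thesis .
qed

text \<open>
  Replacing the factors one at a time costs at most \<open>n\<close> times an entry of the error.
\<close>

lemma second_moment_near:
  "(\<Sum>a<n. \<Sum>b<n. W a b * W b a) \<le> (\<Sum>a<n. \<Sum>b<n. block a b * block b a) + 2 * \<eta> * real n ^ 4"
proof -
  have "(\<Sum>a<n. \<Sum>b<n. W a b * W b a) \<le> (\<Sum>a<n. \<Sum>b<n. block a b * block b a + (n * \<bar>err a b\<bar> + n * \<bar>err b a\<bar>))"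
  proof (intro sum_mono)
    fix a b assume "a \<in> {..<n}" "b \<in> {..<n}"
    then have ab: "a < n" "b < n" by auto
    have "W a b * W b a - block a b * block b a = err a b * W b a + block a b * err b a"
      by (simp add: err_def algebra_simps)
    moreover have "err a b * W b a \<le> \<bar>err a b\<bar> * n"
      using W_ge[OF ab(2,1)] W_le[OF ab(2,1)] by (intro mult_mono) auto
    moreover have "block a b * err b a \<le> n * \<bar>err b a\<bar>"
      using block_bounds[of a b] by (metis abs_ge_self abs_ge_zero block_bounds mult_mono' mult_left_mono order_trans mult_right_mono)
    ultimately show "W a b * W b a \<le> block a b * block b a + (n * \<bar>err a b\<bar> + n * \<bar>err b a\<bar>)"
      by (simp add: algebra_simps)
  qed
  also have "\<dots> = (\<Sum>a<n. \<Sum>b<n. block a b * block b a) + n * (\<Sum>a<n. \<Sum>b<n. \<bar>err a b\<bar>) + n * (\<Sum>a<n. \<Sum>b<n. \<bar>err b a\<bar>)"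
    by (simp add: sum.distrib sum_distrib_left)
  also have "(\<Sum>a<n. \<Sum>b<n. \<bar>err b a\<bar>) = (\<Sum>a<n. \<Sum>b<n. \<bar>err a b\<bar>)" by (rule sum.swap)
  also have "real n * (\<Sum>a<n. \<Sum>b<n. \<bar>err a b\<bar>) \<le> n * (\<eta> * real n ^ 3)"
    by (intro mult_left_mono err_sum) auto
  finally show ?thesis by (simp add: power4_eq_xxxx power3_eq_cube algebra_simps)
qed

lemma third_moment_near:
  "(\<Sum>a<n. \<Sum>b<n. \<Sum>c<n. block a b * block b c * block c a) \<le>
   (\<Sum>a<n. \<Sum>b<n. \<Sum>c<n. W a b * W b c * W c a) + 3 * \<eta> * real n ^ 6"
proof -
  let ?S = "\<Sum>a<n. \<Sum>b<n. \<bar>err a b\<bar>"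
  have "(\<Sum>a<n. \<Sum>b<n. \<Sum>c<n. block a b * block b c * block c a) \<le>
   (\<Sum>a<n. \<Sum>b<n. \<Sum>c<n. W a b * W b c * W c a + ((real n)\<^sup>2 * \<bar>err a b\<bar> + (real n)\<^sup>2 * \<bar>err b c\<bar> + (real n)\<^sup>2 * \<bar>err c a\<bar>))"
  proof (intro sum_mono)
    fix a b c assume "a \<in> {..<n}" "b \<in> {..<n}" "c \<in> {..<n}"
    then have abc: "a < n" "b < n" "c < n" by auto
    have b2: "\<bar>e * (x * y)\<bar> \<le> (real n)\<^sup>2 * \<bar>e\<bar>" if "0 \<le> x" "x \<le> n" "0 \<le> y" "y \<le> n" for e x y :: real
    proof -
      have "x * y \<le> real n * real n" using that by (intro mult_mono) auto
      moreover have "0 \<le> x * y" using that by simp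
      ultimately show ?thesis by (simp add: abs_mult power2_eq_square mult.commute[of "\<bar>e\<bar>"] mult_right_mono)
    qed
    have "block a b * block b c * block c a - W a b * W b c * W c a =
       - (err a b * (W b c * W c a)) - (err b c * (block a b * W c a)) - err c a * (block a b * block b c)"
      by (simp add: err_def algebra_simps)
    moreover have "\<bar>err a b * (W b c * W c a)\<bar> \<le> (real n)\<^sup>2 * \<bar>err a b\<bar>"
      by (intro b2 W_ge W_le abc)
    moreover have "\<bar>err b c * (block a b * W c a)\<bar> \<le> (real n)\<^sup>2 * \<bar>err b c\<bar>"
      by (intro b2 W_ge W_le abc block_bounds)
    moreover have "\<bar>err c a * (block a b * block b c)\<bar> \<le> (real n)\<^sup>2 * \<bar>err c a\<bar>"
      by (intro b2 block_bounds)
    ultimately show "block a b * block b c * block c a \<le> W a b * W b c * W c a + ((real n)\<^sup>2 * \<bar>err a b\<bar> + (real n)\<^sup>2 * \<bar>err b c\<bar> + (real n)\<^sup>2 * \<bar>err c a\<bar>)"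
      by linarith
  qed
  also have "\<dots> = (\<Sum>a<n. \<Sum>b<n. \<Sum>c<n. W a b * W b c * W c a) +
     ((\<Sum>a<n. \<Sum>b<n. \<Sum>c<n. (real n)\<^sup>2 * \<bar>err a b\<bar>) + (\<Sum>a<n. \<Sum>b<n. \<Sum>c<n. (real n)\<^sup>2 * \<bar>err b c\<bar>)
      + (\<Sum>a<n. \<Sum>b<n. \<Sum>c<n. (real n)\<^sup>2 * \<bar>err c a\<bar>))"
    by (simp add: sum.distrib)
  also have "(\<Sum>a<n. \<Sum>b<n. \<Sum>c<n. (real n)\<^sup>2 * \<bar>err a b\<bar>) = real n ^ 3 * ?S"
    by (simp add: sum_distrib_left power2_eq_square power3_eq_cube mult_ac)
  also have "(\<Sum>a<n. \<Sum>b<n. \<Sum>c<n. (real n)\<^sup>2 * \<bar>err b c\<bar>) = real n ^ 3 * ?S"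
    by (simp add: sum_distrib_left power2_eq_square power3_eq_cube mult_ac)
  also have "(\<Sum>a<n. \<Sum>b<n. \<Sum>c<n. (real n)\<^sup>2 * \<bar>err c a\<bar>) = (\<Sum>a<n. \<Sum>c<n. \<Sum>b<n. (real n)\<^sup>2 * \<bar>err c a\<bar>)"
    by (intro sum.cong refl sum.swap)
  also have "\<dots> = real n ^ 3 * (\<Sum>a<n. \<Sum>c<n. \<bar>err c a\<bar>)"
    by (simp add: sum_distrib_left power2_eq_square power3_eq_cube mult_ac)
  also have "(\<Sum>a<n. \<Sum>c<n. \<bar>err c a\<bar>) = ?S" by (rule sum.swap)
  also have "real n ^ 3 * ?S + real n ^ 3 * ?S + real n ^ 3 * ?S \<le> 3 * (real n ^ 3 * (\<eta> * real n ^ 3))"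
    using mult_left_mono[OF err_sum, of "real n ^ 3"] by simp
  also have "3 * (real n ^ 3 * (\<eta> * real n ^ 3)) = 3 * \<eta> * real n ^ 6"
    by (simp flip: power_add)
  finally show ?thesis by simp
qed

lemma err_form_le:
  assumes "(\<Sum>a<n. (u a)\<^sup>2) = 1"
  shows "(\<Sum>a<n. (\<Sum>b<n. err a b * u b)\<^sup>2) \<le> \<eta> * real n ^ 4"
proof -
  have "(\<Sum>a<n. (\<Sum>b<n. err a b * u b)\<^sup>2) \<le> (\<Sum>a<n. (\<Sum>b<n. (err a b)\<^sup>2) * (\<Sum>b<n. (u b)\<^sup>2))"
    by (intro sum_mono Cauchy_Schwarz_ineq_sum)
  then show ?thesis using assms err_square_sum by simp
qed

lemma block_mult: "(\<Sum>b<n. block a b * u b) = n / 2 * (\<Sum>b | b < n \<and> z b = z a. u b)"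
proof -
  have "(\<Sum>b<n. block a b * u b) = (\<Sum>b<n. n / 2 * (if z b = z a then u b else 0))"
    by (intro sum.cong refl) (auto simp: block_def)
  also have "\<dots> = n / 2 * (\<Sum>b<n. if z b = z a then u b else 0)" by (rule sum_distrib_left[symmetric])
  also have "(\<Sum>b<n. if z b = z a then u b else 0) = (\<Sum>b | b < n \<and> z b = z a. u b)"
    by (subst sum.inter_filter[symmetric]) auto
  finally show ?thesis .
qed

text \<open>
  Rayleigh quotient at the eigenvector itself: the block part is bounded by Cauchy-Schwarz on each
  block, the error by its Frobenius norm. The ideal value is \<open>n\<^sup>2/4\<close>.
\<close>

lemma eigenvalue_upper:
  assumes u: "(\<Sum>a<n. (u a)\<^sup>2) = 1" and ev: "\<And>a. a < n \<Longrightarrow> (\<Sum>b<n. W a b * u b) = lam * u a"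
  shows "lam \<le> (27 / 100) * (real n)\<^sup>2"
proof -
  let ?s = "\<lambda>t. \<Sum>b | b < n \<and> z b = t. u b"
  let ?q = "\<lambda>t. \<Sum>b | b < n \<and> z b = t. (u b)\<^sup>2"
  have split: "(\<Sum>a<n. f a) = (\<Sum>a | a < n \<and> z a = True. f a) + (\<Sum>a | a < n \<and> z a = False. f a)" for f :: "nat \<Rightarrow> real"
    by (subst sum.union_disjoint[symmetric]) (auto intro!: sum.cong)
  have "lam = (\<Sum>a<n. u a * (lam * u a))"
    using u by (simp add: power2_eq_square mult_ac sum_distrib_left[symmetric])
  also have "\<dots> = (\<Sum>a<n. u a * (\<Sum>b<n. W a b * u b))" by (intro sum.cong refl) (simp add: ev)
  also have "\<dots> = (\<Sum>a<n. u a * (\<Sum>b<n. block a b * u b)) + (\<Sum>a<n. u a * (\<Sum>b<n. err a b * u b))"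
  proof -
    have "(\<Sum>b<n. W a b * u b) = (\<Sum>b<n. block a b * u b) + (\<Sum>b<n. err a b * u b)" for a
      unfolding sum.distrib[symmetric] by (intro sum.cong refl) (simp add: err_def algebra_simps)
    then show ?thesis by (simp add: distrib_left sum.distrib)
  qed
  also have "(\<Sum>a<n. u a * (\<Sum>b<n. block a b * u b)) = n / 2 * ((?s True)\<^sup>2 + (?s False)\<^sup>2)"
  proof -
    have "(\<Sum>a | a < n \<and> z a = t. u a * (\<Sum>b<n. block a b * u b)) = n / 2 * (?s t)\<^sup>2" for t
    proof -
      have "(\<Sum>a | a < n \<and> z a = t. u a * (\<Sum>b<n. block a b * u b)) = (\<Sum>a | a < n \<and> z a = t. u a * (n / 2 * ?s t))"
        by (intro sum.cong refl) (simp add: block_mult)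
      also have "\<dots> = ?s t * (n / 2 * ?s t)" by (rule sum_distrib_right[symmetric])
      finally show ?thesis by (simp add: power2_eq_square)
    qed
    from this[of True] this[of False] show ?thesis
      unfolding split[of "\<lambda>a. u a * (\<Sum>b<n. block a b * u b)"] distrib_left by (simp only:)
  qed
  also have "n / 2 * ((?s True)\<^sup>2 + (?s False)\<^sup>2) \<le> n / 2 * ((1/2 + 1/10000) * n)"
  proof (intro mult_left_mono)
    have "(?s t)\<^sup>2 \<le> (1/2 + 1/10000) * n * ?q t" for t
    proof -
      have "(?s t)\<^sup>2 \<le> block_size t * ?q t"
        using Cauchy_Schwarz_ineq_sum[of "\<lambda>_. 1" u "{b. b < n \<and> z b = t}"] by (simp add: block_size_def)
      also have "\<dots> \<le> (1/2 + 1/10000) * n * ?q t"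
        using block_size_near[of t] mult_right_mono[OF eta(2), of n]
        by (intro mult_right_mono sum_nonneg) auto
      finally show ?thesis .
    qed
    from this[of True] this[of False] have "(?s True)\<^sup>2 + (?s False)\<^sup>2 \<le> (1/2 + 1/10000) * n * (?q True + ?q False)"
      by (simp only: distrib_left)
    also have "?q True + ?q False = 1" using u split[of "\<lambda>a. (u a)\<^sup>2"] by simp
    finally show "(?s True)\<^sup>2 + (?s False)\<^sup>2 \<le> (1/2 + 1/10000) * n" by simp
  qed auto
  also have "(\<Sum>a<n. u a * (\<Sum>b<n. err a b * u b)) \<le> (real n)\<^sup>2 / 100"
  proof -
    have "(\<Sum>a<n. u a * (\<Sum>b<n. err a b * u b))\<^sup>2 \<le> (\<Sum>a<n. (u a)\<^sup>2) * (\<Sum>a<n. (\<Sum>b<n. err a b * u b)\<^sup>2)"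
      by (rule Cauchy_Schwarz_ineq_sum)
    also have "\<dots> \<le> \<eta> * real n ^ 4" using err_form_le[OF u] u by simp
    also have "\<dots> \<le> 1 / 10000 * real n ^ 4" using eta by (intro mult_right_mono) auto
    also have "\<dots> = ((real n)\<^sup>2 / 100)\<^sup>2" by (simp add: power_divide)
    finally show ?thesis by (rule power2_le_imp_le) auto
  qed
  also have "n / 2 * ((1/2 + 1/10000) * n) + (real n)\<^sup>2 / 100 \<le> (27 / 100) * (real n)\<^sup>2"
    by (simp add: power2_eq_square)
  finally show ?thesis by simp
qed

text \<open>
  The third moment is at least almost \<open>n ^ 6 / 32\<close>, to which the top eigenvalue, being at most
  \<open>0.27 * n\<^sup>2\<close>, contributes less than \<open>0.02 * n ^ 6\<close>. The remainder can only come from the second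
  eigenvalue.
\<close>

lemma eigenvalue_lower:
  assumes upper: "l0 \<le> (27 / 100) * (real n)\<^sup>2"
    and m3: "(\<Sum>a<n. \<Sum>b<n. \<Sum>c<n. W a b * W b c * W c a) \<le> l0 ^ 3 + l1 * ((\<Sum>a<n. \<Sum>b<n. W a b * W b a) - l0 ^ 2)"
    and m2: "l0 ^ 2 \<le> (\<Sum>a<n. \<Sum>b<n. W a b * W b a)"
  shows "l1 \<ge> (real n)\<^sup>2 / 20"
proof (rule ccontr)
  let ?p2 = "\<Sum>a<n. \<Sum>b<n. W a b * W b a"
  assume neg: "\<not> l1 \<ge> (real n)\<^sup>2 / 20"
  have n: "real n > 0" using npos by simp
  have "l0 ^ 3 \<le> ((27 / 100) * (real n)\<^sup>2) ^ 3"
    using upper by (rule power_mono_odd[rotated]) simp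
  then have l03: "l0 ^ 3 \<le> (27/100)^3 * real n ^ 6"
    unfolding power_mult_distrib power_mult[symmetric] by simp
  have eta6: "3 * \<eta> * real n ^ 6 \<le> 3 / 10000 * real n ^ 6" using eta by (intro mult_right_mono) auto
  have eta4: "2 * \<eta> * real n ^ 4 \<le> 2 / 10000 * real n ^ 4" using eta by (intro mult_right_mono) auto
  \<comment> \<open>ideal values: \<open>l0 = n\<^sup>2/4\<close>, second moment \<open>n ^ 4 / 8\<close>, third moment \<open>n ^ 6 / 32\<close>\<close>
  have p2: "?p2 - l0 ^ 2 \<le> (1/8 + 2 / 1000) * real n ^ 4"
  proof -
    have "0 \<le> real n ^ 4" by simp
    moreover have "p - l \<le> (1/8 + 2 / 1000) * m"
      if "0 \<le> m" "p \<le> s + x" "s \<le> (1 / 8 + 1 / 1000) * m" "x \<le> 2 / 10000 * m" "0 \<le> l" for p l m s x :: real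
      using that by simp
    ultimately show ?thesis
      using second_moment_near block_second_moment eta4 zero_le_power2[of l0] by blast
  qed
  have "l1 * (?p2 - l0 ^ 2) \<le> (real n)\<^sup>2 / 20 * (?p2 - l0 ^ 2)"
    using neg m2 by (intro mult_right_mono) auto
  also have "\<dots> \<le> (real n)\<^sup>2 / 20 * ((1/8 + 2 / 1000) * real n ^ 4)"
    by (intro mult_left_mono p2) auto
  also have "\<dots> = (127/20000) * real n ^ 6" by (simp flip: power_add)
  finally have "l1 * (?p2 - l0 ^ 2) \<le> (127/20000) * real n ^ 6" .
  with m3 third_moment_near block_third_moment l03 eta6
  have "real n ^ 6 / 32 \<le> (27/100)^3 * real n ^ 6 + (127/20000) * real n ^ 6 + 3 / 10000 * real n ^ 6" by linarith
  moreover have "(27/100)^3 * real n ^ 6 + (127/20000) * real n ^ 6 + 3 / 10000 * real n ^ 6 < real n ^ 6 / 32"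
    using zero_less_power[OF n, of 6] by (simp add: power3_eq_cube)
  ultimately show False by linarith
qed

text \<open>
  \<open>block\<close> maps every vector to one that is constant on the blocks, so \<open>u = (block u + err u) / lam\<close> is
  within \<open>err u / lam\<close> of a block-constant vector.
\<close>

lemma eigenvector_near_block_constant:
  assumes u: "(\<Sum>a<n. (u a)\<^sup>2) = 1" and ev: "\<And>a. a < n \<Longrightarrow> (\<Sum>b<n. W a b * u b) = lam * u a"
    and lam: "(real n)\<^sup>2 / 20 \<le> lam"
  shows "\<exists>y :: bool \<Rightarrow> real. (\<Sum>a<n. (u a - y (z a))\<^sup>2) \<le> 400 * \<eta>"
proof
  let ?y = "\<lambda>t. n / 2 * (\<Sum>b | b < n \<and> z b = t. u b) / lam"
  have n: "real n > 0" using npos by simp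
  then have n2: "(real n)\<^sup>2 / 20 > 0" by simp
  have l: "lam > 0" by (rule less_le_trans[OF n2 lam])
  have "u a - ?y (z a) = (\<Sum>b<n. err a b * u b) / lam" if "a < n" for a
  proof -
    have "(\<Sum>b<n. err a b * u b) = lam * u a - n / 2 * (\<Sum>b | b < n \<and> z b = z a. u b)"
      unfolding ev[OF that, symmetric] block_mult[symmetric] by (simp add: err_def sum_subtractf[symmetric] algebra_simps)
    then show ?thesis using l by (simp add: diff_divide_distrib)
  qed
  then have "(\<Sum>a<n. (u a - ?y (z a))\<^sup>2) = (\<Sum>a<n. (\<Sum>b<n. err a b * u b)\<^sup>2 / lam\<^sup>2)"
    unfolding power_divide[symmetric] by (intro sum.cong refl) auto
  also have "\<dots> = (\<Sum>a<n. (\<Sum>b<n. err a b * u b)\<^sup>2) / lam\<^sup>2" by (rule sum_divide_distrib[symmetric])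
  finally have "(\<Sum>a<n. (u a - ?y (z a))\<^sup>2) = (\<Sum>a<n. (\<Sum>b<n. err a b * u b)\<^sup>2) / lam\<^sup>2" .
  also have "\<dots> \<le> \<eta> * real n ^ 4 / ((real n)\<^sup>2 / 20)\<^sup>2"
    using l n2 lam eta err_form_le[OF u] by (intro frac_le power_mono) auto
  also have "\<dots> = 400 * \<eta>" using n by (simp add: power_divide flip: power_mult)
  finally show "(\<Sum>a<n. (u a - ?y (z a))\<^sup>2) \<le> 400 * \<eta>" .
qed

end

section \<open>Clustering the rows of two leading eigenvectors\<close>

lemma orthogonal_unit_pair:
  fixes p q :: real
  obtains c d where "c\<^sup>2 + d\<^sup>2 = 1" "c * p + d * q = 0"
proof (cases "p = 0 \<and> q = 0")
  case True
  then show ?thesis using that[of 1 0] by simp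
next
  case False
  then have r: "p\<^sup>2 + q\<^sup>2 > 0" by (auto simp: sum_power2_gt_zero_iff)
  let ?r = "sqrt (p\<^sup>2 + q\<^sup>2)"
  show ?thesis
  proof (rule that[of "q / ?r" "- p / ?r"])
    show "(q / ?r)\<^sup>2 + (- p / ?r)\<^sup>2 = 1"
    proof -
      have "(q / ?r)\<^sup>2 + (- p / ?r)\<^sup>2 = (q\<^sup>2 + p\<^sup>2) / ?r\<^sup>2"
        by (simp add: power_divide add_divide_distrib)
      also have "?r\<^sup>2 = q\<^sup>2 + p\<^sup>2" using r by simp
      also have "(q\<^sup>2 + p\<^sup>2) / (q\<^sup>2 + p\<^sup>2) = 1" using r by (intro divide_self) linarith
      finally show ?thesis .
    qed
    show "q / ?r * p + - p / ?r * q = 0" by simp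
  qed
qed

lemma square_sum_le: "(p + q)\<^sup>2 \<le> 2 * p\<^sup>2 + 2 * q\<^sup>2" for p q :: real
  using zero_le_power2[of "p - q"] by (simp add: power2_eq_square algebra_simps)

text \<open>
  The block-constant approximations \<open>y0\<close>, \<open>y1\<close> of two orthonormal vectors cannot take nearly the same
  pair of values on both blocks: a unit combination of \<open>u0\<close> and \<open>u1\<close> whose approximation vanishes on
  one block still has norm one, and must get it from the other block.
\<close>

lemma block_rows_separated:
  fixes u0 u1 :: "nat \<Rightarrow> real" and y0 y1 :: "bool \<Rightarrow> real"
  assumes "(\<Sum>a<n. (u0 a)\<^sup>2) = 1" "(\<Sum>a<n. (u1 a)\<^sup>2) = 1" "(\<Sum>a<n. u0 a * u1 a) = 0"
    and near: "(\<Sum>a<n. (u0 a - y0 (z a))\<^sup>2) + (\<Sum>a<n. (u1 a - y1 (z a))\<^sup>2) \<le> \<kappa>"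
  shows "1 \<le> 2 * real n * ((y0 True - y0 False)\<^sup>2 + (y1 True - y1 False)\<^sup>2) + 2 * \<kappa>"
proof -
  \<comment> \<open>this combination of the two columns has an approximation vanishing on the block \<^term>\<open>True\<close>\<close>
  obtain c d where cd: "c\<^sup>2 + d\<^sup>2 = 1" "c * y0 True + d * y1 True = 0"
    by (rule orthogonal_unit_pair)
  let ?g = "(y0 True - y0 False)\<^sup>2 + (y1 True - y1 False)\<^sup>2"
  have CS: "(c * p + d * q)\<^sup>2 \<le> p\<^sup>2 + q\<^sup>2" for p q
  proof -
    have "(c * p + d * q)\<^sup>2 + (c * q - d * p)\<^sup>2 = (c\<^sup>2 + d\<^sup>2) * (p\<^sup>2 + q\<^sup>2)"
      by (simp add: power2_eq_square algebra_simps)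
    then have "(c * p + d * q)\<^sup>2 + (c * q - d * p)\<^sup>2 = p\<^sup>2 + q\<^sup>2" unfolding cd(1) by simp
    moreover have "0 \<le> (c * q - d * p)\<^sup>2" by (rule zero_le_power2)
    ultimately show ?thesis by linarith
  qed
  have g: "(c * y0 t + d * y1 t)\<^sup>2 \<le> ?g" for t
  proof (cases t)
    case False
    have "c * (y0 True - y0 False) + d * (y1 True - y1 False) = - (c * y0 False + d * y1 False)"
      using cd(2) by (simp add: algebra_simps)
    then have "(c * (y0 True - y0 False) + d * (y1 True - y1 False))\<^sup>2 = (c * y0 False + d * y1 False)\<^sup>2"
      by (simp only: power2_minus)
    with CS[of "y0 True - y0 False" "y1 True - y1 False"] False show ?thesis by simp
  qed (use cd(2) in simp)
  have "1 = (\<Sum>a<n. (c * u0 a + d * u1 a)\<^sup>2)"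
  proof -
    have "(\<Sum>a<n. (c * u0 a + d * u1 a)\<^sup>2) = c\<^sup>2 * (\<Sum>a<n. (u0 a)\<^sup>2) + d\<^sup>2 * (\<Sum>a<n. (u1 a)\<^sup>2) + 2 * c * d * (\<Sum>a<n. u0 a * u1 a)"
      unfolding sum_distrib_left sum.distrib[symmetric] by (intro sum.cong refl) (simp add: power2_eq_square algebra_simps)
    then show ?thesis using assms cd by simp
  qed
  also have "\<dots> \<le> (\<Sum>a<n. 2 * ?g + 2 * ((u0 a - y0 (z a))\<^sup>2 + (u1 a - y1 (z a))\<^sup>2))"
  proof (intro sum_mono)
    fix a
    let ?A = "c * y0 (z a) + d * y1 (z a)" and ?B = "c * (u0 a - y0 (z a)) + d * (u1 a - y1 (z a))"
    have "(c * u0 a + d * u1 a)\<^sup>2 = (?A + ?B)\<^sup>2" by (simp add: algebra_simps)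
    also have "\<dots> \<le> 2 * ?A\<^sup>2 + 2 * ?B\<^sup>2"
      by (rule square_sum_le)
    also have "\<dots> \<le> 2 * ?g + 2 * ((u0 a - y0 (z a))\<^sup>2 + (u1 a - y1 (z a))\<^sup>2)"
      by (intro add_mono mult_left_mono g CS) auto
    finally show "(c * u0 a + d * u1 a)\<^sup>2 \<le> 2 * ?g + 2 * ((u0 a - y0 (z a))\<^sup>2 + (u1 a - y1 (z a))\<^sup>2)" .
  qed
  also have "\<dots> = 2 * real n * ?g + 2 * ((\<Sum>a<n. (u0 a - y0 (z a))\<^sup>2) + (\<Sum>a<n. (u1 a - y1 (z a))\<^sup>2))"
    by (simp add: sum.distrib sum_distrib_left)
  finally show ?thesis using near by argo
qed

text \<open>
  Each centre \<open>(x0 k, x1 k)\<close> is far from the row of at least one block, so few vertices of that block are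
  assigned to it. If this were the same block for both centres, that block would be small.
\<close>

lemma two_means_misclassified:
  fixes x0 x1 y0 y1 :: "bool \<Rightarrow> real" and c z :: "nat \<Rightarrow> bool"
  assumes n: "0 < n"
    and sep: "1 / (4 * real n) \<le> (y0 True - y0 False)\<^sup>2 + (y1 True - y1 False)\<^sup>2"
    and err: "(\<Sum>a<n. (x0 (c a) - y0 (z a))\<^sup>2 + (x1 (c a) - y1 (z a))\<^sup>2) \<le> K"
    and big: "\<And>t. 32 * real n * K < real (card {a. a < n \<and> z a = t})"
  shows "real (card {a. a < n \<and> c a \<noteq> z a}) \<le> 32 * real n * K \<or> real (card {a. a < n \<and> c a = z a}) \<le> 32 * real n * K"
proof -
  let ?d = "\<lambda>k j. (x0 k - y0 j)\<^sup>2 + (x1 k - y1 j)\<^sup>2"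
  have far: "\<exists>j. 1 / (16 * real n) \<le> ?d k j" for k
  proof (rule ccontr)
    assume "\<nexists>j. 1 / (16 * real n) \<le> ?d k j"
    then have "?d k True < 1 / (16 * real n)" "?d k False < 1 / (16 * real n)" by (auto simp: not_le)
    moreover have "(y0 True - y0 False)\<^sup>2 + (y1 True - y1 False)\<^sup>2 \<le> 2 * ?d k True + 2 * ?d k False"
    proof -
      have "(p - q)\<^sup>2 \<le> 2 * (x - p)\<^sup>2 + 2 * (x - q)\<^sup>2" for p q x :: real
        using zero_le_power2[of "(x - p) + (x - q)"] by (simp add: power2_eq_square algebra_simps)
      from this[of "y0 True" "y0 False" "x0 k"] this[of "y1 True" "y1 False" "x1 k"] show ?thesis
        unfolding distrib_left by linarith
    qed
    ultimately have "(y0 True - y0 False)\<^sup>2 + (y1 True - y1 False)\<^sup>2 < 4 * (1 / (16 * real n))"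
      by argo
    then show False using sep by simp
  qed
  then obtain j where j: "\<And>k. 1 / (16 * real n) \<le> ?d k (j k)" by metis
  have few: "real (card {a. a < n \<and> c a = k \<and> z a = j k}) \<le> 16 * real n * K" for k
  proof -
    have "real (card {a. a < n \<and> c a = k \<and> z a = j k}) * (1 / (16 * real n)) = (\<Sum>a | a < n \<and> c a = k \<and> z a = j k. 1 / (16 * real n))"
      by simp
    also have "\<dots> \<le> (\<Sum>a | a < n \<and> c a = k \<and> z a = j k. ?d (c a) (z a))"
      by (intro sum_mono) (use j[of k] in auto)
    also have "\<dots> \<le> (\<Sum>a<n. ?d (c a) (z a))"
      by (intro sum_mono2) auto
    also have "\<dots> \<le> K" by (rule err)
    finally show ?thesis using n by (simp add: field_simps)
  qed
  have sub: "real (card X) \<le> 32 * real n * K"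
    if "X \<subseteq> {a. a < n \<and> c a = True \<and> z a = j True} \<union> {a. a < n \<and> c a = False \<and> z a = j False}" for X
  proof -
    have "card X \<le> card ({a. a < n \<and> c a = True \<and> z a = j True} \<union> {a. a < n \<and> c a = False \<and> z a = j False})"
      by (rule card_mono[OF _ that]) auto
    also have "\<dots> \<le> card {a. a < n \<and> c a = True \<and> z a = j True} + card {a. a < n \<and> c a = False \<and> z a = j False}"
      by (rule card_Un_le)
    finally show ?thesis using few[of True] few[of False] by linarith
  qed
  show ?thesis
  proof (cases "j True = j False")
    case True
    have "real (card {a. a < n \<and> z a = j True}) \<le> 32 * real n * K"
      by (rule sub) (use True in auto)
    with big[of "j True"] show ?thesis by linarith
  next
    case False
    show ?thesis
    proof (cases "j True")
      case True
      have "real (card {a. a < n \<and> c a = z a}) \<le> 32 * real n * K"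
        by (rule sub) (use True False in auto)
      then show ?thesis ..
    next
      case False': False
      have "real (card {a. a < n \<and> c a \<noteq> z a}) \<le> 32 * real n * K"
        by (rule sub) (use False' False in auto)
      then show ?thesis ..
    qed
  qed
qed

lemma membership_matrix_mult:
  assumes A: "A \<in> membership_matrices n" and B: "B \<in> carrier_mat 2 2" and "a < n" "k < 2"
  shows "(A * B) $$ (a, k) = B $$ (if A $$ (a, 0) = 1 then 0 else 1, k)"
    and "A $$ (a, 1) = 1 \<longleftrightarrow> A $$ (a, 0) \<noteq> 1"
proof -
  have Ac: "A \<in> carrier_mat n 2" and A01: "A $$ (a, 0) \<in> {0, 1}" "A $$ (a, 1) \<in> {0, 1}"
    using A assms(3) by (auto simp: membership_matrices_def)
  have "\<exists>!j. j < 2 \<and> A $$ (a, j) \<noteq> 0" using A assms(3) by (auto simp: membership_matrices_def)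
  then have u: "A $$ (a, 0) = 1 \<longleftrightarrow> A $$ (a, 1) = 0"
    using A01 by (metis One_nat_def insertE less_2_cases_iff singletonD zero_neq_one)
  then show "A $$ (a, 1) = 1 \<longleftrightarrow> A $$ (a, 0) \<noteq> 1" using A01 by auto
  have "(A * B) $$ (a, k) = A $$ (a, 0) * B $$ (0, k) + A $$ (a, 1) * B $$ (1, k)"
    using mat_mult_index_sum[OF Ac B assms(3,4)] by (simp add: numeral_2_eq_2)
  then show "(A * B) $$ (a, k) = B $$ (if A $$ (a, 0) = 1 then 0 else 1, k)"
    using u A01 by auto
qed

lemma frobenius_sq_diff:
  assumes "A \<in> carrier_mat n 2" "B \<in> carrier_mat n 2"
  shows "frobenius_sq (A - B) = (\<Sum>a<n. (A $$ (a, 0) - B $$ (a, 0))\<^sup>2 + (A $$ (a, 1) - B $$ (a, 1))\<^sup>2)"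
  using assms by (simp add: frobenius_sq_def numeral_2_eq_2)

text \<open>
  A block-constant matrix is a competitor in the 2-means problem.
\<close>

lemma approx_2means_cost:
  fixes z :: "nat \<Rightarrow> bool"
  assumes U: "U \<in> carrier_mat n 2" and ap: "approx_2means \<epsilon> U A B" and eps: "0 < \<epsilon>"
  shows "frobenius_sq (A * B - U) \<le> (1 + \<epsilon>) *
    (\<Sum>a<n. (y0 (z a) - U $$ (a, 0))\<^sup>2 + (y1 (z a) - U $$ (a, 1))\<^sup>2)"
proof -
  define A' where "A' = mat n 2 (\<lambda>(a, j). if (j = 0) = z a then 1 else 0 :: real)"
  define B' where "B' = mat 2 2 (\<lambda>(j, k). if k = 0 then y0 (j = 0) else y1 (j = 0))"
  have A': "A' \<in> membership_matrices n"
    unfolding membership_matrices_def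
  proof (intro CollectI conjI allI impI)
    fix a assume "a < n"
    then show "\<exists>!j. j < 2 \<and> A' $$ (a, j) \<noteq> 0"
      by (intro ex1I[of _ "if z a then 0 else 1"]) (auto simp: A'_def split: if_splits)
  qed (auto simp: A'_def)
  have B': "B' \<in> carrier_mat 2 2" by (simp add: B'_def)
  have "(A' * B') $$ (a, k) = (if k = 0 then y0 (z a) else y1 (z a))" if "a < n" "k < 2" for a k
    using membership_matrix_mult(1)[OF A' B' that] that by (auto simp: A'_def B'_def)
  moreover have "A' * B' \<in> carrier_mat n 2" using A' B' by (auto simp: membership_matrices_def)
  ultimately have cost: "frobenius_sq (A' * B' - U) = (\<Sum>a<n. (y0 (z a) - U $$ (a, 0))\<^sup>2 + (y1 (z a) - U $$ (a, 1))\<^sup>2)"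
    using U by (simp add: frobenius_sq_diff)
  have "(INF (A', B')\<in>membership_matrices (dim_row U) \<times> carrier_mat 2 2. frobenius_sq (A' * B' - U))
      \<le> (case (A', B') of (A', B') \<Rightarrow> frobenius_sq (A' * B' - U))"
  proof (rule cINF_lower)
    show "bdd_below ((\<lambda>(A', B'). frobenius_sq (A' * B' - U)) ` (membership_matrices (dim_row U) \<times> carrier_mat 2 2))"
      by (intro bdd_belowI[of _ 0]) (auto simp: frobenius_sq_def intro!: sum_nonneg)
    show "(A', B') \<in> membership_matrices (dim_row U) \<times> carrier_mat 2 2" using U A' B' by auto
  qed
  then have "(1 + \<epsilon>) * (INF (A', B')\<in>membership_matrices (dim_row U) \<times> carrier_mat 2 2. frobenius_sq (A' * B' - U))
      \<le> (1 + \<epsilon>) * frobenius_sq (A' * B' - U)"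
    using eps by (intro mult_left_mono) auto
  then show ?thesis using ap unfolding cost[symmetric] approx_2means_def by linarith
qed

text \<open>
  In squared Frobenius norm, \<open>U\<close> is within \<open>800 * \<eta>\<close> of a block-constant matrix, hence the computed
  clustering is within \<open>2 * (1 + \<epsilon>) * 800 * \<eta> + 2 * 800 * \<eta> = 1600 * (2 + \<epsilon>) * \<eta>\<close> of it. The remaining
  factor \<open>32\<close> comes from \<open>two_means_misclassified\<close>.
\<close>

lemma spectral_clustering_near_block:
  fixes W :: "real mat"
  assumes W: "W \<in> carrier_mat n n" and nb: "near_block n (\<lambda>a b. W $$ (a, b)) z \<eta>"
    and n2: "2 \<le> n"
    and le: "leading_eigenvectors W U" and ap: "approx_2means \<epsilon> U A B" and eps: "0 < \<epsilon>"
    and small: "51200 * (2 + \<epsilon>) * \<eta> \<le> 1 / 4"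
  shows "real (card {a. a < n \<and> (A $$ (a, 0) = 1) \<noteq> z a}) \<le> 51200 * (2 + \<epsilon>) * \<eta> * n \<or>
         real (card {a. a < n \<and> (A $$ (a, 0) = 1) = z a}) \<le> 51200 * (2 + \<epsilon>) * \<eta> * n"
proof -
  interpret near_block n "\<lambda>a b. W $$ (a, b)" z \<eta> by (rule nb)
  obtain ls where U: "U \<in> carrier_mat n 2" and orth: "transpose_mat U * U = 1\<^sub>m 2"
    and cp: "char_poly W = (\<Prod>l\<leftarrow>ls. [:- l, 1:])" and srt: "sorted_wrt (\<ge>) ls"
    and ev: "\<And>k. k < 2 \<Longrightarrow> eigenvector W (col U k) (ls ! k)"
    using le W unfolding leading_eigenvectors_def eigenvalue_list_def by auto
  have len: "length ls = n" by (rule length_eigenvalue_list[OF W cp])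
  have gram: "(\<Sum>a<n. U $$ (a, k) * U $$ (a, l)) = of_bool (k = l)" if "k < 2" "l < 2" for k l
  proof -
    have "(transpose_mat U * U) $$ (k, l) = (\<Sum>a<n. transpose_mat U $$ (k, a) * U $$ (a, l))"
      by (rule mat_mult_index_sum[where m = n]) (use U that in auto)
    also have "\<dots> = (\<Sum>a<n. U $$ (a, k) * U $$ (a, l))"
      using U that by (intro sum.cong refl) auto
    finally show ?thesis using that unfolding orth by auto
  qed
  have unit: "(\<Sum>a<n. (U $$ (a, k))\<^sup>2) = 1" if "k < 2" for k
    using gram[OF that that] by (simp add: power2_eq_square)
  have ev': "(\<Sum>b<n. W $$ (a, b) * U $$ (b, k)) = ls ! k * U $$ (a, k)" if "k < 2" "a < n" for k a
  proof -
    have "W *\<^sub>v col U k = ls ! k \<cdot>\<^sub>v col U k" using ev[OF that(1)] by (simp add: eigenvector_def)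
    then have "vec_index (W *\<^sub>v col U k) a = vec_index (ls ! k \<cdot>\<^sub>v col U k) a" by simp
    then show ?thesis using W U that by (auto simp: scalar_prod_def lessThan_atLeast0)
  qed
  have m: "(\<Sum>a<n. \<Sum>b<n. \<Sum>c<n. W $$ (a, b) * W $$ (b, c) * W $$ (c, a)) \<le> (ls ! 0) ^ 3 + (ls ! 1) * ((\<Sum>a<n. \<Sum>b<n. W $$ (a, b) * W $$ (b, a)) - (ls ! 0) ^ 2)"
    "(ls ! 0) ^ 2 \<le> (\<Sum>a<n. \<Sum>b<n. W $$ (a, b) * W $$ (b, a))"
    using third_moment_le[OF srt] len n2 unfolding eigenvalue_moments[OF W cp] by auto
  have l1: "(real n)\<^sup>2 / 20 \<le> ls ! 1"
    by (rule eigenvalue_lower[OF _ m]) (rule eigenvalue_upper[OF unit ev'], auto)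
  moreover have "ls ! 1 \<le> ls ! 0" using srt len n2 by (auto simp: sorted_wrt_iff_nth_less)
  ultimately have l0: "(real n)\<^sup>2 / 20 \<le> ls ! 0" by linarith
  obtain y0 where y0: "(\<Sum>a<n. (U $$ (a, 0) - y0 (z a))\<^sup>2) \<le> 400 * \<eta>"
    using eigenvector_near_block_constant[OF unit ev' l0] by auto
  obtain y1 where y1: "(\<Sum>a<n. (U $$ (a, 1) - y1 (z a))\<^sup>2) \<le> 400 * \<eta>"
    using eigenvector_near_block_constant[OF unit ev' l1] by auto
  have "1 \<le> 2 * real n * ((y0 True - y0 False)\<^sup>2 + (y1 True - y1 False)\<^sup>2) + 2 * (800 * \<eta>)"
    using y0 y1 gram[of 0 1, simplified] by (intro block_rows_separated[where z = z, OF unit unit]) auto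
  then have sep: "1 / (4 * real n) \<le> (y0 True - y0 False)\<^sup>2 + (y1 True - y1 False)\<^sup>2"
    using npos eta by (simp add: field_simps)
  let ?c = "\<lambda>a. A $$ (a, 0) = 1"
  define x0 where "x0 t = B $$ (if t then 0 else 1, 0)" for t
  define x1 where "x1 t = B $$ (if t then 0 else 1, 1)" for t
  have mem: "A \<in> membership_matrices n" "B \<in> carrier_mat 2 2" using ap U by (auto simp: approx_2means_def)
  then have AB: "A * B \<in> carrier_mat n 2" by (auto simp: membership_matrices_def)
  have ABx: "(A * B) $$ (a, 0) = x0 (?c a)" "(A * B) $$ (a, 1) = x1 (?c a)" if "a < n" for a
    using membership_matrix_mult(1)[OF mem that] by (auto simp: x0_def x1_def One_nat_def[symmetric] simp del: One_nat_def)
  have dist: "(\<Sum>a<n. (y0 (z a) - U $$ (a, 0))\<^sup>2 + (y1 (z a) - U $$ (a, 1))\<^sup>2) \<le> 800 * \<eta>"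
    using y0 y1 by (simp add: sum.distrib power2_commute)
  have cost: "(\<Sum>a<n. (x0 (?c a) - U $$ (a, 0))\<^sup>2 + (x1 (?c a) - U $$ (a, 1))\<^sup>2) \<le> (1 + \<epsilon>) * (800 * \<eta>)"
  proof -
    have "(\<Sum>a<n. (x0 (?c a) - U $$ (a, 0))\<^sup>2 + (x1 (?c a) - U $$ (a, 1))\<^sup>2) = frobenius_sq (A * B - U)"
      unfolding frobenius_sq_diff[OF AB U] by (intro sum.cong refl) (simp add: ABx del: One_nat_def)
    also have "\<dots> \<le> (1 + \<epsilon>) * (\<Sum>a<n. (y0 (z a) - U $$ (a, 0))\<^sup>2 + (y1 (z a) - U $$ (a, 1))\<^sup>2)"
      by (rule approx_2means_cost[OF U ap eps])
    also have "\<dots> \<le> (1 + \<epsilon>) * (800 * \<eta>)" using eps dist by (intro mult_left_mono) auto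
    finally show ?thesis .
  qed
  have K: "(\<Sum>a<n. (x0 (?c a) - y0 (z a))\<^sup>2 + (x1 (?c a) - y1 (z a))\<^sup>2) \<le> 1600 * (2 + \<epsilon>) * \<eta>"
  proof -
    have sq: "(p - q)\<^sup>2 \<le> 2 * (p - r)\<^sup>2 + 2 * (q - r)\<^sup>2" for p q r :: real
      using zero_le_power2[of "(p - r) + (q - r)"] by (simp add: power2_eq_square algebra_simps)
    have "(\<Sum>a<n. (x0 (?c a) - y0 (z a))\<^sup>2 + (x1 (?c a) - y1 (z a))\<^sup>2) \<le>
      (\<Sum>a<n. 2 * ((x0 (?c a) - U $$ (a, 0))\<^sup>2 + (x1 (?c a) - U $$ (a, 1))\<^sup>2) +
           2 * ((y0 (z a) - U $$ (a, 0))\<^sup>2 + (y1 (z a) - U $$ (a, 1))\<^sup>2))"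
    proof (intro sum_mono)
      fix a
      show "(x0 (?c a) - y0 (z a))\<^sup>2 + (x1 (?c a) - y1 (z a))\<^sup>2 \<le> 2 * ((x0 (?c a) - U $$ (a, 0))\<^sup>2 + (x1 (?c a) - U $$ (a, 1))\<^sup>2) +
           2 * ((y0 (z a) - U $$ (a, 0))\<^sup>2 + (y1 (z a) - U $$ (a, 1))\<^sup>2)"
        using sq[of "x0 (?c a)" "y0 (z a)" "U $$ (a, 0)"] sq[of "x1 (?c a)" "y1 (z a)" "U $$ (a, 1)"]
        unfolding distrib_left by linarith
    qed
    also have "\<dots> = 2 * (\<Sum>a<n. (x0 (?c a) - U $$ (a, 0))\<^sup>2 + (x1 (?c a) - U $$ (a, 1))\<^sup>2) +
           2 * (\<Sum>a<n. (y0 (z a) - U $$ (a, 0))\<^sup>2 + (y1 (z a) - U $$ (a, 1))\<^sup>2)"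
      unfolding sum.distrib[of "\<lambda>a. 2 * _ a"] sum_distrib_left ..
    also have "\<dots> \<le> 2 * ((1 + \<epsilon>) * (800 * \<eta>)) + 2 * (800 * \<eta>)" using cost dist by linarith
    finally show ?thesis by (simp add: algebra_simps)
  qed
  have eqC: "32 * real n * (1600 * (2 + \<epsilon>) * \<eta>) = 51200 * (2 + \<epsilon>) * \<eta> * n" by simp
  have big: "51200 * (2 + \<epsilon>) * \<eta> * n < real (card {a. a < n \<and> z a = t})" for t
  proof -
    have "51200 * (2 + \<epsilon>) * \<eta> * n \<le> 1 / 4 * n" using small by (intro mult_right_mono) auto
    moreover have "\<eta> * n \<le> 1 / 10000 * n" using eta by (intro mult_right_mono) auto
    moreover have "0 < real n" using npos by simp
    moreover have "\<bar>real (card {a. a < n \<and> z a = t}) - real n / 2\<bar> \<le> \<eta> * real n"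
      using block_size_near[of t] by (simp only: block_size_def)
    ultimately show ?thesis by argo
  qed
  show ?thesis
    using two_means_misclassified[OF npos sep K] big unfolding eqC by blast
qed

section \<open>From misjudged triples to the similarity matrix\<close>

lemma bij_betw_vertex: "finite S \<Longrightarrow> bij_betw (vertex S) {..<card S} S"
  unfolding vertex_def by (rule bij_betw_nth) auto

lemma sum_vertex: "finite S \<Longrightarrow> (\<Sum>a<card S. f (vertex S a)) = sum f S"
  by (rule sum.reindex_bij_betw[OF bij_betw_vertex])

lemma card_vertex: "finite S \<Longrightarrow> card {a. a < card S \<and> Q (vertex S a)} = card {i \<in> S. Q i}"
proof -
  assume S: "finite S"
  have inj: "inj_on (vertex S) {..<card S}" and im: "vertex S ` {..<card S} = S"
    using bij_betw_vertex[OF S] by (auto simp: bij_betw_def)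
  have "card (vertex S ` {a. a < card S \<and> Q (vertex S a)}) = card {a. a < card S \<and> Q (vertex S a)}"
    by (intro card_image inj_on_subset[OF inj]) auto
  moreover have "vertex S ` {a. a < card S \<and> Q (vertex S a)} = {i \<in> vertex S ` {..<card S}. Q i}"
    by blast
  ultimately show ?thesis by (simp add: im)
qed

text \<open>
  Ordered triples, so that sums over \<open>i\<close>, \<open>j\<close>, \<open>k\<close> need no combinatorial factors.
\<close>

definition distinct_triples :: "nat set \<Rightarrow> (nat \<times> nat \<times> nat) set" where
  "distinct_triples S = {(i, j, k) \<in> S \<times> S \<times> S. i \<noteq> j \<and> i \<noteq> k \<and> j \<noteq> k}"

definition misjudged :: "nat set \<Rightarrow> nat set set \<Rightarrow> (nat \<Rightarrow> bool) \<Rightarrow> (nat \<times> nat \<times> nat) set" where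
  "misjudged S H z = {(i, j, k) \<in> distinct_triples S. ({i, j, k} \<in> H) \<noteq> (z i = z j \<and> z j = z k)}"

lemma finite_distinct_triples: "finite S \<Longrightarrow> finite (distinct_triples S)"
  by (rule finite_subset[of _ "S \<times> S \<times> S"]) (auto simp: distinct_triples_def)

text \<open>
  A hyperedge through \<open>i\<close> and \<open>j\<close> is determined by its third vertex.
\<close>

lemma card_hyperedges_through_pair:
  assumes "finite S" "H \<subseteq> {\<tau>. \<tau> \<subseteq> S \<and> card \<tau> = 3}" "i \<in> S" "j \<in> S" "i \<noteq> j"
  shows "card {\<tau> \<in> H. i \<in> \<tau> \<and> j \<in> \<tau>} = card {k \<in> S. k \<noteq> i \<and> k \<noteq> j \<and> {i, j, k} \<in> H}"
proof -
  have "bij_betw (\<lambda>k. {i, j, k}) {k \<in> S. k \<noteq> i \<and> k \<noteq> j \<and> {i, j, k} \<in> H} {\<tau> \<in> H. i \<in> \<tau> \<and> j \<in> \<tau>}"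
    unfolding bij_betw_def
  proof
    show "inj_on (\<lambda>k. {i, j, k}) {k \<in> S. k \<noteq> i \<and> k \<noteq> j \<and> {i, j, k} \<in> H}"
      by (auto simp: inj_on_def doubleton_eq_iff insert_eq_iff)
    show "(\<lambda>k. {i, j, k}) ` {k \<in> S. k \<noteq> i \<and> k \<noteq> j \<and> {i, j, k} \<in> H} = {\<tau> \<in> H. i \<in> \<tau> \<and> j \<in> \<tau>}"
    proof (intro equalityI subsetI)
      fix \<tau> assume "\<tau> \<in> {\<tau> \<in> H. i \<in> \<tau> \<and> j \<in> \<tau>}"
      then have \<tau>: "\<tau> \<in> H" "i \<in> \<tau>" "j \<in> \<tau>" "\<tau> \<subseteq> S" "card \<tau> = 3" using assms(2) by auto
      then have "finite \<tau>" using assms(1) finite_subset by blast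
      then have "card (\<tau> - {i, j}) = 1" using \<tau> assms(5) by (simp add: card_Diff_subset)
      then obtain k where k: "\<tau> - {i, j} = {k}" by (rule card_1_singletonE)
      then have "\<tau> = {i, j, k}" "k \<noteq> i" "k \<noteq> j" "k \<in> S" using \<tau> by auto
      then show "\<tau> \<in> (\<lambda>k. {i, j, k}) ` {k \<in> S. k \<noteq> i \<and> k \<noteq> j \<and> {i, j, k} \<in> H}"
        using \<tau>(1) by (intro image_eqI[of _ _ k]) auto
    qed auto
  qed
  from bij_betw_same_card[OF this] show ?thesis by simp
qed

definition codegree :: "nat set set \<Rightarrow> nat set \<Rightarrow> nat \<Rightarrow> nat \<Rightarrow> nat" where
  "codegree H S i j = card {k \<in> S. i \<noteq> j \<and> k \<noteq> i \<and> k \<noteq> j \<and> {i, j, k} \<in> H}"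

lemma similarity_matrix_codegree:
  assumes "finite S" "H \<subseteq> {\<tau>. \<tau> \<subseteq> S \<and> card \<tau> = 3}" "a < card S" "b < card S"
  shows "similarity_matrix H S $$ (a, b) = real (codegree H S (vertex S a) (vertex S b))"
proof -
  have inj: "inj_on (vertex S) {..<card S}" and im: "vertex S ` {..<card S} = S"
    using bij_betw_vertex[OF assms(1)] by (auto simp: bij_betw_def)
  show ?thesis
  proof (cases "a = b")
    case True
    then show ?thesis using assms by (simp add: similarity_matrix_def codegree_def)
  next
    case False
    then have "vertex S a \<noteq> vertex S b" using inj assms by (auto simp: inj_on_def)
    moreover have "vertex S a \<in> S" "vertex S b \<in> S" using im assms by auto
    ultimately show ?thesis
      using assms False card_hyperedges_through_pair[OF assms(1,2)]
      by (simp add: similarity_matrix_def codegree_def)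
  qed
qed

lemma degenerate_triples_card:
  assumes S: "finite S"
  shows "(\<Sum>i\<in>S. \<Sum>j\<in>S. \<Sum>k\<in>S. of_bool (\<not> (i \<noteq> j \<and> i \<noteq> k \<and> j \<noteq> k))) \<le> 3 * (real (card S))\<^sup>2"
proof -
  have "(\<Sum>i\<in>S. \<Sum>j\<in>S. \<Sum>k\<in>S. of_bool (\<not> (i \<noteq> j \<and> i \<noteq> k \<and> j \<noteq> k))) \<le>
     (\<Sum>i\<in>S. \<Sum>j\<in>S. \<Sum>k\<in>S. of_bool (i = j) + of_bool (i = k) + of_bool (j = k) :: real)"
    by (intro sum_mono) auto
  also have "\<dots> = (\<Sum>i\<in>S. \<Sum>j\<in>S. \<Sum>k\<in>S. of_bool (i = j)) + (\<Sum>i\<in>S. \<Sum>j\<in>S. \<Sum>k\<in>S. of_bool (i = k))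
    + (\<Sum>i\<in>S. \<Sum>j\<in>S. \<Sum>k\<in>S. of_bool (j = k))"
    by (simp only: sum.distrib)
  also have "(\<Sum>i\<in>S. \<Sum>j\<in>S. \<Sum>k\<in>S. of_bool (i = j) :: real) = (real (card S))\<^sup>2"
    using S by (simp add: of_bool_def sum_distrib_left[symmetric] sum.delta power2_eq_square)
  also have "(\<Sum>i\<in>S. \<Sum>j\<in>S. \<Sum>k\<in>S. of_bool (i = k) :: real) = (real (card S))\<^sup>2"
    using S by (simp add: of_bool_def sum.delta power2_eq_square)
  also have "(\<Sum>i\<in>S. \<Sum>j\<in>S. \<Sum>k\<in>S. of_bool (j = k) :: real) = (real (card S))\<^sup>2"
    using S by (simp add: of_bool_def sum.delta power2_eq_square)
  finally show ?thesis by simp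
qed

lemma of_bool_diff_le:
  "\<bar>of_bool (D \<and> h) - of_bool q :: real\<bar> \<le> of_bool (D \<and> h \<noteq> q) + of_bool (\<not> D)"
  by (cases D; cases h; cases q) simp_all

text \<open>
  If no triple were misjudged, the codegree of \<open>i\<close> and \<open>j\<close> would count the vertices sharing their common
  label, up to the degenerate triples with a repeated index, of which there are at most \<open>3 * n\<^sup>2\<close>.
\<close>

lemma codegree_near_block:
  assumes S: "finite S"
  shows "(\<Sum>i\<in>S. \<Sum>j\<in>S. \<bar>real (codegree H S i j) - of_bool (z i = z j) * real (card {k \<in> S. z k = z i})\<bar>)
    \<le> real (card (misjudged S H z)) + 3 * (real (card S))\<^sup>2"
proof -
  let ?D = "\<lambda>i j k. i \<noteq> j \<and> i \<noteq> k \<and> j \<noteq> k"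
  let ?B = "\<lambda>i j k. ?D i j k \<and> ({i, j, k} \<in> H) \<noteq> (z i = z j \<and> z j = z k)"
  have "(\<Sum>i\<in>S. \<Sum>j\<in>S. \<bar>real (codegree H S i j) - of_bool (z i = z j) * real (card {k \<in> S. z k = z i})\<bar>)
     \<le> (\<Sum>i\<in>S. \<Sum>j\<in>S. \<Sum>k\<in>S. of_bool (?B i j k) + of_bool (\<not> ?D i j k))"
  proof (intro sum_mono)
    fix i j
    have "real (codegree H S i j) = (\<Sum>k\<in>S. of_bool (?D i j k \<and> {i, j, k} \<in> H))"
      using S by (auto simp: codegree_def of_bool_def sum.If_cases intro!: arg_cong[of _ _ card])
    moreover have "of_bool (z i = z j) * real (card {k \<in> S. z k = z i}) = (\<Sum>k\<in>S. of_bool (z i = z j \<and> z k = z i))"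
      using S by (auto simp: of_bool_def sum.If_cases intro!: arg_cong[of _ _ card])
    ultimately have "\<bar>real (codegree H S i j) - of_bool (z i = z j) * real (card {k \<in> S. z k = z i})\<bar>
       = \<bar>\<Sum>k\<in>S. of_bool (?D i j k \<and> {i, j, k} \<in> H) - of_bool (z i = z j \<and> z k = z i)\<bar>"
      by (simp only: sum_subtractf)
    also have "\<dots> \<le> (\<Sum>k\<in>S. \<bar>of_bool (?D i j k \<and> {i, j, k} \<in> H) - of_bool (z i = z j \<and> z k = z i)\<bar>)"
      by (rule sum_abs)
    also have "\<dots> \<le> (\<Sum>k\<in>S. of_bool (?B i j k) + of_bool (\<not> ?D i j k))"
    proof (intro sum_mono)
      fix k
      have "(z i = z j \<and> z k = z i) = (z i = z j \<and> z j = z k)" by auto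
      then show "\<bar>of_bool (?D i j k \<and> {i, j, k} \<in> H) - of_bool (z i = z j \<and> z k = z i) :: real\<bar> \<le> of_bool (?B i j k) + of_bool (\<not> ?D i j k)"
        by (simp only: of_bool_diff_le)
    qed
    finally show "\<bar>real (codegree H S i j) - of_bool (z i = z j) * real (card {k \<in> S. z k = z i})\<bar>
      \<le> (\<Sum>k\<in>S. of_bool (?B i j k) + of_bool (\<not> ?D i j k))" .
  qed
  also have "\<dots> = (\<Sum>i\<in>S. \<Sum>j\<in>S. \<Sum>k\<in>S. of_bool (?B i j k)) + (\<Sum>i\<in>S. \<Sum>j\<in>S. \<Sum>k\<in>S. of_bool (\<not> ?D i j k))"
    by (simp only: sum.distrib)
  also have "(\<Sum>i\<in>S. \<Sum>j\<in>S. \<Sum>k\<in>S. of_bool (?B i j k) :: real) = real (card (misjudged S H z))"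
  proof -
    have "(\<Sum>i\<in>S. \<Sum>j\<in>S. \<Sum>k\<in>S. of_bool (?B i j k) :: real) = (\<Sum>(i, j, k)\<in>S \<times> S \<times> S. of_bool (?B i j k))"
      by (simp only: sum.cartesian_product)
    also have "\<dots> = (\<Sum>p\<in>S \<times> S \<times> S. if p \<in> misjudged S H z then 1 else 0)"
    proof (intro sum.cong refl)
      fix p assume p: "p \<in> S \<times> S \<times> S"
      obtain i j k where ijk: "p = (i, j, k)" by (cases p)
      have "p \<in> misjudged S H z \<longleftrightarrow> ?B i j k"
        using p unfolding ijk misjudged_def distinct_triples_def by blast
      then show "(case p of (i, j, k) \<Rightarrow> of_bool (?B i j k)) = (if p \<in> misjudged S H z then 1 else 0 :: real)"
        unfolding ijk by (simp only: prod.case of_bool_def)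
    qed
    also have "\<dots> = real (card (S \<times> S \<times> S \<inter> misjudged S H z))"
      using S by (simp add: sum.If_cases)
    also have "S \<times> S \<times> S \<inter> misjudged S H z = misjudged S H z"
      by (auto simp: misjudged_def distinct_triples_def)
    finally show ?thesis .
  qed
  finally show ?thesis using degenerate_triples_card[OF S] by linarith
qed

lemma similarity_matrix_near_block:
  fixes \<beta> \<gamma> :: real
  assumes S: "finite S" "0 < card S" and H: "H \<subseteq> {\<tau>. \<tau> \<subseteq> S \<and> card \<tau> = 3}"
    and bad: "real (card (misjudged S H z)) + 3 * (real (card S))\<^sup>2 \<le> \<beta> * real (card S) ^ 3"
    and bal: "\<bar>real (card {i \<in> S. z i}) - card S / 2\<bar> \<le> \<gamma> * card S"
    and small: "0 \<le> \<gamma>" "0 \<le> \<beta>" "\<beta> + \<gamma> \<le> 1 / 10000"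
  shows "near_block (card S) (\<lambda>a b. similarity_matrix H S $$ (a, b)) (\<lambda>a. z (vertex S a)) (\<beta> + \<gamma>)"
proof
  let ?n = "card S"
  let ?W = "\<lambda>i j. real (codegree H S i j)"
  note W = similarity_matrix_codegree[OF S(1) H]
  show "0 < ?n" by (rule S)
  fix a b assume ab: "a < ?n" "b < ?n"
  show "0 \<le> similarity_matrix H S $$ (a, b)" by (simp add: W ab)
  have "codegree H S i j \<le> ?n" for i j
    unfolding codegree_def by (rule card_mono) (use S in auto)
  then show "similarity_matrix H S $$ (a, b) \<le> ?n" by (simp add: W ab)
next
  let ?n = "card S"
  let ?W = "\<lambda>i j. real (codegree H S i j)"
  note W = similarity_matrix_codegree[OF S(1) H]
  have tot: "card {i \<in> S. z i} + card {i \<in> S. \<not> z i} = ?n"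
  proof -
    have "card ({i \<in> S. z i} \<union> {i \<in> S. \<not> z i}) = card {i \<in> S. z i} + card {i \<in> S. \<not> z i}"
      by (rule card_Un_disjoint) (use S in auto)
    moreover have "{i \<in> S. z i} \<union> {i \<in> S. \<not> z i} = S" by auto
    ultimately show ?thesis by simp
  qed
  have bal': "\<bar>real (card {k \<in> S. z k = t}) - ?n / 2\<bar> \<le> \<gamma> * ?n" for t
    using bal tot by (cases t) auto
  have "(\<Sum>a<?n. \<Sum>b<?n. \<bar>similarity_matrix H S $$ (a, b) - ?n / 2 * of_bool (z (vertex S a) = z (vertex S b))\<bar>)
     = (\<Sum>a<?n. \<Sum>b<?n. \<bar>?W (vertex S a) (vertex S b) - ?n / 2 * of_bool (z (vertex S a) = z (vertex S b))\<bar>)"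
    by (simp add: W)
  also have "\<dots> = (\<Sum>i\<in>S. \<Sum>j\<in>S. \<bar>?W i j - ?n / 2 * of_bool (z i = z j)\<bar>)"
    by (simp only: sum_vertex[OF S(1), symmetric])
  also have "\<dots> \<le> (\<Sum>i\<in>S. \<Sum>j\<in>S. \<bar>?W i j - of_bool (z i = z j) * real (card {k \<in> S. z k = z i})\<bar> + \<gamma> * ?n)"
  proof (intro sum_mono)
    fix i j
    have "\<bar>of_bool (z i = z j) * real (card {k \<in> S. z k = z i}) - ?n / 2 * of_bool (z i = z j)\<bar> \<le> \<gamma> * ?n"
      using bal'[of "z i"] small by (cases "z i = z j") auto
    then show "\<bar>?W i j - ?n / 2 * of_bool (z i = z j)\<bar> \<le> \<bar>?W i j - of_bool (z i = z j) * real (card {k \<in> S. z k = z i})\<bar> + \<gamma> * ?n"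
      by linarith
  qed
  also have "\<dots> = (\<Sum>i\<in>S. \<Sum>j\<in>S. \<bar>?W i j - of_bool (z i = z j) * real (card {k \<in> S. z k = z i})\<bar>) + \<gamma> * real ?n ^ 3"
    by (simp add: sum.distrib power3_eq_cube)
  also have "\<dots> \<le> (\<beta> + \<gamma>) * real ?n ^ 3"
    using codegree_near_block[OF S(1), of H z] bad by (simp add: distrib_right)
  finally show "(\<Sum>a<?n. \<Sum>b<?n. \<bar>similarity_matrix H S $$ (a, b) - ?n / 2 * of_bool (z (vertex S a) = z (vertex S b))\<bar>) \<le> (\<beta> + \<gamma>) * real ?n ^ 3" .
  have "\<bar>real (card {a. a < ?n \<and> z (vertex S a)}) - ?n / 2\<bar> \<le> \<gamma> * ?n"
    using bal by (simp add: card_vertex[OF S(1), of z])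
  also have "\<dots> \<le> (\<beta> + \<gamma>) * ?n" using small by (intro mult_right_mono) auto
  finally show "\<bar>real (card {a. a < ?n \<and> z (vertex S a)}) - ?n / 2\<bar> \<le> (\<beta> + \<gamma>) * ?n" .
qed (use small in auto)

lemma spectral_method_near_block:
  assumes sm: "spectral_method x S t \<epsilon> lab" and S: "finite S" "2 \<le> card S"
    and nb: "near_block (card S) (\<lambda>a b. similarity_matrix (tls_hyperedges x t S) S $$ (a, b)) (\<lambda>a. z (vertex S a)) \<eta>"
    and eps: "0 < \<epsilon>" and small: "51200 * (2 + \<epsilon>) * \<eta> \<le> 1 / 4"
  shows "real (card {i \<in> S. (lab i = 1) \<noteq> z i}) \<le> 51200 * (2 + \<epsilon>) * \<eta> * card S \<or>
         real (card {i \<in> S. (lab i = 1) = z i}) \<le> 51200 * (2 + \<epsilon>) * \<eta> * card S"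
proof -
  obtain U A B where le: "leading_eigenvectors (similarity_matrix (tls_hyperedges x t S) S) U"
    and ap: "approx_2means \<epsilon> U A B"
    and lab: "\<forall>a<card S. \<forall>k\<in>{1, 2}. lab (vertex S a) = k \<longleftrightarrow> A $$ (a, k - 1) = 1"
    using sm unfolding spectral_method_def by blast
  have W: "similarity_matrix (tls_hyperedges x t S) S \<in> carrier_mat (card S) (card S)"
    by (simp add: similarity_matrix_def)
  have lab1: "A $$ (a, 0) = 1 \<longleftrightarrow> lab (vertex S a) = 1" if "a < card S" for a
    using lab that by force
  have "{a. a < card S \<and> (A $$ (a, 0) = 1) \<noteq> z (vertex S a)} = {a. a < card S \<and> (lab (vertex S a) = 1) \<noteq> z (vertex S a)}"
    "{a. a < card S \<and> (A $$ (a, 0) = 1) = z (vertex S a)} = {a. a < card S \<and> (lab (vertex S a) = 1) = z (vertex S a)}"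
    using lab1 by auto
  note eq = this
  show ?thesis
    using spectral_clustering_near_block[OF W nb S(2) le ap eps small]
    unfolding eq card_vertex[OF S(1), of "\<lambda>i. (lab i = 1) \<noteq> z i"] card_vertex[OF S(1), of "\<lambda>i. (lab i = 1) = z i"] .
qed

lemma ham_card: "ham N z w = card {i \<in> {1..N}. z i \<noteq> w i}"
  by (simp add: ham_def of_bool_def sum.If_cases Int_def)

text \<open>
  Swapping the two names turns agreements into disagreements, and each vertex outside \<open>S\<close> costs at most
  one error under either naming.
\<close>

lemma ham_star_le_subset:
  assumes S: "S \<subseteq> {1..N}" and l: "\<And>i. i \<in> {1..N} \<Longrightarrow> lab i \<in> {1, 2}" "\<And>i. i \<in> {1..N} \<Longrightarrow> Z i \<in> {1, 2}"
  shows "ham_star N lab Z \<le> min (card {i \<in> S. (lab i = 1) \<noteq> (Z i = 1)}) (card {i \<in> S. (lab i = 1) = (Z i = 1)}) + (N - card S)"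
proof -
  have fin: "finite S" using S finite_subset by blast
  have cS: "card ({1..N} - S) = N - card S" using S fin by (simp add: card_Diff_subset)
  have "{i \<in> {1..N}. lab i \<noteq> Z i} \<subseteq> {i \<in> S. (lab i = 1) \<noteq> (Z i = 1)} \<union> ({1..N} - S)"
    using l by fastforce
  then have "card {i \<in> {1..N}. lab i \<noteq> Z i} \<le> card ({i \<in> S. (lab i = 1) \<noteq> (Z i = 1)} \<union> ({1..N} - S))"
    using fin by (intro card_mono) auto
  also have "\<dots> \<le> card {i \<in> S. (lab i = 1) \<noteq> (Z i = 1)} + (N - card S)"
    unfolding cS[symmetric] by (rule card_Un_le)
  finally have 1: "ham N lab Z \<le> card {i \<in> S. (lab i = 1) \<noteq> (Z i = 1)} + (N - card S)"
    by (simp only: ham_card)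
  have "{1..N} = {i \<in> {1..N}. lab i \<noteq> Z i} \<union> {i \<in> {1..N}. lab i = Z i}" by auto
  then have "N \<le> card {i \<in> {1..N}. lab i \<noteq> Z i} + card {i \<in> {1..N}. lab i = Z i}"
    by (metis (no_types, lifting) card_Un_le card_atLeastAtMost diff_Suc_1)
  then have "N - ham N lab Z \<le> card {i \<in> {1..N}. lab i = Z i}" by (simp add: ham_card)
  also have "{i \<in> {1..N}. lab i = Z i} \<subseteq> {i \<in> S. (lab i = 1) = (Z i = 1)} \<union> ({1..N} - S)"
    using l by fastforce
  then have "card {i \<in> {1..N}. lab i = Z i} \<le> card ({i \<in> S. (lab i = 1) = (Z i = 1)} \<union> ({1..N} - S))"
    using fin by (intro card_mono) auto
  also have "\<dots> \<le> card {i \<in> S. (lab i = 1) = (Z i = 1)} + (N - card S)"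
    unfolding cS[symmetric] by (rule card_Un_le)
  finally have 2: "N - ham N lab Z \<le> card {i \<in> S. (lab i = 1) = (Z i = 1)} + (N - card S)" .
  show ?thesis unfolding ham_star_def using 1 2 by linarith
qed

text \<open>
  All closeness parameters are expressed by the single \<open>\<gamma>\<close>. Passing from \<open>N\<close> to \<open>n \<ge> N/2\<close> turns
  \<open>\<gamma> * N ^ 3\<close> misjudged triples into \<open>8 * \<gamma> * n ^ 3\<close>; degenerate triples add \<open>\<gamma> * n ^ 3\<close>, and the imbalance
  of the labels \<open>4 * \<gamma>\<close>. This gives the factor \<open>13\<close>.
\<close>

lemma spectral_method_recovers:
  fixes \<gamma> :: real
  assumes sm: "spectral_method x S t \<epsilon> lab" and S: "S \<subseteq> {1..N}" "N - card S \<le> \<gamma> * N"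
    and l: "\<And>i. i \<in> {1..N} \<Longrightarrow> lab i \<in> {1, 2}" "\<And>i. i \<in> {1..N} \<Longrightarrow> Z i \<in> {1, 2}"
    and bad: "real (card {(i, j, k) \<in> distinct_triples {1..N}. (tls_residual x {i, j, k} \<le> t) \<noteq> (Z i = Z j \<and> Z j = Z k)}) \<le> \<gamma> * real N ^ 3"
    and bal: "\<bar>real (card {i \<in> {1..N}. Z i = 1}) - N / 2\<bar> \<le> \<gamma> * N"
    and eps: "0 < \<epsilon>" and N: "6 \<le> \<gamma> * N" and small: "51200 * (2 + \<epsilon>) * (13 * \<gamma>) \<le> 1 / 4"
  shows "ham_star N lab Z \<le> (51200 * (2 + \<epsilon>) * 13 + 1) * \<gamma> * N"
proof -
  let ?n = "card S" and ?z = "\<lambda>i. Z i = 1" and ?H = "tls_hyperedges x t S"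
  have fin: "finite S" using S finite_subset by blast
  have "0 < \<gamma> * N" using N by linarith
  then have Npos: "real N > 0" and g0: "0 < \<gamma>"
    by (auto simp: zero_less_mult_iff)
  have "51200 * (2 + \<epsilon>) * (13 * \<gamma>) \<ge> 51200 * 2 * (13 * \<gamma>)"
    using eps g0 by (intro mult_right_mono mult_left_mono) auto
  then have g: "13 * \<gamma> \<le> 1 / 10000" using small by linarith
  have nN: "?n \<le> N" using card_mono[OF _ S(1)] by simp
  have "\<gamma> * N \<le> 1 / 130000 * N" using g by (intro mult_right_mono) auto
  then have n2: "real ?n \<ge> N / 2" using S(2) nN by (simp add: of_nat_diff)
  have "N \<ge> 6" using N \<open>\<gamma> * N \<le> 1 / 130000 * N\<close> by simp
  then have n3: "2 \<le> ?n" "0 < ?n" using n2 by linarith+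
  have mis: "misjudged S ?H ?z \<subseteq> {(i, j, k) \<in> distinct_triples {1..N}. (tls_residual x {i, j, k} \<le> t) \<noteq> (Z i = Z j \<and> Z j = Z k)}"
  proof clarify
    fix i j k assume "(i, j, k) \<in> misjudged S ?H ?z"
    then have d: "i \<in> S" "j \<in> S" "k \<in> S" "i \<noteq> j" "i \<noteq> k" "j \<noteq> k"
      and m: "({i, j, k} \<in> ?H) \<noteq> ((Z i = 1) = (Z j = 1) \<and> (Z j = 1) = (Z k = 1))"
      by (auto simp: misjudged_def distinct_triples_def)
    have "card {i, j, k} = 3" using d by simp
    then have "{i, j, k} \<in> ?H \<longleftrightarrow> tls_residual x {i, j, k} \<le> t" using d by (simp add: tls_hyperedges_def)
    moreover have "i \<in> {1..N}" "j \<in> {1..N}" "k \<in> {1..N}" using d S(1) by auto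
    then have "((Z i = 1) = (Z j = 1) \<and> (Z j = 1) = (Z k = 1)) \<longleftrightarrow> (Z i = Z j \<and> Z j = Z k)"
      using l(2)[of i] l(2)[of j] l(2)[of k] by auto
    moreover have "(i, j, k) \<in> distinct_triples {1..N}" using d S(1) by (auto simp: distinct_triples_def)
    ultimately show "(i, j, k) \<in> distinct_triples {1..N} \<and> (tls_residual x {i, j, k} \<le> t) \<noteq> (Z i = Z j \<and> Z j = Z k)"
      using m by blast
  qed
  have "card (misjudged S ?H ?z) \<le> card {(i, j, k) \<in> distinct_triples {1..N}. (tls_residual x {i, j, k} \<le> t) \<noteq> (Z i = Z j \<and> Z j = Z k)}"
    by (rule card_mono[OF finite_subset[OF _ finite_distinct_triples[of "{1..N}"]] mis]) auto
  then have "real (card (misjudged S ?H ?z)) \<le> \<gamma> * real N ^ 3" using bad by linarith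
  also have "\<dots> \<le> \<gamma> * (2 * real ?n) ^ 3" using n2 g0 by (intro mult_left_mono power_mono) auto
  also have "\<dots> = 8 * \<gamma> * real ?n ^ 3" by (simp add: power_mult_distrib)
  finally have b1: "real (card (misjudged S ?H ?z)) \<le> 8 * \<gamma> * real ?n ^ 3" .
  have "3 \<le> \<gamma> * ?n"
  proof -
    have "\<gamma> * (N / 2) \<le> \<gamma> * ?n" using n2 g0 by (intro mult_left_mono) auto
    then show ?thesis using N by argo
  qed
  then have "3 * (real ?n)\<^sup>2 \<le> \<gamma> * ?n * (real ?n)\<^sup>2" by (intro mult_right_mono) auto
  also have "\<dots> = \<gamma> * real ?n ^ 3" by (simp add: power2_eq_square power3_eq_cube)
  finally have b: "real (card (misjudged S ?H ?z)) + 3 * (real ?n)\<^sup>2 \<le> (9 * \<gamma>) * real ?n ^ 3"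
    using b1 by simp
  have "\<bar>real (card {i \<in> S. Z i = 1}) - real ?n / 2\<bar> \<le> 2 * (\<gamma> * N)"
  proof -
    have "card {i \<in> S. Z i = 1} \<le> card {i \<in> {1..N}. Z i = 1}"
      by (rule card_mono) (use S in auto)
    moreover have "card {i \<in> {1..N}. Z i = 1} \<le> card ({i \<in> S. Z i = 1} \<union> ({1..N} - S))"
      by (rule card_mono) (use fin in auto)
    moreover have "card ({i \<in> S. Z i = 1} \<union> ({1..N} - S)) \<le> card {i \<in> S. Z i = 1} + (N - ?n)"
      using card_Un_le[of "{i \<in> S. Z i = 1}" "{1..N} - S"] S fin by (simp add: card_Diff_subset)
    ultimately show ?thesis using bal S(2) nN by (simp add: of_nat_diff)
  qed
  also have "\<dots> \<le> (4 * \<gamma>) * ?n"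
  proof -
    have "\<gamma> * (N / 2) \<le> \<gamma> * ?n" using n2 g0 by (intro mult_left_mono) auto
    then show ?thesis by argo
  qed
  finally have bal': "\<bar>real (card {i \<in> S. Z i = 1}) - real ?n / 2\<bar> \<le> (4 * \<gamma>) * ?n" .
  have "near_block ?n (\<lambda>a b. similarity_matrix ?H S $$ (a, b)) (\<lambda>a. Z (vertex S a) = 1) (9 * \<gamma> + 4 * \<gamma>)"
    by (rule similarity_matrix_near_block[OF fin n3(2) _ b bal']) (use g g0 in \<open>auto simp: tls_hyperedges_def\<close>)
  then have nb: "near_block ?n (\<lambda>a b. similarity_matrix ?H S $$ (a, b)) (\<lambda>a. Z (vertex S a) = 1) (13 * \<gamma>)" by simp
  let ?C = "51200 * (2 + \<epsilon>) * (13 * \<gamma>)"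
  have "real (min (card {i \<in> S. (lab i = 1) \<noteq> (Z i = 1)}) (card {i \<in> S. (lab i = 1) = (Z i = 1)})) \<le> ?C * ?n"
    using spectral_method_near_block[OF sm fin n3(1) nb eps small] by auto
  also have "\<dots> \<le> ?C * N" using nN eps g0 by (intro mult_left_mono) auto
  finally have "real (min (card {i \<in> S. (lab i = 1) \<noteq> (Z i = 1)}) (card {i \<in> S. (lab i = 1) = (Z i = 1)})) \<le> ?C * N" .
  moreover have "real (ham_star N lab Z) \<le> real (min (card {i \<in> S. (lab i = 1) \<noteq> (Z i = 1)}) (card {i \<in> S. (lab i = 1) = (Z i = 1)})) + real (N - ?n)"
    using ham_star_le_subset[OF S(1) l] by (simp only: of_nat_add[symmetric] of_nat_le_iff)
  ultimately have "real (ham_star N lab Z) \<le> ?C * N + \<gamma> * N" using S(2) by linarith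
  then show ?thesis by (simp add: algebra_simps)
qed

section \<open>The TLS residual of three points\<close>

type_synonym plane = "real ^ 2"

text \<open>
  Twice the signed area of the triangle with vertices \<open>0\<close>, \<open>p\<close> and \<open>q\<close>.
\<close>

definition cross :: "plane \<Rightarrow> plane \<Rightarrow> real" where
  "cross p q = vec_nth p 1 * vec_nth q 2 - vec_nth p 2 * vec_nth q 1"

lemma cross_add: "cross (p + p') q = cross p q + cross p' q" "cross p (q + q') = cross p q + cross p q'"
  and cross_scale: "cross (c *\<^sub>R p) q = c * cross p q" "cross p (c *\<^sub>R q) = c * cross p q"
  and cross_self: "cross p p = 0"
  by (auto simp: cross_def algebra_simps)

lemma cross_anticommute: "cross p q = - cross q p"
  by (simp add: cross_def)

lemma inner_plane: "inner p q = vec_nth p 1 * vec_nth q 1 + vec_nth p 2 * vec_nth q 2" for p q :: plane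
  by (simp add: inner_vec_def sum_2)

lemma lagrange_plane: "(cross p q)\<^sup>2 + (inner p q)\<^sup>2 = (norm p)\<^sup>2 * (norm q)\<^sup>2"
  unfolding power2_norm_eq_inner inner_plane cross_def by (simp add: power2_eq_square algebra_simps)

lemma cross_le: "\<bar>cross p q\<bar> \<le> norm p * norm q"
proof -
  have "(cross p q)\<^sup>2 \<le> (norm p * norm q)\<^sup>2"
    unfolding power_mult_distrib lagrange_plane[of p q, symmetric] by simp
  then show ?thesis by (metis abs_le_square_iff abs_mult abs_norm_cancel)
qed

lemma cross_nonzero_of_angle:
  assumes "0 < \<alpha>" "\<alpha> < pi" "norm (v 1) = 1" "norm (v 2) = 1" "meet_at_angle \<alpha> (span {v 1}) (span {v (2::nat)})"
  shows "cross (v 1) (v 2) \<noteq> 0"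
proof
  assume 0: "cross (v 1) (v 2) = 0"
  obtain u1 u2 where u: "norm u1 = 1" "norm u2 = 1" "span {v 1} = span {u1}" "span {v 2} = span {u2}"
    "inner u1 u2 = cos \<alpha>"
    using assms(5) unfolding meet_at_angle_def by blast
  have "v 1 \<in> span {u1}" "v 2 \<in> span {u2}" using u span_base[of "v 1" "{v 1}"] span_base[of "v 2" "{v 2}"] by auto
  then obtain c d where cd: "v 1 = c *\<^sub>R u1" "v 2 = d *\<^sub>R u2" by (auto simp: span_singleton)
  then have "\<bar>c\<bar> = 1" "\<bar>d\<bar> = 1" using u assms by auto
  then have "(inner (v 1) (v 2))\<^sup>2 = (cos \<alpha>)\<^sup>2" using u cd
    by (auto simp: power_mult_distrib abs_square_eq_1[symmetric])
  moreover have "(inner (v 1) (v 2))\<^sup>2 = 1" using lagrange_plane[of "v 1" "v 2"] 0 assms by simp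
  ultimately have "(sin \<alpha>)\<^sup>2 = 0" using sin_cos_squared_add[of \<alpha>] by simp
  then show False using sin_gt_zero[OF assms(1,2)] by simp
qed

lemma plane_lines_affine_hull: "a \<noteq> b \<Longrightarrow> affine hull {a, b} \<in> plane_lines"
  by (simp add: plane_lines_def)

lemma plane_lines_nonempty: "plane_lines \<noteq> {}"
  using plane_lines_affine_hull[of 0 "axis 1 1"] by (auto simp: axis_eq_0_iff)

lemma plane_line_nonempty: "L \<in> plane_lines \<Longrightarrow> L \<noteq> {}"
  by (auto simp: plane_lines_def)

lemma cross_collinear:
  assumes "L \<in> plane_lines" "p \<in> L" "q \<in> L" "r \<in> L"
  shows "cross (q - p) (r - p) = 0"
proof -
  have "collinear L" using assms(1) by (simp add: collinear_aff_dim plane_lines_def)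
  then obtain u where u: "\<forall>x\<in>L. \<forall>y\<in>L. \<exists>c. x - y = c *\<^sub>R u" unfolding collinear_def by blast
  obtain c d where "q - p = c *\<^sub>R u" "r - p = d *\<^sub>R u" using u assms by blast
  then show ?thesis by (simp add: cross_scale cross_self)
qed

text \<open>
  A version of \<open>tls_residual < s\<close> with all three distances bounded separately, which is stable under
  perturbing and permuting the points.
\<close>

definition near_line :: "real \<Rightarrow> plane \<Rightarrow> plane \<Rightarrow> plane \<Rightarrow> bool" where
  "near_line s a b c \<longleftrightarrow> (\<exists>L\<in>plane_lines. infdist a L < s \<and> infdist b L < s \<and> infdist c L < s)"

lemma infdist_less_witness:
  assumes "infdist x A < s" "A \<noteq> {}"
  obtains a where "a \<in> A" "dist x a < s"
  using assms by (auto simp: infdist_notempty cINF_less_iff)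

text \<open>
  Points on a common line span a triangle of area zero, and the area depends continuously on the
  points.
\<close>

lemma near_line_cross_le:
  assumes "near_line s a b c" and R: "norm a \<le> R" "norm b \<le> R" "norm c \<le> R"
  shows "\<bar>cross (b - a) (c - a)\<bar> \<le> 2 * s * (4 * R + 2 * s)"
proof -
  obtain L where L: "L \<in> plane_lines" "infdist a L < s" "infdist b L < s" "infdist c L < s"
    using assms(1) unfolding near_line_def by blast
  note ne = plane_line_nonempty[OF L(1)]
  obtain p where p: "p \<in> L" "dist a p < s" using infdist_less_witness[OF L(2) ne] .
  obtain q where q: "q \<in> L" "dist b q < s" using infdist_less_witness[OF L(3) ne] .
  obtain r where r: "r \<in> L" "dist c r < s" using infdist_less_witness[OF L(4) ne] .
  have s: "0 < s" using p(2) by (smt (verit) zero_le_dist)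
  define e where "e = (b - q) - (a - p)"
  define f where "f = (c - r) - (a - p)"
  have e: "norm e \<le> 2 * s" and f: "norm f \<le> 2 * s"
    using norm_triangle_ineq4[of "b - q" "a - p"] norm_triangle_ineq4[of "c - r" "a - p"] p q r
    by (auto simp: e_def f_def dist_norm)
  have ba: "norm (b - a) \<le> 2 * R" and ca: "norm (c - a) \<le> 2 * R"
    using norm_triangle_ineq4[of b a] norm_triangle_ineq4[of c a] R by auto
  have eq: "b - a = (q - p) + e" "c - a = (r - p) + f" by (auto simp: e_def f_def)
  have qp: "norm (q - p) \<le> 2 * R + 2 * s"
    using norm_triangle_ineq4[of "b - a" e] ba e unfolding eq(1) by simp
  have "cross (b - a) (c - a) = cross (q - p) (r - p) + cross (q - p) f + cross e (c - a)"
    by (subst eq(1), subst (1) eq(2)) (simp add: cross_add eq(2))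
  also have "cross (q - p) (r - p) = 0" by (rule cross_collinear[OF L(1) p(1) q(1) r(1)])
  finally have "\<bar>cross (b - a) (c - a)\<bar> \<le> \<bar>cross (q - p) f\<bar> + \<bar>cross e (c - a)\<bar>" by linarith
  also have "\<bar>cross (q - p) f\<bar> \<le> (2 * R + 2 * s) * (2 * s)"
    by (rule order_trans[OF cross_le]) (intro mult_mono qp f order_trans[OF norm_ge_zero qp], auto)
  also have "\<bar>cross e (c - a)\<bar> \<le> (2 * s) * (2 * R)"
    by (rule order_trans[OF cross_le]) (intro mult_mono e ca, use s in auto)
  finally show ?thesis by (simp add: algebra_simps)
qed

lemma near_line_perturb:
  assumes "near_line s a b c" "dist a a' \<le> e" "dist b b' \<le> e" "dist c c' \<le> e"
  shows "near_line (s + e) a' b' c'"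
proof -
  obtain L where L: "L \<in> plane_lines" "infdist a L < s" "infdist b L < s" "infdist c L < s"
    using assms(1) unfolding near_line_def by blast
  have "infdist a' L < s + e" "infdist b' L < s + e" "infdist c' L < s + e"
    using infdist_triangle[of a' L a] infdist_triangle[of b' L b] infdist_triangle[of c' L c] L assms
    by (auto simp: dist_commute)
  then show ?thesis using L(1) unfolding near_line_def by blast
qed

lemma near_line_permute: "near_line s a b c \<Longrightarrow> near_line s b c a" "near_line s a b c \<Longrightarrow> near_line s a c b"
  by (auto simp: near_line_def)

text \<open>
  The area of a triangle with two vertices on one line through the origin and one on another
  factors, so a mixed triple is nearly collinear only if \<open>w1\<close> and \<open>w2\<close> are close or \<open>w3\<close> is small.
\<close>

lemma near_line_two_lines:
  assumes nl: "near_line s (w1 *\<^sub>R u) (w2 *\<^sub>R u) (w3 *\<^sub>R u')" and u: "norm u = 1" "norm u' = 1"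
    and w: "\<bar>w1\<bar> \<le> R" "\<bar>w2\<bar> \<le> R" "\<bar>w3\<bar> \<le> R"
  shows "\<bar>w2 - w1\<bar> * \<bar>w3\<bar> * \<bar>cross u u'\<bar> \<le> 2 * s * (4 * R + 2 * s)"
proof -
  have "cross (w2 *\<^sub>R u - w1 *\<^sub>R u) (w3 *\<^sub>R u' - w1 *\<^sub>R u) = (w2 - w1) * (w3 * cross u u')"
    by (simp add: cross_def algebra_simps)
  then show ?thesis using near_line_cross_le[OF nl, of R] u w by (simp add: abs_mult mult.assoc)
qed

text \<open>
  The residual as a function of three points, for which measurability and laws can be stated.
\<close>

definition tls3 :: "plane \<times> plane \<times> plane \<Rightarrow> real" where
  "tls3 = (\<lambda>(a, b, c). sqrt (INF L\<in>plane_lines. (infdist a L)\<^sup>2 + (infdist b L)\<^sup>2 + (infdist c L)\<^sup>2))"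

lemma tls_residual_triple:
  assumes "i \<noteq> j" "i \<noteq> k" "j \<noteq> k"
  shows "tls_residual x {i, j, k} = tls3 (x i, x j, x k)"
  using assms by (simp add: tls_residual_def tls3_def add.assoc)

lemma tls3_bdd: "bdd_below ((\<lambda>L. (infdist a L)\<^sup>2 + (infdist b L)\<^sup>2 + (infdist c L)\<^sup>2) ` plane_lines)"
  by (intro bdd_belowI[of _ 0]) auto

lemma tls3_nonneg: "0 \<le> tls3 p"
proof -
  obtain a b c where p: "p = (a, b, c)" by (cases p)
  have "0 \<le> (INF L\<in>plane_lines. (infdist a L)\<^sup>2 + (infdist b L)\<^sup>2 + (infdist c L)\<^sup>2)"
    by (rule cINF_greatest[OF plane_lines_nonempty]) auto
  then show ?thesis by (simp add: p tls3_def)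
qed

lemma tls3_less_iff:
  assumes "0 < r"
  shows "tls3 (a, b, c) < r \<longleftrightarrow> (\<exists>L\<in>plane_lines. (infdist a L)\<^sup>2 + (infdist b L)\<^sup>2 + (infdist c L)\<^sup>2 < r\<^sup>2)"
proof -
  have "tls3 (a, b, c) < r \<longleftrightarrow> (INF L\<in>plane_lines. (infdist a L)\<^sup>2 + (infdist b L)\<^sup>2 + (infdist c L)\<^sup>2) < r\<^sup>2"
    unfolding tls3_def prod.case using assms by (subst real_sqrt_less_iff[symmetric]) simp
  then show ?thesis by (simp add: cINF_less_iff[OF plane_lines_nonempty tls3_bdd])
qed

lemma near_line_of_tls3:
  assumes "tls3 (a, b, c) < r"
  shows "near_line r a b c"
proof -
  have r: "0 < r" using assms tls3_nonneg[of "(a, b, c)"] by linarith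
  obtain L where L: "L \<in> plane_lines" "(infdist a L)\<^sup>2 + (infdist b L)\<^sup>2 + (infdist c L)\<^sup>2 < r\<^sup>2"
    using assms tls3_less_iff[OF r] by blast
  have "(infdist a L)\<^sup>2 < r\<^sup>2" "(infdist b L)\<^sup>2 < r\<^sup>2" "(infdist c L)\<^sup>2 < r\<^sup>2"
    using L(2) zero_le_power2[of "infdist a L"] zero_le_power2[of "infdist b L"] zero_le_power2[of "infdist c L"] by linarith+
  then have "infdist a L < r" "infdist b L < r" "infdist c L < r"
    using r by (auto intro: power2_less_imp_less)
  then show ?thesis using L(1) unfolding near_line_def by blast
qed

lemma tls3_le:
  assumes "L \<in> plane_lines" "infdist a L \<le> s" "infdist b L \<le> s" "infdist c L \<le> s"
  shows "tls3 (a, b, c) \<le> 2 * s"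
proof -
  have s: "0 \<le> s" using assms(2) infdist_nonneg[of a L] by linarith
  have "(infdist a L)\<^sup>2 \<le> s\<^sup>2" "(infdist b L)\<^sup>2 \<le> s\<^sup>2" "(infdist c L)\<^sup>2 \<le> s\<^sup>2"
    using assms by (auto intro!: power_mono infdist_nonneg)
  moreover have "(INF L\<in>plane_lines. (infdist a L)\<^sup>2 + (infdist b L)\<^sup>2 + (infdist c L)\<^sup>2) \<le> (infdist a L)\<^sup>2 + (infdist b L)\<^sup>2 + (infdist c L)\<^sup>2"
    by (rule cINF_lower[OF tls3_bdd assms(1)])
  moreover have "0 \<le> s\<^sup>2" "(2 * s)\<^sup>2 = 4 * s\<^sup>2" by (simp_all add: power_mult_distrib)
  ultimately have "(INF L\<in>plane_lines. (infdist a L)\<^sup>2 + (infdist b L)\<^sup>2 + (infdist c L)\<^sup>2) \<le> (2 * s)\<^sup>2"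
    by argo
  then show ?thesis unfolding tls3_def prod.case using s by (simp add: real_le_lsqrt)
qed

lemma span_plane_line: "u \<noteq> 0 \<Longrightarrow> span {u} \<in> plane_lines"
  by (simp add: plane_lines_def subspace_imp_affine aff_dim_subspace)

text \<open>
  The line spanned by \<open>u\<close> itself is a competitor. The factor \<open>2\<close> rounds up \<open>sqrt 3\<close>.
\<close>

lemma tls3_pure_le:
  assumes "u \<noteq> 0" "norm y1 \<le> s" "norm y2 \<le> s" "norm y3 \<le> s"
  shows "tls3 (w1 *\<^sub>R u + y1, w2 *\<^sub>R u + y2, w3 *\<^sub>R u + y3) \<le> 2 * s"
proof -
  have "infdist (w *\<^sub>R u + y) (span {u}) \<le> norm y" for w y
    using infdist_le[of "w *\<^sub>R u" "span {u}" "w *\<^sub>R u + y"] by (auto simp: span_mul span_base dist_norm)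
  then show ?thesis using assms
    by (intro tls3_le[OF span_plane_line[OF assms(1)]]) (auto intro: order_trans)
qed

lemma tls3_near_origin_le:
  assumes "norm a \<le> s" "norm b \<le> s" "norm c \<le> s"
  shows "tls3 (a, b, c) \<le> 2 * s"
  using tls3_pure_le[of "axis 1 1" a s b c 0 0 0] assms by (simp add: axis_eq_0_iff)

text \<open>
  An infimum over uncountably many lines; the strict sublevel sets are nevertheless open, being
  unions of open sets.
\<close>

lemma tls3_measurable [measurable]: "tls3 \<in> borel_measurable (borel \<Otimes>\<^sub>M borel \<Otimes>\<^sub>M borel)"
proof -
  have "tls3 \<in> borel_measurable (borel :: (plane \<times> plane \<times> plane) measure)"
    unfolding borel_measurable_iff_less
  proof
    fix r :: real
    show "{p \<in> space borel. tls3 p < r} \<in> sets borel"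
    proof (cases "0 < r")
      case False
      then have "\<not> tls3 p < r" for p using tls3_nonneg[of p] by linarith
      then have "{p \<in> space borel. tls3 p < r} = {}" by blast
      then show ?thesis by (simp only: sets.empty_sets)
    next
      case True
      let ?f = "\<lambda>L (p :: plane \<times> plane \<times> plane). (infdist (fst p) L)\<^sup>2 + (infdist (fst (snd p)) L)\<^sup>2 + (infdist (snd (snd p)) L)\<^sup>2"
      have "{p \<in> space borel. tls3 p < r} = (\<Union>L\<in>plane_lines. {p. ?f L p < r\<^sup>2})"
        using tls3_less_iff[OF True] by auto
      moreover have "open (\<Union>L\<in>plane_lines. {p. ?f L p < r\<^sup>2})"
        by (intro open_UN ballI open_Collect_less continuous_intros)
      ultimately show ?thesis by (simp only: borel_open)
    qed
  qed
  then show ?thesis by (simp add: borel_prod)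
qed

section \<open>The model as a product of independent sites\<close>

text \<open>
  Fubini in the coordinates of the standard basis.
\<close>

lemma prob_space_std_gaussian: "prob_space std_gaussian"
proof
  let ?d = "\<lambda>y :: plane. ennreal (\<Prod>i\<in>UNIV. std_normal_density (vec_nth y i))"
  have d[measurable]: "?d \<in> borel_measurable borel" by (intro measurable_compose[OF _ measurable_ennreal] borel_measurable_prod) measurable
  have comp: "vec_nth (\<Sum>b\<in>Basis. f b *\<^sub>R b) i = f (axis i 1)" for f :: "plane \<Rightarrow> real" and i :: 2
    by (simp add: cart_eq_inner_axis inner_sum_left inner_Basis if_distrib[of "\<lambda>x. _ * x"] sum.delta cong: if_cong)
  have bij: "bij_betw (\<lambda>i :: 2. axis i (1 :: real)) UNIV Basis"
    by (auto simp: bij_betw_def inj_on_def axis_eq_axis Basis_vec_def)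
  interpret L: product_sigma_finite "\<lambda>b :: plane. lborel :: real measure" by standard
  have one: "(\<integral>\<^sup>+ x. ennreal (std_normal_density x) \<partial>lborel) = 1"
    using prob_space.emeasure_space_1[OF prob_space_normal_density[of 1 0]] by (simp add: emeasure_density)
  have "emeasure std_gaussian (space std_gaussian) = (\<integral>\<^sup>+ y. ?d y \<partial>lborel)"
    unfolding std_gaussian_def by (simp add: emeasure_density)
  also have "\<dots> = (\<integral>\<^sup>+ f. ?d (\<Sum>b\<in>Basis. f b *\<^sub>R b) \<partial>(\<Pi>\<^sub>M b\<in>Basis. lborel))"
    by (subst lborel_eq) (simp add: nn_integral_distr)
  also have "\<dots> = (\<integral>\<^sup>+ f. (\<Prod>b\<in>Basis. ennreal (std_normal_density (f b))) \<partial>(\<Pi>\<^sub>M b\<in>(Basis :: plane set). lborel))"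
  proof (intro nn_integral_cong)
    fix f :: "plane \<Rightarrow> real"
    have "?d (\<Sum>b\<in>Basis. f b *\<^sub>R b) = (\<Prod>i\<in>(UNIV :: 2 set). ennreal (std_normal_density (f (axis i 1))))"
      unfolding comp by (rule prod_ennreal[symmetric]) simp
    also have "\<dots> = (\<Prod>b\<in>(Basis :: plane set). ennreal (std_normal_density (f b)))"
      by (rule prod.reindex_bij_betw[OF bij])
    finally show "?d (\<Sum>b\<in>Basis. f b *\<^sub>R b) = (\<Prod>b\<in>(Basis :: plane set). ennreal (std_normal_density (f b)))" .
  qed
  also have "\<dots> = (\<Prod>b\<in>(Basis :: plane set). \<integral>\<^sup>+ x. ennreal (std_normal_density x) \<partial>lborel)"
    by (rule L.product_nn_integral_prod) auto
  also have "\<dots> = 1" by (simp add: one)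
  finally show "emeasure std_gaussian (space std_gaussian) = 1" .
qed

lemma sets_std_gaussian [measurable_cong, simp]: "sets std_gaussian = sets borel"
  by (simp add: std_gaussian_def)

definition label_measure :: "nat measure" where
  "label_measure = measure_pmf (pmf_of_set {1, 2})"

lemma sets_label_measure [measurable_cong, simp]: "sets label_measure = sets (count_space UNIV)"
  by (simp add: label_measure_def)

lemma prob_space_label_measure: "prob_space label_measure"
  unfolding label_measure_def by (rule prob_space_measure_pmf)

lemma measure_label: "measure label_measure {1} = 1 / 2" "measure label_measure {2} = 1 / 2" "measure label_measure {1, 2} = 1"
  by (auto simp: label_measure_def measure_pmf_of_set)

definition site :: "real measure \<Rightarrow> (nat \<times> real \<times> plane) measure" where
  "site \<nu> = label_measure \<Otimes>\<^sub>M \<nu> \<Otimes>\<^sub>M std_gaussian"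

definition point :: "(nat \<Rightarrow> plane) \<Rightarrow> real \<Rightarrow> nat \<times> real \<times> plane \<Rightarrow> plane" where
  "point v \<sigma> = (\<lambda>(z, w, y). w *\<^sub>R v z + \<sigma> *\<^sub>R y)"

lemma nn_integral_PiM_Times:
  fixes f :: "'i \<Rightarrow> 'a \<times> 'b \<Rightarrow> ennreal"
  assumes A: "prob_space A" and B: "prob_space B" and I: "finite I"
    and f: "\<And>i. i \<in> I \<Longrightarrow> f i \<in> borel_measurable (A \<Otimes>\<^sub>M B)"
  shows "(\<integral>\<^sup>+ p. (\<Prod>i\<in>I. f i (fst p i, snd p i)) \<partial>(PiM I (\<lambda>_. A) \<Otimes>\<^sub>M PiM I (\<lambda>_. B)))
    = (\<Prod>i\<in>I. \<integral>\<^sup>+ p. f i p \<partial>(A \<Otimes>\<^sub>M B))"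
proof -
  interpret A: prob_space A by (rule A)
  interpret B: prob_space B by (rule B)
  interpret PA: product_sigma_finite "\<lambda>_. A" by standard
  interpret PB: product_sigma_finite "\<lambda>_. B" by standard
  interpret FA: prob_space "PiM I (\<lambda>_. A)" by (intro prob_space_PiM A)
  interpret FB: prob_space "PiM I (\<lambda>_. B)" by (intro prob_space_PiM B)
  have f': "(\<lambda>y. f i (x, y)) \<in> borel_measurable B" if "i \<in> I" "x \<in> space A" for i x
    using f[OF that(1)] that(2) by (simp add: measurable_Pair2')
  have m: "(\<lambda>p. \<Prod>i\<in>I. f i (fst p i, snd p i)) \<in> borel_measurable (PiM I (\<lambda>_. A) \<Otimes>\<^sub>M PiM I (\<lambda>_. B))"
  proof (intro borel_measurable_prod_ennreal)
    fix i assume i: "i \<in> I"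
    show "(\<lambda>p. f i (fst p i, snd p i)) \<in> borel_measurable (PiM I (\<lambda>_. A) \<Otimes>\<^sub>M PiM I (\<lambda>_. B))"
      by (rule measurable_compose[OF _ f[OF i]]) (use i in measurable)
  qed
  have "(\<integral>\<^sup>+ p. (\<Prod>i\<in>I. f i (fst p i, snd p i)) \<partial>(PiM I (\<lambda>_. A) \<Otimes>\<^sub>M PiM I (\<lambda>_. B)))
    = (\<integral>\<^sup>+ x. \<integral>\<^sup>+ y. (\<Prod>i\<in>I. f i (x i, y i)) \<partial>PiM I (\<lambda>_. B) \<partial>PiM I (\<lambda>_. A))"
    by (subst FB.nn_integral_fst[OF m, symmetric]) simp
  also have "\<dots> = (\<integral>\<^sup>+ x. (\<Prod>i\<in>I. \<integral>\<^sup>+ y. f i (x i, y) \<partial>B) \<partial>PiM I (\<lambda>_. A))"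
  proof (intro nn_integral_cong)
    fix x assume "x \<in> space (PiM I (\<lambda>_. A))"
    then have "x i \<in> space A" if "i \<in> I" for i using that by (auto simp: space_PiM)
    then show "(\<integral>\<^sup>+ y. (\<Prod>i\<in>I. f i (x i, y i)) \<partial>PiM I (\<lambda>_. B)) = (\<Prod>i\<in>I. \<integral>\<^sup>+ y. f i (x i, y) \<partial>B)"
      using f' by (intro PB.product_nn_integral_prod[OF I]) auto
  qed
  also have "\<dots> = (\<Prod>i\<in>I. \<integral>\<^sup>+ x. \<integral>\<^sup>+ y. f i (x, y) \<partial>B \<partial>A)"
    using f by (intro PA.product_nn_integral_prod[OF I, of "\<lambda>i x. \<integral>\<^sup>+ y. f i (x, y) \<partial>B"] B.borel_measurable_nn_integral_fst) auto
  also have "\<dots> = (\<Prod>i\<in>I. \<integral>\<^sup>+ p. f i p \<partial>(A \<Otimes>\<^sub>M B))"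
    using f by (intro prod.cong refl B.nn_integral_fst) auto
  finally show ?thesis .
qed

text \<open>
  Independent families may be regrouped index by index. On rectangles this is Fubini, applied once
  for each family.
\<close>

lemma distr_zip_PiM:
  assumes A: "prob_space A" and B: "prob_space B" and I: "finite I"
  shows "distr (PiM I (\<lambda>_. A) \<Otimes>\<^sub>M PiM I (\<lambda>_. B)) (PiM I (\<lambda>_. A \<Otimes>\<^sub>M B)) (\<lambda>p. \<lambda>i\<in>I. (fst p i, snd p i))
    = PiM I (\<lambda>_. A \<Otimes>\<^sub>M B)"
proof -
  interpret A: prob_space A by (rule A)
  interpret B: prob_space B by (rule B)
  interpret AB: pair_prob_space A B ..
  interpret P: product_sigma_finite "\<lambda>_. A \<Otimes>\<^sub>M B" by standard
  have m: "(\<lambda>p. \<lambda>i\<in>I. (fst p i, snd p i)) \<in> PiM I (\<lambda>_. A) \<Otimes>\<^sub>M PiM I (\<lambda>_. B) \<rightarrow>\<^sub>M PiM I (\<lambda>_. A \<Otimes>\<^sub>M B)"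
    by (intro measurable_restrict) measurable
  show ?thesis
  proof (rule P.PiM_eqI[OF I])
    fix E assume E: "\<And>i. i \<in> I \<Longrightarrow> E i \<in> sets (A \<Otimes>\<^sub>M B)"
    have PE: "Pi\<^sub>E I E \<in> sets (PiM I (\<lambda>_. A \<Otimes>\<^sub>M B))" using E I by (intro sets_PiM_I_finite) auto
    have "emeasure (distr (PiM I (\<lambda>_. A) \<Otimes>\<^sub>M PiM I (\<lambda>_. B)) (PiM I (\<lambda>_. A \<Otimes>\<^sub>M B)) (\<lambda>p. \<lambda>i\<in>I. (fst p i, snd p i))) (Pi\<^sub>E I E)
      = (\<integral>\<^sup>+ q. indicator (Pi\<^sub>E I E) q \<partial>distr (PiM I (\<lambda>_. A) \<Otimes>\<^sub>M PiM I (\<lambda>_. B)) (PiM I (\<lambda>_. A \<Otimes>\<^sub>M B)) (\<lambda>p. \<lambda>i\<in>I. (fst p i, snd p i)))"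
      using PE by simp
    also have "\<dots> = (\<integral>\<^sup>+ p. indicator (Pi\<^sub>E I E) (\<lambda>i\<in>I. (fst p i, snd p i)) \<partial>(PiM I (\<lambda>_. A) \<Otimes>\<^sub>M PiM I (\<lambda>_. B)))"
      using PE by (intro nn_integral_distr[OF m]) auto
    also have "\<dots> = (\<integral>\<^sup>+ p. (\<Prod>i\<in>I. indicator (E i) (fst p i, snd p i)) \<partial>(PiM I (\<lambda>_. A) \<Otimes>\<^sub>M PiM I (\<lambda>_. B)))"
    proof (intro nn_integral_cong)
      fix p
      show "indicator (Pi\<^sub>E I E) (\<lambda>i\<in>I. (fst p i, snd p i)) = (\<Prod>i\<in>I. indicator (E i) (fst p i, snd p i) :: ennreal)"
      proof (cases "\<forall>i\<in>I. (fst p i, snd p i) \<in> E i")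
        case True
        then show ?thesis by (auto simp: indicator_def PiE_iff)
      next
        case False
        then obtain i where i: "i \<in> I" "(fst p i, snd p i) \<notin> E i" by blast
        then have "(\<Prod>i\<in>I. indicator (E i) (fst p i, snd p i) :: ennreal) = 0"
          using I by (intro prod_zero) (auto simp: indicator_def)
        moreover have "(\<lambda>i\<in>I. (fst p i, snd p i)) \<notin> Pi\<^sub>E I E" using i by (auto simp: PiE_iff)
        ultimately show ?thesis by simp
      qed
    qed
    also have "\<dots> = (\<Prod>i\<in>I. \<integral>\<^sup>+ q. indicator (E i) q \<partial>(A \<Otimes>\<^sub>M B))"
      using E by (intro nn_integral_PiM_Times[OF A B I]) auto
    also have "\<dots> = (\<Prod>i\<in>I. emeasure (A \<Otimes>\<^sub>M B) (E i))" using E by (intro prod.cong refl nn_integral_indicator)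
    finally show "emeasure (distr (PiM I (\<lambda>_. A) \<Otimes>\<^sub>M PiM I (\<lambda>_. B)) (PiM I (\<lambda>_. A \<Otimes>\<^sub>M B)) (\<lambda>p. \<lambda>i\<in>I. (fst p i, snd p i))) (Pi\<^sub>E I E)
      = (\<Prod>i\<in>I. emeasure (A \<Otimes>\<^sub>M B) (E i))" .
  qed simp
qed

definition unzip_points :: "nat \<Rightarrow> (nat \<Rightarrow> plane) \<Rightarrow> real \<Rightarrow> (nat \<Rightarrow> nat \<times> real \<times> plane) \<Rightarrow> (nat \<Rightarrow> nat) \<times> (nat \<Rightarrow> plane)" where
  "unzip_points N v \<sigma> f = (\<lambda>i\<in>{1..N}. fst (f i), \<lambda>i\<in>{1..N}. point v \<sigma> (f i))"

lemma point_measurable: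
  assumes [measurable_cong]: "sets \<nu> = sets borel"
  shows "point v \<sigma> \<in> site \<nu> \<rightarrow>\<^sub>M borel"
  unfolding point_def site_def by measurable

lemma fst_site_measurable: "fst \<in> site \<nu> \<rightarrow>\<^sub>M count_space UNIV"
  unfolding site_def by measurable

lemma unzip_points_measurable:
  assumes "sets \<nu> = sets borel"
  shows "unzip_points N v \<sigma> \<in> PiM {1..N} (\<lambda>_. site \<nu>) \<rightarrow>\<^sub>M
     PiM {1..N} (\<lambda>_. count_space UNIV) \<Otimes>\<^sub>M PiM {1..N} (\<lambda>_. borel)"
proof -
  have "(\<lambda>f. fst (f i)) \<in> PiM {1..N} (\<lambda>_. site \<nu>) \<rightarrow>\<^sub>M count_space UNIV"
    and "(\<lambda>f. point v \<sigma> (f i)) \<in> PiM {1..N} (\<lambda>_. site \<nu>) \<rightarrow>\<^sub>M borel" if "i \<in> {1..N}" for i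
    by (rule measurable_compose[where f = "\<lambda>f. f i", OF _ fst_site_measurable], rule measurable_component_singleton[OF that])
      (rule measurable_compose[where f = "\<lambda>f. f i", OF _ point_measurable[OF assms]], rule measurable_component_singleton[OF that])
  then show ?thesis
    unfolding unzip_points_def by (intro measurable_Pair measurable_restrict) auto
qed

text \<open>
  The model is defined by three independent families; here it becomes a function of one
  family of independent sites, so that events about different indices are visibly independent.
\<close>

lemma GLMM_eq_distr_site:
  assumes nu: "prob_space \<nu>" "sets \<nu> = sets borel"
  shows "GLMM N v \<nu> \<sigma> = distr (PiM {1..N} (\<lambda>_. site \<nu>))
     (PiM {1..N} (\<lambda>_. count_space UNIV) \<Otimes>\<^sub>M PiM {1..N} (\<lambda>_. borel)) (unzip_points N v \<sigma>)"
proof -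
  let ?I = "{1..N}"
  let ?T = "PiM ?I (\<lambda>_. count_space UNIV :: nat measure) \<Otimes>\<^sub>M PiM ?I (\<lambda>_. borel :: plane measure)"
  let ?U = "PiM ?I (\<lambda>_. label_measure)" and ?V = "PiM ?I (\<lambda>_. \<nu>)" and ?G = "PiM ?I (\<lambda>_. std_gaussian)"
  let ?VG = "PiM ?I (\<lambda>_. \<nu> \<Otimes>\<^sub>M std_gaussian)"
  interpret nu: prob_space \<nu> by (rule nu)
  interpret G: prob_space std_gaussian by (rule prob_space_std_gaussian)
  interpret VG: pair_prob_space \<nu> std_gaussian ..
  interpret PU: prob_space ?U by (intro prob_space_PiM prob_space_label_measure)
  interpret PVG: prob_space ?VG by (intro prob_space_PiM VG.prob_space_axioms)
  note [measurable_cong] = nu(2)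
  let ?zip = "\<lambda>p. \<lambda>i\<in>?I. (fst p i, snd p i)"
  have zm[measurable]: "?zip \<in> ?V \<Otimes>\<^sub>M ?G \<rightarrow>\<^sub>M ?VG" by (intro measurable_restrict) measurable
  have zm2[measurable]: "?zip \<in> ?U \<Otimes>\<^sub>M ?VG \<rightarrow>\<^sub>M PiM ?I (\<lambda>_. site \<nu>)"
    unfolding site_def by (intro measurable_restrict) measurable
  note um = unzip_points_measurable[OF nu(2), of N v \<sigma>]
  have "PiM ?I (\<lambda>_. site \<nu>) = distr (?U \<Otimes>\<^sub>M ?VG) (PiM ?I (\<lambda>_. site \<nu>)) ?zip"
    unfolding site_def by (rule distr_zip_PiM[OF prob_space_label_measure VG.prob_space_axioms, symmetric]) simp
  also have "?U \<Otimes>\<^sub>M ?VG = distr ?U ?U (\<lambda>x. x) \<Otimes>\<^sub>M distr (?V \<Otimes>\<^sub>M ?G) ?VG ?zip"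
    by (simp add: distr_zip_PiM[OF nu(1) prob_space_std_gaussian])
  also have "\<dots> = distr (?U \<Otimes>\<^sub>M ?V \<Otimes>\<^sub>M ?G) (?U \<Otimes>\<^sub>M ?VG) (\<lambda>(x, y). (x, ?zip y))"
  proof (rule pair_measure_distr[OF measurable_ident_sets[OF refl] zm])
    show "sigma_finite_measure (distr (?V \<Otimes>\<^sub>M ?G) ?VG ?zip)"
      unfolding distr_zip_PiM[OF nu(1) prob_space_std_gaussian finite_atLeastAtMost]
      by (rule PVG.sigma_finite_measure_axioms)
  qed
  finally have site: "PiM ?I (\<lambda>_. site \<nu>) = distr (distr (?U \<Otimes>\<^sub>M ?V \<Otimes>\<^sub>M ?G) (?U \<Otimes>\<^sub>M ?VG) (\<lambda>(x, y). (x, ?zip y))) (PiM ?I (\<lambda>_. site \<nu>)) ?zip" .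
  have m1: "(\<lambda>(x, y). (x, ?zip y)) \<in> ?U \<Otimes>\<^sub>M ?V \<Otimes>\<^sub>M ?G \<rightarrow>\<^sub>M ?U \<Otimes>\<^sub>M ?VG"
    by measurable
  have m2: "?zip \<circ> (\<lambda>(x, y). (x, ?zip y)) \<in> ?U \<Otimes>\<^sub>M ?V \<Otimes>\<^sub>M ?G \<rightarrow>\<^sub>M PiM ?I (\<lambda>_. site \<nu>)"
    by (rule measurable_comp[OF m1 zm2])
  have "distr (PiM ?I (\<lambda>_. site \<nu>)) ?T (unzip_points N v \<sigma>)
    = distr (?U \<Otimes>\<^sub>M ?V \<Otimes>\<^sub>M ?G) ?T (unzip_points N v \<sigma> \<circ> (?zip \<circ> (\<lambda>(x, y). (x, ?zip y))))"
    by (subst site, subst distr_distr[OF zm2 m1], subst distr_distr[OF um m2]) simp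
  also have "\<dots> = GLMM N v \<nu> \<sigma>"
    unfolding GLMM_def label_measure_def[symmetric]
  proof (intro distr_cong refl)
    fix p assume "p \<in> space (?U \<Otimes>\<^sub>M ?V \<Otimes>\<^sub>M ?G)"
    then obtain z w y where p: "p = (z, w, y)" "z \<in> extensional ?I"
      by (auto simp: space_pair_measure space_PiM PiE_def)
    then have "(\<lambda>i\<in>?I. z i) = z" by (auto simp: extensional_restrict)
    moreover have "(unzip_points N v \<sigma> \<circ> (?zip \<circ> (\<lambda>(x, y). (x, ?zip y)))) p = (\<lambda>i\<in>?I. z i, \<lambda>i\<in>?I. w i *\<^sub>R v (z i) + \<sigma> *\<^sub>R y i)"
      unfolding p unzip_points_def by (auto simp: point_def intro!: restrict_ext)
    ultimately show "(unzip_points N v \<sigma> \<circ> (?zip \<circ> (\<lambda>(x, y). (x, ?zip y)))) p = (case p of (z, w, y) \<Rightarrow> (z, \<lambda>i\<in>?I. w i *\<^sub>R v (z i) + \<sigma> *\<^sub>R y i))"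
      by (simp only: p prod.case)
  qed
  finally show ?thesis ..
qed

section \<open>The residual of a random triple\<close>

lemma prob_space_site:
  assumes "prob_space \<nu>"
  shows "prob_space (site \<nu>)"
proof -
  interpret nu: prob_space \<nu> by (rule assms)
  interpret G: prob_space std_gaussian by (rule prob_space_std_gaussian)
  interpret U: prob_space label_measure by (rule prob_space_label_measure)
  interpret VG: pair_prob_space \<nu> std_gaussian ..
  interpret UVG: pair_prob_space label_measure "\<nu> \<Otimes>\<^sub>M std_gaussian" ..
  show ?thesis unfolding site_def by unfold_locales
qed

lemma distr_PiM_pair:
  assumes M: "prob_space M" and I: "finite I" "i \<in> I" "j \<in> I" "i \<noteq> j"
  shows "distr (PiM I (\<lambda>_. M)) (M \<Otimes>\<^sub>M M) (\<lambda>f. (f i, f j)) = M \<Otimes>\<^sub>M M"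
proof -
  interpret M: prob_space M by (rule M)
  have m: "(\<lambda>f. (f i, f j)) \<in> PiM I (\<lambda>_. M) \<rightarrow>\<^sub>M M \<Otimes>\<^sub>M M"
    using I by measurable
  show ?thesis
  proof (rule pair_measure_eqI[symmetric])
    fix A B assume AB: "A \<in> sets M" "B \<in> sets M"
    let ?E = "\<lambda>k. if k = i then A else B"
    have "(\<lambda>f. (f i, f j)) -` (A \<times> B) \<inter> space (PiM I (\<lambda>_. M)) = prod_emb I (\<lambda>_. M) {i, j} (Pi\<^sub>E {i, j} ?E)"
      using I by (auto simp: prod_emb_def space_PiM PiE_iff split: if_splits)
    then have "emeasure (distr (PiM I (\<lambda>_. M)) (M \<Otimes>\<^sub>M M) (\<lambda>f. (f i, f j))) (A \<times> B)
      = emeasure (PiM I (\<lambda>_. M)) (prod_emb I (\<lambda>_. M) {i, j} (Pi\<^sub>E {i, j} ?E))"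
      using AB by (subst emeasure_distr[OF m]) auto
    also have "\<dots> = (\<Prod>k\<in>{i, j}. emeasure M (?E k))"
      using I AB M by (intro emeasure_PiM_emb) auto
    also have "\<dots> = emeasure M A * emeasure M B" using I by simp
    finally show "emeasure M A * emeasure M B = emeasure (distr (PiM I (\<lambda>_. M)) (M \<Otimes>\<^sub>M M) (\<lambda>f. (f i, f j))) (A \<times> B)" ..
  qed (auto intro: M.sigma_finite_measure_axioms)
qed

text \<open>
  The little mass of \<open>\<nu>\<close> on short intervals keeps the residuals of mixed triples away from \<open>0\<close>, its mass
  near the origin creates the gap above the quantile \<open>1/4\<close>, and a nonzero \<open>cross\<close> keeps the two lines apart.
\<close>

locale line_mixture =
  fixes \<nu> :: "real measure" and v :: "nat \<Rightarrow> plane" and R C \<rho> :: real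
  assumes prob_nu: "prob_space \<nu>" and sets_nu: "sets \<nu> = sets borel"
    and v_unit: "norm (v 1) = 1" "norm (v 2) = 1" and v_cross: "cross (v 1) (v 2) \<noteq> 0"
    and nu_bounded: "AE w in \<nu>. \<bar>w\<bar> \<le> R"
    and nu_spread: "\<And>x r. 0 < r \<Longrightarrow> measure \<nu> {x - r..x + r} \<le> C * r powr \<rho>"
    and nu_origin: "\<And>u. 0 < u \<Longrightarrow> 0 < measure \<nu> {- u..u}"
    and rho_pos: "0 < \<rho>"
begin

abbreviation "triple_space \<equiv> PiM {..<3 :: nat} (\<lambda>_. site \<nu>)"

sublocale nu: prob_space \<nu> by (rule prob_nu)
sublocale gauss: prob_space std_gaussian by (rule prob_space_std_gaussian)
sublocale label: prob_space label_measure by (rule prob_space_label_measure)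
sublocale site: prob_space "site \<nu>" by (rule prob_space_site[OF prob_nu])
sublocale triple: finite_product_prob_space "\<lambda>_. site \<nu>" "{..<3 :: nat}"
  by standard auto

declare sets_nu [measurable_cong]

lemma sets_site [measurable_cong]: "sets (site \<nu>) = sets (count_space UNIV \<Otimes>\<^sub>M borel \<Otimes>\<^sub>M borel)"
  unfolding site_def by (intro sets_pair_measure_cong) (auto simp: sets_nu)

lemma space_site [simp]: "space (site \<nu>) = UNIV"
  using sets_eq_imp_space_eq[OF sets_site] by (simp add: space_pair_measure)

definition weight :: "nat \<times> real \<times> plane \<Rightarrow> real" where "weight p = fst (snd p)"
definition noise :: "nat \<times> real \<times> plane \<Rightarrow> plane" where "noise p = snd (snd p)"

lemma weight_measurable [measurable]: "weight \<in> site \<nu> \<rightarrow>\<^sub>M borel"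
  and noise_measurable [measurable]: "noise \<in> site \<nu> \<rightarrow>\<^sub>M borel"
  and label_measurable [measurable]: "fst \<in> site \<nu> \<rightarrow>\<^sub>M count_space UNIV"
  and point_measurable' [measurable]: "point v \<sigma> \<in> site \<nu> \<rightarrow>\<^sub>M borel"
  unfolding weight_def noise_def point_def by measurable

lemma measure_site_Times:
  assumes "A \<in> sets borel" "B \<in> sets borel"
  shows "measure (site \<nu>) {p. fst p \<in> Z \<and> weight p \<in> A \<and> noise p \<in> B} = measure label_measure Z * measure \<nu> A * measure std_gaussian B"
proof -
  have eq: "{p. fst p \<in> Z \<and> weight p \<in> A \<and> noise p \<in> B} = Z \<times> (A \<times> B)"
    by (auto simp: weight_def noise_def)
  interpret VG: pair_prob_space \<nu> std_gaussian ..
  have Z: "Z \<in> sets label_measure" by simp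
  have A: "A \<in> sets \<nu>" and B: "B \<in> sets std_gaussian" using assms by (auto simp: sets_nu)
  have AB: "A \<times> B \<in> sets (\<nu> \<Otimes>\<^sub>M std_gaussian)" using A B by (rule pair_measureI)
  have "emeasure (site \<nu>) (Z \<times> (A \<times> B)) = emeasure label_measure Z * (emeasure \<nu> A * emeasure std_gaussian B)"
    unfolding site_def VG.emeasure_pair_measure_Times[OF Z AB] gauss.emeasure_pair_measure_Times[OF A B] ..
  then show ?thesis
    unfolding eq measure_def by (simp add: enn2real_mult mult.assoc)
qed

lemma site_Times_sets:
  assumes "A \<in> sets borel" "B \<in> sets borel"
  shows "{p. fst p \<in> Z \<and> weight p \<in> A \<and> noise p \<in> B} \<in> sets (site \<nu>)"
proof -
  have "{p. fst p \<in> Z \<and> weight p \<in> A \<and> noise p \<in> B} = Z \<times> (A \<times> B)"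
    by (auto simp: weight_def noise_def)
  then show ?thesis unfolding sets_site using assms by auto
qed

lemma site_label_sets: "{p. fst p \<in> Z} \<in> sets (site \<nu>)"
  using site_Times_sets[of UNIV UNIV Z] by simp

lemma ball_less_3: "(\<forall>i\<in>{..<3 :: nat}. Q i) \<longleftrightarrow> Q 0 \<and> Q 1 \<and> Q 2"
  by (auto simp: eval_nat_numeral less_Suc_eq)

lemma site_weight: "A \<in> sets borel \<Longrightarrow> measure (site \<nu>) {p. weight p \<in> A} = measure \<nu> A"
  using measure_site_Times[of A UNIV UNIV] label.prob_space gauss.prob_space sets_eq_imp_space_eq[OF sets_label_measure]
    sets_eq_imp_space_eq[OF sets_std_gaussian] by simp

lemma site_noise: "B \<in> sets borel \<Longrightarrow> measure (site \<nu>) {p. noise p \<in> B} = measure std_gaussian B"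
  using measure_site_Times[of UNIV B UNIV] label.prob_space nu.prob_space sets_eq_imp_space_eq[OF sets_label_measure]
    sets_eq_imp_space_eq[OF sets_nu] by simp

lemma site_label: "measure (site \<nu>) {p. fst p \<in> Z} = measure label_measure Z"
  using measure_site_Times[of UNIV UNIV Z] gauss.prob_space nu.prob_space sets_eq_imp_space_eq[OF sets_std_gaussian]
    sets_eq_imp_space_eq[OF sets_nu] by simp

lemma AE_site: "AE p in site \<nu>. fst p \<in> {1, 2} \<and> \<bar>weight p\<bar> \<le> R"
proof -
  have "measure (site \<nu>) {p. fst p \<in> {1, 2}} = 1"
    by (simp only: site_label measure_label)
  then have 1: "AE p in site \<nu>. fst p \<in> {1, 2}"
    using site.AE_prob_1[of "{p. fst p \<in> {1, 2}}"] by (simp only: mem_Collect_eq)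
  have "{- R..R} = {w \<in> space \<nu>. \<bar>w\<bar> \<le> R}" using sets_eq_imp_space_eq[OF sets_nu] by auto
  then have "measure \<nu> {- R..R} = 1" using nu_bounded nu.prob_Collect_eq_1[of "\<lambda>w. \<bar>w\<bar> \<le> R"] by simp
  then have "measure (site \<nu>) {p. weight p \<in> {- R..R}} = 1" by (subst site_weight) auto
  then have 2: "AE p in site \<nu>. weight p \<in> {- R..R}"
    using site.AE_prob_1[of "{p. weight p \<in> {- R..R}}"] by (simp only: mem_Collect_eq)
  show ?thesis using 1 2 by eventually_elim auto
qed

text \<open>
  Tightness: a probability measure on the plane gives little mass to the complement of a large ball.
\<close>

lemma noise_small:
  assumes "0 < s" "0 < \<eta>"
  shows "\<exists>\<sigma>0>0. \<forall>\<sigma>. 0 < \<sigma> \<and> \<sigma> \<le> \<sigma>0 \<longrightarrow> measure std_gaussian {y. s < norm (\<sigma> *\<^sub>R y)} \<le> \<eta>"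
proof -
  have sp: "space std_gaussian = UNIV" using sets_eq_imp_space_eq[OF sets_std_gaussian] by simp
  let ?A = "\<lambda>n. {y :: plane. real n < norm y}"
  have "(\<lambda>n. measure std_gaussian (?A n)) \<longlonglongrightarrow> measure std_gaussian (\<Inter>n. ?A n)"
    by (rule gauss.finite_Lim_measure_decseq) (auto simp: decseq_def)
  moreover have "(\<Inter>n. ?A n) = {}"
    by (simp add: set_eq_iff not_less real_arch_simple)
  ultimately have "(\<lambda>n. measure std_gaussian (?A n)) \<longlonglongrightarrow> 0" by simp
  then obtain n where n: "measure std_gaussian (?A n) < \<eta>"
    using order_tendstoD(2)[OF _ assms(2)] by (metis (no_types, lifting) eventually_happens sequentially_bot)
  show ?thesis
  proof (intro exI[of _ "s / (real n + 1)"] conjI allI impI)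
    show "0 < s / (real n + 1)" using assms by simp
    fix \<sigma> assume \<sigma>: "0 < \<sigma> \<and> \<sigma> \<le> s / (real n + 1)"
    have "{y :: plane. s < norm (\<sigma> *\<^sub>R y)} \<subseteq> ?A n"
    proof clarify
      fix y :: plane assume y: "s < norm (\<sigma> *\<^sub>R y)"
      have "\<sigma> * real n \<le> \<sigma> * (real n + 1)" using \<sigma> by simp
      also have "\<dots> \<le> s" using \<sigma> by (simp add: field_simps)
      also have "\<dots> < \<sigma> * norm y" using y \<sigma> by simp
      finally show "real n < norm y" using \<sigma> by simp
    qed
    then have "measure std_gaussian {y. s < norm (\<sigma> *\<^sub>R y)} \<le> measure std_gaussian (?A n)"
      by (intro gauss.finite_measure_mono) auto
    then show "measure std_gaussian {y. s < norm (\<sigma> *\<^sub>R y)} \<le> \<eta>" using n by simp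
  qed
qed

lemma triple_coordinate:
  assumes "i \<in> {..<3 :: nat}" and [measurable]: "Measurable.pred (site \<nu>) Q"
  shows "measure triple_space {g \<in> space triple_space. Q (g i)} = measure (site \<nu>) {p. Q p}"
proof -
  have d: "distr triple_space (site \<nu>) (\<lambda>g. g i) = site \<nu>"
    by (rule distr_PiM_component) (use assms site.prob_space_axioms in auto)
  have m: "(\<lambda>g. g i) \<in> triple_space \<rightarrow>\<^sub>M site \<nu>" using assms(1) by (rule measurable_component_singleton)
  have Q: "{p. Q p} \<in> sets (site \<nu>)" using assms(2) by (simp add: pred_def)
  have "measure (distr triple_space (site \<nu>) (\<lambda>g. g i)) {p. Q p} = measure triple_space ((\<lambda>g. g i) -` {p. Q p} \<inter> space triple_space)"
    by (rule measure_distr[OF m Q])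
  also have "(\<lambda>g. g i) -` {p. Q p} \<inter> space triple_space = {g \<in> space triple_space. Q (g i)}" by auto
  finally show ?thesis unfolding d by simp
qed

lemma triple_weight_small:
  assumes "i \<in> {..<3 :: nat}" "0 < r"
  shows "measure triple_space {g \<in> space triple_space. \<bar>weight (g i)\<bar> \<le> r} \<le> C * r powr \<rho>"
proof -
  have "measure triple_space {g \<in> space triple_space. \<bar>weight (g i)\<bar> \<le> r} = measure (site \<nu>) {p. \<bar>weight p\<bar> \<le> r}"
    by (rule triple_coordinate[OF assms(1)]) measurable
  also have "{p. \<bar>weight p\<bar> \<le> r} = {p. weight p \<in> {0 - r..0 + r}}" by auto
  also have "measure (site \<nu>) \<dots> = measure \<nu> {0 - r..0 + r}" by (rule site_weight) simp
  also have "\<dots> \<le> C * r powr \<rho>" by (rule nu_spread[OF assms(2)])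
  finally show ?thesis .
qed

text \<open>
  Condition on the first weight: the second one must then lie in an interval of length \<open>2 * r\<close>.
\<close>

lemma triple_weights_close:
  assumes "i \<in> {..<3 :: nat}" "j \<in> {..<3}" "i \<noteq> j" "0 < r"
  shows "measure triple_space {g \<in> space triple_space. \<bar>weight (g i) - weight (g j)\<bar> \<le> r} \<le> C * r powr \<rho>"
proof -
  let ?D = "{p. \<bar>weight (fst p) - weight (snd p)\<bar> \<le> r}"
  have D: "?D \<in> sets (site \<nu> \<Otimes>\<^sub>M site \<nu>)"
  proof -
    have "{p \<in> space (site \<nu> \<Otimes>\<^sub>M site \<nu>). \<bar>weight (fst p) - weight (snd p)\<bar> \<le> r} \<in> sets (site \<nu> \<Otimes>\<^sub>M site \<nu>)"
      by measurable
    then show ?thesis by (simp add: space_pair_measure)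
  qed
  have d: "distr triple_space (site \<nu> \<Otimes>\<^sub>M site \<nu>) (\<lambda>g. (g i, g j)) = site \<nu> \<Otimes>\<^sub>M site \<nu>"
    by (rule distr_PiM_pair) (use assms site.prob_space_axioms in auto)
  have m: "(\<lambda>g. (g i, g j)) \<in> triple_space \<rightarrow>\<^sub>M site \<nu> \<Otimes>\<^sub>M site \<nu>"
    using assms by measurable
  have C: "0 \<le> C * r powr \<rho>" using nu_spread[OF assms(4), of 0] measure_nonneg order_trans by blast
  have "emeasure triple_space {g \<in> space triple_space. \<bar>weight (g i) - weight (g j)\<bar> \<le> r} = emeasure (distr triple_space (site \<nu> \<Otimes>\<^sub>M site \<nu>) (\<lambda>g. (g i, g j))) ?D"
    unfolding emeasure_distr[OF m D] by (rule arg_cong[of _ _ "emeasure triple_space"]) auto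
  also have "\<dots> = emeasure (site \<nu> \<Otimes>\<^sub>M site \<nu>) ?D" by (simp only: d)
  also have "\<dots> = (\<integral>\<^sup>+ p. emeasure (site \<nu>) (Pair p -` ?D) \<partial>site \<nu>)"
    by (rule site.emeasure_pair_measure_alt[OF D])
  also have "\<dots> \<le> (\<integral>\<^sup>+ p. ennreal (C * r powr \<rho>) \<partial>site \<nu>)"
  proof (intro nn_integral_mono)
    fix p
    have "Pair p -` ?D = {q. weight q \<in> {weight p - r..weight p + r}}" by auto
    then have "measure (site \<nu>) (Pair p -` ?D) = measure \<nu> {weight p - r..weight p + r}"
      by (simp add: site_weight del: atLeastAtMost_iff)
    then show "emeasure (site \<nu>) (Pair p -` ?D) \<le> ennreal (C * r powr \<rho>)"
      using nu_spread[OF assms(4), of "weight p"] by (simp add: site.emeasure_eq_measure ennreal_leI)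
  qed
  also have "\<dots> = ennreal (C * r powr \<rho>)" by (simp add: site.emeasure_space_1[unfolded space_site])
  finally show ?thesis using C by (simp add: triple.emeasure_eq_measure)
qed

definition pure :: "(nat \<Rightarrow> nat \<times> real \<times> plane) \<Rightarrow> bool" where
  "pure g \<longleftrightarrow> fst (g 0) = fst (g 1) \<and> fst (g 1) = fst (g 2)"

definition residual :: "real \<Rightarrow> (nat \<Rightarrow> nat \<times> real \<times> plane) \<Rightarrow> real" where
  "residual \<sigma> g = tls3 (point v \<sigma> (g 0), point v \<sigma> (g 1), point v \<sigma> (g 2))"

lemma pure_measurable [measurable]: "Measurable.pred triple_space pure"
  unfolding pure_def by measurable

lemma residual_measurable [measurable]: "residual \<sigma> \<in> borel_measurable triple_space"
  unfolding residual_def by measurable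

abbreviation "triple_prob Q \<equiv> measure triple_space {g \<in> space triple_space. Q g}"

definition noisy :: "real \<Rightarrow> real \<Rightarrow> (nat \<Rightarrow> nat \<times> real \<times> plane) \<Rightarrow> bool" where
  "noisy \<sigma> s g \<longleftrightarrow> s < norm (\<sigma> *\<^sub>R noise (g 0)) \<or> s < norm (\<sigma> *\<^sub>R noise (g 1)) \<or> s < norm (\<sigma> *\<^sub>R noise (g 2))"

lemma noisy_measurable [measurable]: "Measurable.pred triple_space (noisy \<sigma> s)"
  unfolding noisy_def by measurable

lemma triple_prob_Or_le:
  assumes [measurable]: "Measurable.pred triple_space Q" "Measurable.pred triple_space Q'"
  shows "triple_prob (\<lambda>g. Q g \<or> Q' g) \<le> triple_prob Q + triple_prob Q'"
proof -
  have "{g \<in> space triple_space. Q g \<or> Q' g} = {g \<in> space triple_space. Q g} \<union> {g \<in> space triple_space. Q' g}" by auto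
  then show ?thesis by (simp only:) (rule measure_Un_le; measurable)
qed

lemma triple_prob_mono_AE:
  assumes "AE g in triple_space. Q g \<longrightarrow> Q' g" and [measurable]: "Measurable.pred triple_space Q'"
  shows "triple_prob Q \<le> triple_prob Q'"
proof (rule triple.finite_measure_mono_AE)
  show "AE g in triple_space. g \<in> {g \<in> space triple_space. Q g} \<longrightarrow> g \<in> {g \<in> space triple_space. Q' g}"
    using assms(1) by eventually_elim auto
qed measurable

lemma noisy_prob_small:
  assumes "0 < s" "0 < \<eta>"
  shows "\<exists>\<sigma>0>0. \<forall>\<sigma>. 0 < \<sigma> \<and> \<sigma> \<le> \<sigma>0 \<longrightarrow> triple_prob (noisy \<sigma> s) \<le> \<eta>"
proof -
  obtain \<sigma>0 where \<sigma>0: "0 < \<sigma>0" "\<And>\<sigma>. 0 < \<sigma> \<and> \<sigma> \<le> \<sigma>0 \<Longrightarrow> measure std_gaussian {y. s < norm (\<sigma> *\<^sub>R y)} \<le> \<eta> / 3"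
    using noise_small[OF assms(1), of "\<eta> / 3"] assms(2) by auto
  have "triple_prob (noisy \<sigma> s) \<le> \<eta>" if \<sigma>: "0 < \<sigma> \<and> \<sigma> \<le> \<sigma>0" for \<sigma>
  proof -
    have one: "triple_prob (\<lambda>g. s < norm (\<sigma> *\<^sub>R noise (g i))) \<le> \<eta> / 3" if i: "i \<in> {..<3}" for i
    proof -
      have "triple_prob (\<lambda>g. s < norm (\<sigma> *\<^sub>R noise (g i))) = measure (site \<nu>) {p. s < norm (\<sigma> *\<^sub>R noise p)}"
        by (rule triple_coordinate[OF i]) measurable
      also have "{p. s < norm (\<sigma> *\<^sub>R noise p)} = {p. noise p \<in> {y. s < norm (\<sigma> *\<^sub>R y)}}" by simp
      also have "measure (site \<nu>) \<dots> = measure std_gaussian {y. s < norm (\<sigma> *\<^sub>R y)}" by (rule site_noise) simp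
      finally show ?thesis using \<sigma>0(2)[OF \<sigma>] by simp
    qed
    have "triple_prob (noisy \<sigma> s) \<le> triple_prob (\<lambda>g. s < norm (\<sigma> *\<^sub>R noise (g 0))) + triple_prob (\<lambda>g. s < norm (\<sigma> *\<^sub>R noise (g 1)) \<or> s < norm (\<sigma> *\<^sub>R noise (g 2)))"
      unfolding noisy_def by (rule triple_prob_Or_le) measurable
    also have "triple_prob (\<lambda>g. s < norm (\<sigma> *\<^sub>R noise (g 1)) \<or> s < norm (\<sigma> *\<^sub>R noise (g 2))) \<le> triple_prob (\<lambda>g. s < norm (\<sigma> *\<^sub>R noise (g 1))) + triple_prob (\<lambda>g. s < norm (\<sigma> *\<^sub>R noise (g 2)))"
      by (rule triple_prob_Or_le) measurable
    finally show ?thesis using one[of 0] one[of 1] one[of 2] by simp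
  qed
  then show ?thesis using \<sigma>0(1) by blast
qed

lemma AE_triple: "AE g in triple_space. \<forall>i\<in>{..<3}. fst (g i) \<in> {1, 2} \<and> \<bar>weight (g i)\<bar> \<le> R"
proof -
  have "AE g in triple_space. fst (g i) \<in> {1, 2} \<and> \<bar>weight (g i)\<bar> \<le> R" if "i \<in> {..<3}" for i
    by (rule AE_PiM_component[OF _ that AE_site]) (rule site.prob_space_axioms)
  from this[of 0] this[of 1] this[of 2] show ?thesis unfolding ball_less_3 by simp
qed

lemma point_decompose: "point v \<sigma> p = weight p *\<^sub>R v (fst p) + \<sigma> *\<^sub>R noise p"
  by (simp add: point_def weight_def noise_def case_prod_unfold)

lemma v_nonzero: "z \<in> {1, 2} \<Longrightarrow> v z \<noteq> 0"
  using v_unit by auto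

text \<open>
  Unless the noise is large, the common line of the three points is close to all of them.
\<close>

lemma pure_residual_small:
  assumes "0 < t" "0 < \<eta>"
  shows "\<exists>\<sigma>0>0. \<forall>\<sigma>. 0 < \<sigma> \<and> \<sigma> \<le> \<sigma>0 \<longrightarrow> triple_prob (\<lambda>g. pure g \<and> t < residual \<sigma> g) \<le> \<eta>"
proof -
  obtain \<sigma>0 where \<sigma>0: "0 < \<sigma>0" "\<And>\<sigma>. 0 < \<sigma> \<and> \<sigma> \<le> \<sigma>0 \<Longrightarrow> triple_prob (noisy \<sigma> (t / 2)) \<le> \<eta>"
    using noisy_prob_small[of "t / 2" \<eta>] assms by auto
  have "triple_prob (\<lambda>g. pure g \<and> t < residual \<sigma> g) \<le> triple_prob (noisy \<sigma> (t / 2))" for \<sigma>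
  proof (rule triple_prob_mono_AE)
    show "AE g in triple_space. pure g \<and> t < residual \<sigma> g \<longrightarrow> noisy \<sigma> (t / 2) g"
      using AE_triple
    proof (rule eventually_mono, intro impI)
      fix g assume l: "\<forall>i\<in>{..<3}. fst (g i) \<in> {1, 2} \<and> \<bar>weight (g i)\<bar> \<le> R"
        and g: "pure g \<and> t < residual \<sigma> g"
      show "noisy \<sigma> (t / 2) g"
      proof (rule ccontr)
        assume n: "\<not> noisy \<sigma> (t / 2) g"
        have "v (fst (g 0)) \<noteq> 0" using l v_nonzero by simp
        then have "residual \<sigma> g \<le> 2 * (t / 2)"
          using g n unfolding residual_def point_decompose pure_def noisy_def not_less de_Morgan_disj
          by (simp only:) (rule tls3_pure_le; simp)
        then show False using g by simp
      qed
    qed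
  qed measurable
  then show ?thesis using \<sigma>0 order_trans by meson
qed

text \<open>
  A small residual and small noise put the three noiseless points near a line, which forces two
  weights to be close or one weight to be small; the spread of \<open>\<nu>\<close> makes these six events unlikely.
\<close>

lemma mixed_residual_large:
  assumes "0 < \<eta>"
  shows "\<exists>t>0. \<exists>\<sigma>0>0. \<forall>\<sigma>. 0 < \<sigma> \<and> \<sigma> \<le> \<sigma>0 \<longrightarrow> triple_prob (\<lambda>g. \<not> pure g \<and> residual \<sigma> g \<le> t) \<le> \<eta>"
proof -
  let ?\<kappa> = "\<bar>cross (v 1) (v 2)\<bar>"
  have \<kappa>: "0 < ?\<kappa>" using v_cross by simp
  \<comment> \<open>\<open>r\<close> makes the six events on the weights unlikely; then \<open>t\<close> is so small that a triangle of
    area less than \<open>r * r * ?\<kappa>\<close> is forced\<close>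
  have "((\<lambda>r. 6 * (C * r powr \<rho>)) \<longlongrightarrow> 6 * (C * 0)) (at_right 0)"
    using rho_pos by (intro tendsto_intros tendsto_zero_powrI[where b = \<rho>] tendsto_ident_at) (auto simp: eventually_at_right_less intro: eventually_mono[OF eventually_at_right_less])
  then have "eventually (\<lambda>r. 6 * (C * r powr \<rho>) < \<eta> / 2) (at_right 0)"
    by (rule order_tendstoD) (use assms in simp)
  then have "eventually (\<lambda>r. 0 < r \<and> 6 * (C * r powr \<rho>) < \<eta> / 2) (at_right 0)"
    by (intro eventually_conj eventually_at_right_less)
  then obtain r where r: "0 < r" "6 * (C * r powr \<rho>) < \<eta> / 2"
    using eventually_happens'[OF trivial_limit_at_right_real] by blast
  have "((\<lambda>t. 2 * (3 * t) * (4 * R + 2 * (3 * t))) \<longlongrightarrow> 2 * (3 * 0) * (4 * R + 2 * (3 * 0))) (at_right 0)"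
    by (intro tendsto_intros)
  then have "eventually (\<lambda>t. 2 * (3 * t) * (4 * R + 2 * (3 * t)) < r * r * ?\<kappa>) (at_right 0)"
    by (rule order_tendstoD) (use r \<kappa> in simp)
  then have "eventually (\<lambda>t. 0 < t \<and> 2 * (3 * t) * (4 * R + 2 * (3 * t)) < r * r * ?\<kappa>) (at_right 0)"
    by (intro eventually_conj eventually_at_right_less)
  then obtain t where t: "0 < t" "2 * (3 * t) * (4 * R + 2 * (3 * t)) < r * r * ?\<kappa>"
    using eventually_happens'[OF trivial_limit_at_right_real] by blast
  obtain \<sigma>0 where \<sigma>0: "0 < \<sigma>0" "\<And>\<sigma>. 0 < \<sigma> \<and> \<sigma> \<le> \<sigma>0 \<Longrightarrow> triple_prob (noisy \<sigma> t) \<le> \<eta> / 2"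
    using noisy_prob_small[of t "\<eta> / 2"] assms t by auto
  let ?close = "\<lambda>i j g. \<bar>weight (g i) - weight (g j)\<bar> \<le> r"
  let ?small = "\<lambda>i g. \<bar>weight (g i)\<bar> \<le> r"
  have key: "\<bar>w2 - w1\<bar> \<le> r \<or> \<bar>w3\<bar> \<le> r"
    if "near_line (3 * t) (w1 *\<^sub>R v z) (w2 *\<^sub>R v z) (w3 *\<^sub>R v z')" "\<bar>w1\<bar> \<le> R" "\<bar>w2\<bar> \<le> R" "\<bar>w3\<bar> \<le> R"
      "z \<in> {1, 2}" "z' \<in> {1, 2}" "z \<noteq> z'" for w1 w2 w3 z z'
  proof (rule ccontr)
    assume "\<not> (\<bar>w2 - w1\<bar> \<le> r \<or> \<bar>w3\<bar> \<le> r)"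
    then have "r * r \<le> \<bar>w2 - w1\<bar> * \<bar>w3\<bar>" using r by (intro mult_mono) auto
    then have "r * r * ?\<kappa> \<le> \<bar>w2 - w1\<bar> * \<bar>w3\<bar> * ?\<kappa>" by (intro mult_right_mono) auto
    moreover have "\<bar>cross (v z) (v z')\<bar> = ?\<kappa>" using that(5-7) cross_anticommute[of "v 2" "v 1"] by auto
    moreover have "norm (v z) = 1" "norm (v z') = 1" using that(5,6) v_unit by auto
    ultimately show False using near_line_two_lines[OF that(1) _ _ that(2-4)] t(2) by simp
  qed
  have main: "triple_prob (\<lambda>g. \<not> pure g \<and> residual \<sigma> g \<le> t) \<le>
    triple_prob (\<lambda>g. noisy \<sigma> t g \<or> ?close 0 1 g \<or> ?close 1 2 g \<or> ?close 0 2 g \<or> ?small 0 g \<or> ?small 1 g \<or> ?small 2 g)" (is "_ \<le> triple_prob ?Q") for \<sigma>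
  proof (rule triple_prob_mono_AE)
    show "AE g in triple_space. \<not> pure g \<and> residual \<sigma> g \<le> t \<longrightarrow> ?Q g"
      using AE_triple
    proof (rule eventually_mono, intro impI)
      fix g assume l: "\<forall>i\<in>{..<3}. fst (g i) \<in> {1, 2} \<and> \<bar>weight (g i)\<bar> \<le> R"
        and g: "\<not> pure g \<and> residual \<sigma> g \<le> t"
      have w: "\<bar>weight (g 0)\<bar> \<le> R" "\<bar>weight (g 1)\<bar> \<le> R" "\<bar>weight (g 2)\<bar> \<le> R"
        and z: "fst (g 0) \<in> {1, 2}" "fst (g 1) \<in> {1, 2}" "fst (g 2) \<in> {1, 2}" using l by auto
      show "?Q g"
      proof (cases "noisy \<sigma> t g")
        case False
        then have n: "norm (\<sigma> *\<^sub>R noise (g 0)) \<le> t" "norm (\<sigma> *\<^sub>R noise (g 1)) \<le> t" "norm (\<sigma> *\<^sub>R noise (g 2)) \<le> t"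
          by (auto simp: noisy_def not_less)
        have "residual \<sigma> g < 2 * t" using g t by linarith
        then have "near_line (2 * t) (point v \<sigma> (g 0)) (point v \<sigma> (g 1)) (point v \<sigma> (g 2))"
          unfolding residual_def by (rule near_line_of_tls3)
        then have "near_line (2 * t + t) (weight (g 0) *\<^sub>R v (fst (g 0))) (weight (g 1) *\<^sub>R v (fst (g 1))) (weight (g 2) *\<^sub>R v (fst (g 2)))"
          by (rule near_line_perturb) (use n in \<open>auto simp: point_decompose dist_norm\<close>)
        then have nl: "near_line (3 * t) (weight (g 0) *\<^sub>R v (fst (g 0))) (weight (g 1) *\<^sub>R v (fst (g 1))) (weight (g 2) *\<^sub>R v (fst (g 2)))"
          by simp
        consider "fst (g 0) = fst (g 1)" "fst (g 0) \<noteq> fst (g 2)" | "fst (g 1) = fst (g 2)" "fst (g 1) \<noteq> fst (g 0)"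
          | "fst (g 0) = fst (g 2)" "fst (g 0) \<noteq> fst (g 1)"
          using g z unfolding pure_def by fastforce
        then show ?thesis
        proof cases
          case 1
          then show ?thesis using key[OF _ w(1,2,3) z(1) z(3)] nl by (simp add: abs_minus_commute) argo
        next
          case 2
          then show ?thesis using key[OF _ w(2,3,1) z(2) z(1)] near_line_permute(1)[OF nl] by (simp add: abs_minus_commute) argo
        next
          case 3
          then show ?thesis using key[OF _ w(1,3,2) z(1) z(2)] near_line_permute(2)[OF nl] by (simp add: abs_minus_commute) argo
        qed
      qed simp
    qed
  qed measurable
  have "triple_prob (\<lambda>g. noisy \<sigma> t g \<or> ?close 0 1 g \<or> ?close 1 2 g \<or> ?close 0 2 g \<or> ?small 0 g \<or> ?small 1 g \<or> ?small 2 g) \<le> \<eta>"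
    if \<sigma>: "0 < \<sigma> \<and> \<sigma> \<le> \<sigma>0" for \<sigma>
  proof -
    have "triple_prob (\<lambda>g. noisy \<sigma> t g \<or> ?close 0 1 g \<or> ?close 1 2 g \<or> ?close 0 2 g \<or> ?small 0 g \<or> ?small 1 g \<or> ?small 2 g)
      \<le> triple_prob (noisy \<sigma> t) + (triple_prob (?close 0 1) + (triple_prob (?close 1 2) + (triple_prob (?close 0 2)
       + (triple_prob (?small 0) + (triple_prob (?small 1) + triple_prob (?small 2))))))"
      by (rule order_trans[OF triple_prob_Or_le], measurable, rule add_left_mono,
          rule order_trans[OF triple_prob_Or_le], measurable, rule add_left_mono,
          rule order_trans[OF triple_prob_Or_le], measurable, rule add_left_mono,
          rule order_trans[OF triple_prob_Or_le], measurable, rule add_left_mono,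
          rule order_trans[OF triple_prob_Or_le], measurable, rule add_left_mono,
          rule triple_prob_Or_le, measurable)
    also have "\<dots> \<le> \<eta> / 2 + (C * r powr \<rho> + (C * r powr \<rho> + (C * r powr \<rho> + (C * r powr \<rho> + (C * r powr \<rho> + C * r powr \<rho>)))))"
      by (intro add_mono triple_weights_close triple_weight_small \<sigma>0(2)[OF \<sigma>] r(1)) auto
    finally show ?thesis using r(2) by simp
  qed
  then show ?thesis using \<sigma>0(1) t(1) main order_trans by meson
qed

text \<open>
  If the three weights and noises are small, then all points are near the origin and any line through
  the origin fits them. This has positive probability, bounded below uniformly in small noise levels.
\<close>

lemma mixed_residual_small_pos:
  assumes "0 < t"
  shows "\<exists>c>0. \<exists>\<sigma>0>0. \<forall>\<sigma>. 0 < \<sigma> \<and> \<sigma> \<le> \<sigma>0 \<longrightarrow> c \<le> triple_prob (\<lambda>g. \<not> pure g \<and> residual \<sigma> g \<le> t)"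
proof -
  \<comment> \<open>a lower bound for the probability of each coordinate of a box contained in the event\<close>
  let ?q = "1 / 2 * measure \<nu> {- (t / 4)..t / 4} * (1 / 2)"
  have q: "0 < ?q" using nu_origin[of "t / 4"] assms by simp
  obtain \<sigma>0 where \<sigma>0: "0 < \<sigma>0" "\<And>\<sigma>. 0 < \<sigma> \<and> \<sigma> \<le> \<sigma>0 \<Longrightarrow> measure std_gaussian {y. t / 4 < norm (\<sigma> *\<^sub>R y)} \<le> 1 / 2"
    using noise_small[of "t / 4" "1 / 2"] assms by auto
  have "?q ^ 3 \<le> triple_prob (\<lambda>g. \<not> pure g \<and> residual \<sigma> g \<le> t)" if \<sigma>: "0 < \<sigma> \<and> \<sigma> \<le> \<sigma>0" for \<sigma>
  proof -
    let ?B = "{y :: plane. norm (\<sigma> *\<^sub>R y) \<le> t / 4}"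
    have "measure std_gaussian ?B = 1 - measure std_gaussian {y. t / 4 < norm (\<sigma> *\<^sub>R y)}"
    proof -
      have "space std_gaussian - {y. t / 4 < norm (\<sigma> *\<^sub>R y)} = ?B"
        using sets_eq_imp_space_eq[OF sets_std_gaussian] by auto
      then show ?thesis using gauss.prob_compl[of "{y. t / 4 < norm (\<sigma> *\<^sub>R y)}"] by simp
    qed
    then have B: "1 / 2 \<le> measure std_gaussian ?B" using \<sigma>0(2)[OF \<sigma>] by simp
    let ?E = "\<lambda>i :: nat. {p. fst p \<in> {if i = 2 then 2 else 1} \<and> weight p \<in> {- (t / 4)..t / 4} \<and> noise p \<in> ?B}"
    have E: "?E i \<in> sets (site \<nu>)" for i
      by (rule site_Times_sets) auto
    have "measure (site \<nu>) (?E i) = 1 / 2 * measure \<nu> {- (t / 4)..t / 4} * measure std_gaussian ?B" for i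
      by (subst measure_site_Times) (auto simp: measure_label measure_label[unfolded One_nat_def])
    then have Eq: "?q \<le> measure (site \<nu>) (?E i)" for i
      using B by (simp only:) (intro mult_left_mono, auto)
    have "?q ^ 3 = (\<Prod>i\<in>{..<3 :: nat}. ?q)" by simp
    also have "\<dots> \<le> (\<Prod>i\<in>{..<3}. measure (site \<nu>) (?E i))"
      using q Eq by (intro prod_mono) auto
    also have "\<dots> = measure triple_space (Pi\<^sub>E {..<3} ?E)"
      by (rule triple.prob_times[symmetric]) (rule E)
    also have "\<dots> \<le> triple_prob (\<lambda>g. \<not> pure g \<and> residual \<sigma> g \<le> t)"
    proof (rule triple.finite_measure_mono)
      show "Pi\<^sub>E {..<3} ?E \<subseteq> {g \<in> space triple_space. \<not> pure g \<and> residual \<sigma> g \<le> t}"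
      proof (intro subsetI CollectI conjI)
        fix g assume g: "g \<in> Pi\<^sub>E {..<3} ?E"
        then show "g \<in> space triple_space" by (auto simp: space_PiM PiE_iff)
        have "g 1 \<in> ?E 1" "g 2 \<in> ?E 2" using g by (rule PiE_mem, simp)+
        then show "\<not> pure g" by (simp add: pure_def)
        have "norm (point v \<sigma> (g i)) \<le> t / 2" if i: "i \<in> {..<3}" for i
        proof -
          have gi: "g i \<in> ?E i" using g i by (rule PiE_mem)
          then have "norm (v (fst (g i))) = 1" using v_unit by (auto split: if_splits)
          then have "norm (point v \<sigma> (g i)) \<le> \<bar>weight (g i)\<bar> + norm (\<sigma> *\<^sub>R noise (g i))"
            unfolding point_decompose by (intro order_trans[OF norm_triangle_ineq]) simp
          also have "\<dots> \<le> t / 4 + t / 4" using gi by (intro add_mono) auto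
          finally show ?thesis by simp
        qed
        then have "residual \<sigma> g \<le> 2 * (t / 2)"
          unfolding residual_def by (intro tls3_near_origin_le) auto
        then show "residual \<sigma> g \<le> t" by simp
      qed
    qed measurable
    finally show ?thesis .
  qed
  then show ?thesis using \<sigma>0(1) q by (meson zero_less_power)
qed

lemma pure_prob: "triple_prob pure = 1 / 4"
proof -
  let ?E = "\<lambda>z :: nat. Pi\<^sub>E {..<3 :: nat} (\<lambda>_. {p. fst p \<in> {z}})"
  have E: "{p. fst p \<in> {z}} \<in> sets (site \<nu>)" for z
    by (rule site_label_sets)
  have P: "measure triple_space (?E z) = 1 / 8" if "z \<in> {1, 2}" for z
  proof -
    have "measure triple_space (?E z) = (\<Prod>i\<in>{..<3 :: nat}. measure (site \<nu>) {p. fst p \<in> {z}})"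
      by (rule triple.prob_times) (rule E)
    also have "\<dots> = (1 / 2) ^ 3"
      using that by (simp only: site_label prod_constant) (auto simp: measure_label measure_label[unfolded One_nat_def])
    finally show ?thesis by (simp add: power3_eq_cube)
  qed
  have Es: "?E z \<in> sets triple_space" for z by (intro sets_PiM_I_finite E) auto
  have "triple_prob pure = measure triple_space (?E 1 \<union> ?E 2)"
  proof (rule triple.finite_measure_eq_AE)
    show "AE g in triple_space. g \<in> {g \<in> space triple_space. pure g} \<longleftrightarrow> g \<in> ?E 1 \<union> ?E 2"
      using AE_triple AE_space
    proof eventually_elim
      case (elim g)
      then have "g \<in> extensional {..<3}" by (auto simp: space_PiM PiE_iff)
      then have "g \<in> ?E z \<longleftrightarrow> fst (g 0) = z \<and> fst (g 1) = z \<and> fst (g 2) = z" for z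
        unfolding PiE_iff ball_less_3 by simp
      moreover have "fst (g 0) \<in> {1, 2}" using elim(1) by simp
      moreover have "(a = b \<and> b = c) \<longleftrightarrow> (a = 1 \<and> b = 1 \<and> c = 1) \<or> (a = 2 \<and> b = 2 \<and> c = 2)"
        if "a \<in> {1, 2}" for a b c :: nat using that by auto
      ultimately show ?case using elim(2) unfolding pure_def mem_Collect_eq Un_iff by (simp only: simp_thms)
    qed
    show "{g \<in> space triple_space. pure g} \<in> sets triple_space" by measurable
    show "?E 1 \<union> ?E 2 \<in> sets triple_space" using Es by (intro sets.Un)
  qed
  also have "\<dots> = measure triple_space (?E 1) + measure triple_space (?E 2)"
  proof (rule triple.finite_measure_Union[OF Es Es], rule equals0I)
    fix g assume "g \<in> ?E 1 \<inter> ?E 2"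
    then have g: "g \<in> ?E 1" "g \<in> ?E 2" by (rule IntD1, rule IntD2)
    have "g 0 \<in> {p. fst p \<in> {1}}" by (rule PiE_mem[OF g(1)]) simp
    moreover have "g 0 \<in> {p. fst p \<in> {2}}" by (rule PiE_mem[OF g(2)]) simp
    ultimately show False by simp
  qed
  also have "\<dots> = 1 / 8 + 1 / 8"
    unfolding P[of 1, OF insertI1] P[of 2, OF insertI2[OF insertI1]] ..
  finally show ?thesis by simp
qed

end

section \<open>Second moments of weakly dependent counts\<close>

text \<open>
  Each pair of events that may be dependent contributes at most one to the variance of the count.
\<close>

lemma (in prob_space) chebyshev_dependency:
  fixes A :: "'i \<Rightarrow> 'a set" and p s :: real
  assumes K: "finite K" and A: "\<And>a. a \<in> K \<Longrightarrow> A a \<in> events" "\<And>a. a \<in> K \<Longrightarrow> prob (A a) = p"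
    and indep: "\<And>a b. a \<in> K \<Longrightarrow> b \<in> K \<Longrightarrow> \<not> dep a b \<Longrightarrow> prob (A a \<inter> A b) = p * p"
    and s: "0 < s"
  shows "prob {x \<in> space M. s \<le> \<bar>real (card {a \<in> K. x \<in> A a}) - card K * p\<bar>}
    \<le> real (card {(a, b) \<in> K \<times> K. dep a b}) / s\<^sup>2"
proof -
  let ?X = "\<lambda>x. \<Sum>a\<in>K. indicator (A a) x :: real"
  have int: "integrable M (\<lambda>x. indicator (A a) x :: real)" if "a \<in> K" for a
    using A(1)[OF that] by (simp add: integrable_indicator_iff less_top[symmetric])
  have int2: "integrable M (\<lambda>x. (indicator (A a) x - p) * (indicator (A b) x - p))" if "a \<in> K" "b \<in> K" for a b
  proof -
    have [measurable]: "A a \<in> events" "A b \<in> events" using A that by auto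
    have "(\<lambda>x. (indicator (A a) x - p) * (indicator (A b) x - p)) = (\<lambda>x. indicator (A a \<inter> A b) x - p * indicator (A a) x - p * indicator (A b) x + p * p)"
      by (auto simp: indicator_def fun_eq_iff algebra_simps)
    then show ?thesis using int[OF that(1)] int[OF that(2)]
      by (simp only:) (intro Bochner_Integration.integrable_add Bochner_Integration.integrable_diff integrable_mult_right, auto simp: integrable_indicator_iff less_top[symmetric])
  qed
  have cov: "(\<integral>x. (indicator (A a) x - p) * (indicator (A b) x - p) \<partial>M) \<le> of_bool (dep a b)" if ab: "a \<in> K" "b \<in> K" for a b
  proof -
    have [measurable]: "A a \<in> events" "A b \<in> events" using A that by auto
    have "(\<integral>x. (indicator (A a) x - p) * (indicator (A b) x - p) \<partial>M) = (\<integral>x. indicator (A a \<inter> A b) x - p * indicator (A a) x - p * indicator (A b) x + p * p \<partial>M)"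
      by (intro Bochner_Integration.integral_cong refl) (auto simp: indicator_def algebra_simps)
    also have "\<dots> = prob (A a \<inter> A b) - p * prob (A a) - p * prob (A b) + p * p"
      using int[OF ab(1)] int[OF ab(2)] by (simp add: prob_space integrable_indicator_iff less_top[symmetric])
    also have "\<dots> = prob (A a \<inter> A b) - p * p" using A(2) ab by simp
    also have "\<dots> \<le> of_bool (dep a b)"
    proof (cases "dep a b")
      case True
      have "0 \<le> p * p" "prob (A a \<inter> A b) \<le> 1" by (simp_all add: prob_le_1)
      from diff_mono[OF this(2,1)] have "prob (A a \<inter> A b) - p * p \<le> 1 - 0" .
      then show ?thesis using True by simp
    qed (use indep[OF ab] in simp)
    finally show ?thesis .
  qed
  have EX: "expectation ?X = card K * p"
  proof -
    have "expectation ?X = (\<Sum>a\<in>K. prob (A a))"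
      using int by (subst Bochner_Integration.integral_sum) (auto intro!: sum.cong simp: A)
    then show ?thesis using A by simp
  qed
  have sq: "(?X x - card K * p)\<^sup>2 = (\<Sum>a\<in>K. \<Sum>b\<in>K. (indicator (A a) x - p) * (indicator (A b) x - p))" for x
  proof -
    have "?X x - card K * p = (\<Sum>a\<in>K. indicator (A a) x - p)" by (simp add: sum_subtractf)
    then show ?thesis by (simp only: power2_eq_square sum_product)
  qed
  have mX: "?X \<in> borel_measurable M" using A by (intro borel_measurable_sum) auto
  have bX: "\<bar>?X x\<bar> \<le> card K" for x
  proof -
    have "\<bar>?X x\<bar> \<le> (\<Sum>a\<in>K. 1)" by (rule order_trans[OF sum_abs sum_mono]) (auto simp: indicator_def)
    then show ?thesis by simp
  qed
  have iX2: "integrable M (\<lambda>x. (?X x)\<^sup>2)"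
  proof (rule integrable_const_bound[where B = "(real (card K))\<^sup>2"])
    show "AE x in M. norm ((?X x)\<^sup>2) \<le> (real (card K))\<^sup>2"
      using power_mono[OF bX abs_ge_zero, where n = 2] by (simp add: power_abs)
  qed (use mX in measurable)
  have "variance ?X = (\<integral>x. (\<Sum>a\<in>K. \<Sum>b\<in>K. (indicator (A a) x - p) * (indicator (A b) x - p)) \<partial>M)"
    unfolding EX sq ..
  also have "\<dots> = (\<Sum>a\<in>K. \<Sum>b\<in>K. \<integral>x. (indicator (A a) x - p) * (indicator (A b) x - p) \<partial>M)"
    using int2 by (simp add: Bochner_Integration.integral_sum Bochner_Integration.integrable_sum)
  also have "\<dots> \<le> (\<Sum>a\<in>K. \<Sum>b\<in>K. of_bool (dep a b))" by (intro sum_mono cov)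
  also have "\<dots> = (\<Sum>q\<in>K \<times> K. of_bool (case q of (a, b) \<Rightarrow> dep a b))"
    by (simp add: sum.cartesian_product case_prod_unfold)
  also have "\<dots> = real (card (K \<times> K \<inter> {q. case q of (a, b) \<Rightarrow> dep a b}))"
    using K by (simp add: of_bool_def sum.If_cases)
  also have "K \<times> K \<inter> {q. case q of (a, b) \<Rightarrow> dep a b} = {(a, b) \<in> K \<times> K. dep a b}" by auto
  finally have var: "variance ?X \<le> real (card {(a, b) \<in> K \<times> K. dep a b})" .
  have cnt: "?X x = real (card {a \<in> K. x \<in> A a})" for x
    using K by (simp add: indicator_def sum.If_cases Int_def)
  have "prob {x \<in> space M. s \<le> \<bar>?X x - expectation ?X\<bar>} \<le> variance ?X / s\<^sup>2"
    by (rule Chebyshev_inequality[OF mX iX2 s])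
  also have "\<dots> \<le> real (card {(a, b) \<in> K \<times> K. dep a b}) / s\<^sup>2"
    using var by (intro divide_right_mono) auto
  finally show ?thesis unfolding EX unfolding cnt .
qed

section \<open>Random triples\<close>

definition triples :: "nat \<Rightarrow> nat set set" where
  "triples N = {\<tau>. \<tau> \<subseteq> {1..N} \<and> card \<tau> = 3}"

definition triple_pmf :: "nat \<Rightarrow> nat set measure" where
  "triple_pmf N = measure_pmf (pmf_of_set (triples N))"

lemma random_triples_eq: "random_triples N M = PiM {1..M} (\<lambda>_. triple_pmf N)"
  by (simp add: random_triples_def triples_def triple_pmf_def)

lemma prob_space_triple_pmf: "prob_space (triple_pmf N)"
  unfolding triple_pmf_def by (rule prob_space_measure_pmf)

lemma sets_triple_pmf [simp]: "sets (triple_pmf N) = UNIV"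
  and space_triple_pmf [simp]: "space (triple_pmf N) = UNIV"
  by (auto simp: triple_pmf_def)

lemma finite_triples: "finite (triples N)"
  unfolding triples_def by (rule finite_subset[of _ "Pow {1..N}"]) auto

lemma card_triples: "card (triples N) = N choose 3"
  unfolding triples_def by (subst n_subsets) auto

lemma triples_nonempty: "3 \<le> N \<Longrightarrow> triples N \<noteq> {}"
  using card_triples[of N] zero_less_binomial[of 3 N] by (metis card.empty less_irrefl)

lemma triple_contains_prob:
  assumes "3 \<le> N" "i \<in> {1..N}"
  shows "measure (triple_pmf N) {\<tau>. i \<in> \<tau>} \<le> 3 / N"
proof -
  have "triples N \<inter> {\<tau>. i \<in> \<tau>} \<subseteq> insert i ` {B. B \<subseteq> {1..N} - {i} \<and> card B = 2}"
  proof
    fix \<tau> assume "\<tau> \<in> triples N \<inter> {\<tau>. i \<in> \<tau>}"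
    then have \<tau>: "\<tau> \<subseteq> {1..N}" "card \<tau> = 3" "i \<in> \<tau>" by (auto simp: triples_def)
    then show "\<tau> \<in> insert i ` {B. B \<subseteq> {1..N} - {i} \<and> card B = 2}"
      by (intro image_eqI[of _ _ "\<tau> - {i}"]) auto
  qed
  then have "card (triples N \<inter> {\<tau>. i \<in> \<tau>}) \<le> card {B. B \<subseteq> {1..N} - {i} \<and> card B = 2}"
    by (rule surj_card_le[rotated]) (rule finite_subset[of _ "Pow {1..N}"], auto)
  also have "\<dots> = (N - 1) choose 2"
    using assms by (subst n_subsets) auto
  finally have c: "card (triples N \<inter> {\<tau>. i \<in> \<tau>}) \<le> (N - 1) choose 2" .
  have "3 * (N choose 3) = N * ((N - 1) choose 2)"
    using binomial_absorption[of 2 N] by (simp add: numeral_3_eq_3 numeral_2_eq_2)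
  then have eq: "real ((N - 1) choose 2) * real N = 3 * real (N choose 3)"
    by (metis mult.commute of_nat_mult of_nat_numeral)
  have pos: "0 < real (N choose 3)" using assms by (simp add: zero_less_binomial)
  have "measure (triple_pmf N) {\<tau>. i \<in> \<tau>} = card (triples N \<inter> {\<tau>. i \<in> \<tau>}) / card (triples N)"
    unfolding triple_pmf_def by (rule measure_pmf_of_set[OF triples_nonempty[OF assms(1)] finite_triples])
  also have "\<dots> \<le> ((N - 1) choose 2) / (N choose 3)"
    unfolding card_triples using c by (intro divide_right_mono) auto
  also have "\<dots> = 3 / N" using eq pos assms by (simp add: field_simps)
  finally show ?thesis .
qed

lemma prob_space_random_triples: "prob_space (random_triples N M)"
  unfolding random_triples_eq by (intro prob_space_PiM prob_space_triple_pmf)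

lemma AE_random_triples:
  assumes "3 \<le> N"
  shows "AE \<tau> in random_triples N M. \<forall>m\<in>{1..M}. \<tau> m \<in> triples N"
proof -
  have "AE \<tau> in random_triples N M. \<tau> m \<in> triples N" if "m \<in> {1..M}" for m
    unfolding random_triples_eq
  proof (rule AE_PiM_component[OF prob_space_triple_pmf that])
    show "AE \<tau> in triple_pmf N. \<tau> \<in> triples N"
      unfolding triple_pmf_def using triples_nonempty[OF assms] finite_triples by (auto simp: AE_measure_pmf_iff)
  qed
  then show ?thesis by (intro AE_finite_allI) auto
qed

text \<open>
  A union bound over the common index: each of the \<open>N\<close> indices lies in both triples with probability
  at most \<open>(3 / N)\<^sup>2\<close>.
\<close>

lemma triples_meet_prob:
  assumes N: "3 \<le> N" and m: "m \<in> {1..M}" "m' \<in> {1..M}" "m \<noteq> m'"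
  shows "measure (random_triples N M) {\<tau> \<in> space (random_triples N M). \<exists>i\<in>{1..N}. i \<in> \<tau> m \<and> i \<in> \<tau> m'} \<le> 9 / N"
proof -
  interpret RT: prob_space "random_triples N M" by (rule prob_space_random_triples)
  interpret T: prob_space "triple_pmf N" by (rule prob_space_triple_pmf)
  let ?E = "\<lambda>i. {\<tau> \<in> space (random_triples N M). i \<in> \<tau> m \<and> i \<in> \<tau> m'}"
  have meas: "(\<lambda>\<tau>. (\<tau> m, \<tau> m')) \<in> random_triples N M \<rightarrow>\<^sub>M triple_pmf N \<Otimes>\<^sub>M triple_pmf N"
    unfolding random_triples_eq using m by measurable
  have E: "?E i \<in> RT.events" and PE: "RT.prob (?E i) \<le> (3 / N) * (3 / N)" if i: "i \<in> {1..N}" for i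
  proof -
    let ?S = "{\<tau>. i \<in> \<tau>}"
    have S: "?S \<times> ?S \<in> sets (triple_pmf N \<Otimes>\<^sub>M triple_pmf N)" by (intro pair_measureI) auto
    have eq: "?E i = (\<lambda>\<tau>. (\<tau> m, \<tau> m')) -` (?S \<times> ?S) \<inter> space (random_triples N M)" by auto
    show "?E i \<in> RT.events" unfolding eq by (rule measurable_sets[OF meas S])
    have d: "distr (random_triples N M) (triple_pmf N \<Otimes>\<^sub>M triple_pmf N) (\<lambda>\<tau>. (\<tau> m, \<tau> m')) = triple_pmf N \<Otimes>\<^sub>M triple_pmf N"
      unfolding random_triples_eq by (rule distr_PiM_pair[OF prob_space_triple_pmf _ m]) simp
    have "RT.prob (?E i) = measure (distr (random_triples N M) (triple_pmf N \<Otimes>\<^sub>M triple_pmf N) (\<lambda>\<tau>. (\<tau> m, \<tau> m'))) (?S \<times> ?S)"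
      unfolding eq by (rule measure_distr[OF meas S, symmetric])
    also have "\<dots> = measure (triple_pmf N) ?S * measure (triple_pmf N) ?S"
      unfolding d by (simp add: measure_def T.emeasure_pair_measure_Times enn2real_mult)
    also have "\<dots> \<le> (3 / N) * (3 / N)"
      by (intro mult_mono triple_contains_prob[OF N i]) auto
    finally show "RT.prob (?E i) \<le> (3 / N) * (3 / N)" .
  qed
  have "RT.prob {\<tau> \<in> space (random_triples N M). \<exists>i\<in>{1..N}. i \<in> \<tau> m \<and> i \<in> \<tau> m'} = RT.prob (\<Union>i\<in>{1..N}. ?E i)"
    by (rule arg_cong[where f = RT.prob]) auto
  also have "\<dots> \<le> (\<Sum>i\<in>{1..N}. RT.prob (?E i))"
    using E by (intro RT.finite_measure_subadditive_finite) auto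
  also have "\<dots> \<le> (\<Sum>i\<in>{1..N}. (3 / N) * (3 / N))" by (intro sum_mono PE)
  also have "\<dots> = 9 / N" using N by simp
  finally show ?thesis .
qed

section \<open>Order statistics\<close>

text \<open>
  The counts compare the \<open>k\<close>-th order statistic with \<open>t\<close>. Rounding moves the rank by at most \<open>1/2\<close>, and
  \<open>2 \<le> M\<close> keeps it between \<open>1\<close> and \<open>M\<close>.
\<close>

lemma selected_threshold_bounds:
  assumes M: "2 \<le> M"
  defines "k \<equiv> nat (round (1 / 4 * real M))"
  shows "k \<le> card {m \<in> {1..M}. tls_residual x (\<tau> m) \<le> t} \<Longrightarrow> selected_threshold x \<tau> M (1 / 4) \<le> t"
    and "card {m \<in> {1..M}. tls_residual x (\<tau> m) < t} < k \<Longrightarrow> t \<le> selected_threshold x \<tau> M (1 / 4)"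
    and "\<bar>real k - M / 4\<bar> \<le> 1 / 2"
proof -
  have r: "\<bar>real_of_int (round (1 / 4 * real M)) - 1 / 4 * real M\<bar> \<le> 1 / 2" by (rule of_int_round_abs_le)
  have r1: "1 \<le> round (1 / 4 * real M)"
  proof -
    have "round (1 / 2 :: real) \<le> round (1 / 4 * real M)" using M by (intro round_mono) auto
    then show ?thesis by (simp add: round_def)
  qed
  then have rk: "real k = real_of_int (round (1 / 4 * real M))" by (simp add: k_def)
  show "\<bar>real k - M / 4\<bar> \<le> 1 / 2" using r rk by simp
  have "real k \<le> M" using r rk M by linarith
  then have k: "1 \<le> k" "k \<le> M" using r1 by (auto simp: k_def)
  let ?xs = "map (\<lambda>m. tls_residual x (\<tau> m)) [1..<M + 1]"
  let ?s = "sort ?xs"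
  have sel: "selected_threshold x \<tau> M (1 / 4) = ?s ! (k - 1)"
    using k by (simp add: selected_threshold_def Let_def k_def)
  have len: "length ?s = M" by simp
  have cnt: "card {i. i < M \<and> Q (?s ! i)} = card {m \<in> {1..M}. Q (tls_residual x (\<tau> m))}" for Q
  proof -
    have "card {i. i < M \<and> Q (?s ! i)} = length (filter Q ?s)"
      by (simp add: length_filter_conv_card)
    also have "\<dots> = length (filter Q ?xs)" by (metis mset_filter mset_sort size_mset)
    also have "\<dots> = length (filter (\<lambda>m. Q (tls_residual x (\<tau> m))) [1..<M + 1])"
      by (simp add: filter_map o_def del: upt_Suc)
    also have "\<dots> = card (set (filter (\<lambda>m. Q (tls_residual x (\<tau> m))) [1..<M + 1]))"
      by (rule distinct_card[symmetric]) simp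
    also have "set (filter (\<lambda>m. Q (tls_residual x (\<tau> m))) [1..<M + 1]) = {m \<in> {1..M}. Q (tls_residual x (\<tau> m))}"
      by auto
    finally show ?thesis .
  qed
  have srt: "?s ! i \<le> ?s ! j" if "i \<le> j" "j < M" for i j
    using that by (intro sorted_nth_mono) auto
  show "selected_threshold x \<tau> M (1 / 4) \<le> t" if "k \<le> card {m \<in> {1..M}. tls_residual x (\<tau> m) \<le> t}"
  proof (rule ccontr)
    assume n: "\<not> selected_threshold x \<tau> M (1 / 4) \<le> t"
    have "{i. i < M \<and> ?s ! i \<le> t} \<subseteq> {..<k - 1}"
    proof
      fix i assume i: "i \<in> {i. i < M \<and> ?s ! i \<le> t}"
      then show "i \<in> {..<k - 1}"
        using n srt[of "k - 1" i] unfolding sel by (cases "i < k - 1") auto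
    qed
    from card_mono[OF finite_lessThan this] have "card {i. i < M \<and> ?s ! i \<le> t} \<le> k - 1" by simp
    then show False using that cnt[of "\<lambda>r. r \<le> t"] k by simp
  qed
  show "t \<le> selected_threshold x \<tau> M (1 / 4)" if "card {m \<in> {1..M}. tls_residual x (\<tau> m) < t} < k"
  proof (rule ccontr)
    assume n: "\<not> t \<le> selected_threshold x \<tau> M (1 / 4)"
    have "{..<k} \<subseteq> {i. i < M \<and> ?s ! i < t}"
    proof
      fix i assume "i \<in> {..<k}"
      then have "i \<le> k - 1" "i < M" "k - 1 < M" using k by auto
      then show "i \<in> {i. i < M \<and> ?s ! i < t}" using n srt[of i "k - 1"] unfolding sel by auto
    qed
    then have "card {..<k} \<le> card {i. i < M \<and> ?s ! i < t}" by (intro card_mono) auto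
    then show False using that cnt[of "\<lambda>r. r < t"] by simp
  qed
qed

section \<open>Counting sampled residuals\<close>

text \<open>
  The generalised inverse of the distribution function, with left and right limits taken apart: the
  law of \<open>Y\<close> may have an atom at \<open>T\<close>.
\<close>

lemma (in prob_space) lower_quantile:
  fixes Y :: "'a \<Rightarrow> real"
  assumes Y[measurable]: "Y \<in> borel_measurable M" and nonneg: "\<And>x. 0 \<le> Y x"
    and q: "0 < q" "q \<le> prob {x \<in> space M. Y x \<le> b}"
  obtains T where "T \<le> b" "prob {x \<in> space M. Y x < T} \<le> q" "q \<le> prob {x \<in> space M. Y x \<le> T}"
proof -
  let ?G = "\<lambda>t. prob {x \<in> space M. Y x \<le> t}"
  let ?S = "{t. q \<le> ?G t}"
  have mono: "?G s \<le> ?G t" if "s \<le> t" for s t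
    using that by (intro finite_measure_mono) auto
  have lower: "0 \<le> t" if "t \<in> ?S" for t
  proof (rule ccontr)
    assume "\<not> 0 \<le> t"
    then have "\<not> Y x \<le> t" for x using nonneg[of x] by linarith
    then have "{x \<in> space M. Y x \<le> t} = {}" by blast
    then have "?G t = 0" by (simp only: measure_empty)
    then show False using that q(1) by simp
  qed
  then have bdd: "bdd_below ?S" by (intro bdd_belowI[of _ 0]) auto
  have ne: "?S \<noteq> {}" using q by auto
  define T where "T = Inf ?S"
  have above: "q \<le> ?G t" if "T < t" for t
  proof -
    have "\<exists>s\<in>?S. s < t" using that unfolding T_def by (rule cInf_less_iff[OF ne bdd, THEN iffD1])
    then obtain s where "q \<le> ?G s" "s < t" by (elim bexE) simp
    then show ?thesis using mono[of s t] by linarith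
  qed
  have below: "?G t < q" if "t < T" for t
    using that cInf_lower[OF _ bdd, of t] unfolding T_def by force
  show ?thesis
  proof (rule that[of T])
    show "T \<le> b" unfolding T_def using q by (intro cInf_lower bdd) simp
    have "(\<lambda>n. ?G (T + 1 / Suc n)) \<longlonglongrightarrow> prob (\<Inter>n. {x \<in> space M. Y x \<le> T + 1 / Suc n})"
    proof (rule finite_Lim_measure_decseq)
      show "decseq (\<lambda>n. {x \<in> space M. Y x \<le> T + 1 / Suc n})"
      proof (intro decseq_SucI subsetI)
        fix n x assume "x \<in> {x \<in> space M. Y x \<le> T + 1 / real (Suc (Suc n))}"
        moreover have "1 / real (Suc (Suc n)) \<le> 1 / real (Suc n)" by (intro divide_left_mono) auto
        ultimately show "x \<in> {x \<in> space M. Y x \<le> T + 1 / real (Suc n)}" by auto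
      qed
    qed auto
    moreover have "(\<Inter>n. {x \<in> space M. Y x \<le> T + 1 / Suc n}) = {x \<in> space M. Y x \<le> T}"
    proof (intro equalityI subsetI)
      fix x assume x: "x \<in> (\<Inter>n. {x \<in> space M. Y x \<le> T + 1 / Suc n})"
      have "(\<lambda>n. T + 1 / real (Suc n)) \<longlonglongrightarrow> T + 0"
        by (intro tendsto_intros LIMSEQ_Suc[OF lim_1_over_n])
      then have "Y x \<le> T" using x by (intro LIMSEQ_le_const[of _ "T"]) auto
      then show "x \<in> {x \<in> space M. Y x \<le> T}" using x by auto
    next
      fix x assume "x \<in> {x \<in> space M. Y x \<le> T}"
      moreover have "0 \<le> 1 / real (Suc n)" for n by simp
      ultimately show "x \<in> (\<Inter>n. {x \<in> space M. Y x \<le> T + 1 / Suc n})" by (auto intro: add_increasing2)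
    qed
    ultimately have "(\<lambda>n. ?G (T + 1 / Suc n)) \<longlonglongrightarrow> ?G T" by simp
    then show "q \<le> ?G T" using above by (intro LIMSEQ_le_const) auto
    have "(\<lambda>n. ?G (T - 1 / Suc n)) \<longlonglongrightarrow> prob (\<Union>n. {x \<in> space M. Y x \<le> T - 1 / Suc n})"
    proof (rule finite_Lim_measure_incseq)
      show "incseq (\<lambda>n. {x \<in> space M. Y x \<le> T - 1 / Suc n})"
      proof (intro incseq_SucI subsetI)
        fix n x assume "x \<in> {x \<in> space M. Y x \<le> T - 1 / real (Suc n)}"
        moreover have "1 / real (Suc (Suc n)) \<le> 1 / real (Suc n)" by (intro divide_left_mono) auto
        ultimately show "x \<in> {x \<in> space M. Y x \<le> T - 1 / real (Suc (Suc n))}" by auto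
      qed
    qed auto
    moreover have "(\<Union>n. {x \<in> space M. Y x \<le> T - 1 / Suc n}) = {x \<in> space M. Y x < T}"
    proof (intro equalityI subsetI)
      fix x assume "x \<in> (\<Union>n. {x \<in> space M. Y x \<le> T - 1 / Suc n})"
      then obtain n where "x \<in> space M" "Y x \<le> T - 1 / real (Suc n)" by auto
      moreover have "0 < 1 / real (Suc n)" by simp
      ultimately have "x \<in> space M" "Y x < T" by linarith+
      then show "x \<in> {x \<in> space M. Y x < T}" by simp
    next
      fix x assume x: "x \<in> {x \<in> space M. Y x < T}"
      then obtain n where "1 / real (Suc n) < T - Y x" using nat_approx_posE[of "T - Y x"] by auto
      then show "x \<in> (\<Union>n. {x \<in> space M. Y x \<le> T - 1 / Suc n})" using x by (auto intro!: exI[of _ n])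
    qed
    ultimately have "(\<lambda>n. ?G (T - 1 / Suc n)) \<longlonglongrightarrow> prob {x \<in> space M. Y x < T}" by simp
    then show "prob {x \<in> space M. Y x < T} \<le> q"
      using below by (intro LIMSEQ_le_const2) (auto intro!: less_imp_le)
  qed
qed

lemma tls_residual_cong: "(\<And>i. i \<in> \<tau> \<Longrightarrow> x i = y i) \<Longrightarrow> tls_residual x \<tau> = tls_residual y \<tau>"
  unfolding tls_residual_def by (simp cong: sum.cong)

lemma tls_residual_measurable:
  assumes "\<tau> \<subseteq> J" "card \<tau> = 3"
  shows "(\<lambda>x. tls_residual x \<tau>) \<in> borel_measurable (PiM J (\<lambda>_. borel))"
proof -
  obtain i j k where \<tau>: "\<tau> = {i, j, k}" "i \<noteq> j" "j \<noteq> k" "i \<noteq> k" using assms(2) by (auto simp: card_3_iff)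
  have [measurable]: "i \<in> J" "j \<in> J" "k \<in> J" using assms \<tau> by auto
  show ?thesis unfolding \<tau>(1) using \<tau>(2-) by (simp add: tls_residual_triple)
qed

text \<open>
  A sum over the finitely many admissible triples: the samples live in an uncountable discrete
  space, where a joint condition on \<open>x\<close> and \<open>\<tau> m\<close> is seen to be measurable by splitting it over the
  values of \<open>\<tau> m\<close>.
\<close>

definition sample_count :: "nat \<Rightarrow> nat \<Rightarrow> real set \<Rightarrow> (nat \<Rightarrow> plane) \<Rightarrow> (nat \<Rightarrow> nat set) \<Rightarrow> real" where
  "sample_count N M D x \<tau> = (\<Sum>m\<in>{1..M}. \<Sum>a\<in>triples N. of_bool (\<tau> m = a) * of_bool (tls_residual x a \<in> D))"

lemma sample_count_eq:
  assumes "\<And>m. m \<in> {1..M} \<Longrightarrow> \<tau> m \<in> triples N"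
  shows "sample_count N M D x \<tau> = real (card {m \<in> {1..M}. tls_residual x (\<tau> m) \<in> D})"
proof -
  have "sample_count N M D x \<tau> = (\<Sum>m\<in>{1..M}. of_bool (tls_residual x (\<tau> m) \<in> D))"
    unfolding sample_count_def
  proof (intro sum.cong refl)
    fix m assume "m \<in> {1..M}"
    then have "(\<Sum>a\<in>triples N. of_bool (\<tau> m = a) * of_bool (tls_residual x a \<in> D)) = (\<Sum>a\<in>triples N. if \<tau> m = a then of_bool (tls_residual x a \<in> D) else 0 :: real)"
      by (intro sum.cong refl) auto
    then show "(\<Sum>a\<in>triples N. of_bool (\<tau> m = a) * of_bool (tls_residual x a \<in> D)) = (of_bool (tls_residual x (\<tau> m) \<in> D) :: real)"
      using assms[OF \<open>m \<in> {1..M}\<close>] finite_triples by (simp add: sum.delta)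
  qed
  then show ?thesis by (simp add: of_bool_def sum.If_cases Int_def)
qed

lemma sample_count_measurable:
  assumes [measurable]: "D \<in> sets borel"
  shows "(\<lambda>(x, \<tau>). sample_count N M D x \<tau>) \<in> borel_measurable (PiM {1..N} (\<lambda>_. borel :: plane measure) \<Otimes>\<^sub>M random_triples N M)"
proof -
  have 1: "(\<lambda>p. of_bool (snd p m = a) :: real) \<in> borel_measurable (PiM {1..N} (\<lambda>_. borel :: plane measure) \<Otimes>\<^sub>M random_triples N M)" if m: "m \<in> {1..M}" for m a
  proof -
    have a: "(\<lambda>p. snd p m) \<in> PiM {1..N} (\<lambda>_. borel :: plane measure) \<Otimes>\<^sub>M random_triples N M \<rightarrow>\<^sub>M triple_pmf N"
      unfolding random_triples_eq using m by measurable
    have b: "(\<lambda>b. of_bool (b = a) :: real) \<in> borel_measurable (triple_pmf N)"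
      by (simp add: triple_pmf_def)
    from measurable_compose[OF a b] show ?thesis .
  qed
  have 2: "(\<lambda>p. of_bool (tls_residual (fst p) a \<in> D) :: real) \<in> borel_measurable (PiM {1..N} (\<lambda>_. borel :: plane measure) \<Otimes>\<^sub>M random_triples N M)" if a: "a \<in> triples N" for a
  proof -
    have t: "(\<lambda>p. tls_residual (fst p) a) \<in> borel_measurable (PiM {1..N} (\<lambda>_. borel :: plane measure) \<Otimes>\<^sub>M random_triples N M)"
      using a by (intro measurable_compose[OF measurable_fst tls_residual_measurable]) (auto simp: triples_def)
    have "(\<lambda>r. of_bool (r \<in> D) :: real) \<in> borel_measurable borel" by measurable
    from measurable_compose[OF t this] show ?thesis .
  qed
  show ?thesis unfolding sample_count_def case_prod_unfold
    by (intro borel_measurable_sum borel_measurable_times 1 2)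
qed

context line_mixture
begin

abbreviation "config_space N \<equiv> PiM {1..N :: nat} (\<lambda>_. site \<nu>)"
abbreviation "points \<sigma> f \<equiv> (\<lambda>i :: nat. point v \<sigma> (f i))"

lemma prob_space_config: "prob_space (config_space N)"
  by (intro prob_space_PiM site.prob_space_axioms)

text \<open>
  The sites are exchangeable, so it suffices to study one canonical triple of them.
\<close>

lemma triple_transfer:
  assumes ijk: "i \<in> {1..N}" "j \<in> {1..N}" "k \<in> {1..N}" "i \<noteq> j" "i \<noteq> k" "j \<noteq> k"
    and Q: "Measurable.pred triple_space (\<lambda>g. Q (g 0) (g 1) (g 2))"
  shows "{f \<in> space (config_space N). Q (f i) (f j) (f k)} \<in> sets (config_space N)"
    and "measure (config_space N) {f \<in> space (config_space N). Q (f i) (f j) (f k)} = triple_prob (\<lambda>g. Q (g 0) (g 1) (g 2))"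
proof -
  define h where "h = (\<lambda>n :: nat. if n = 0 then i else if n = 1 then j else k)"
  have h: "h 0 = i" "h 1 = j" "h 2 = k" by (auto simp: h_def)
  have inj: "inj_on h {..<3}" using ijk by (auto simp: inj_on_def h_def)
  have im: "h \<in> {..<3} \<rightarrow> {1..N}" using ijk by (auto simp: h_def)
  let ?r = "\<lambda>f. \<lambda>n\<in>{..<3 :: nat}. f (h n)"
  have d: "distr (config_space N) triple_space ?r = triple_space"
    by (rule distr_PiM_reindex[OF _ inj im]) (rule site.prob_space_axioms)
  have m: "?r \<in> config_space N \<rightarrow>\<^sub>M triple_space"
    using im by (intro measurable_restrict measurable_component_singleton) auto
  have S: "{g \<in> space triple_space. Q (g 0) (g 1) (g 2)} \<in> sets triple_space"
    using Q by (simp add: pred_def)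
  have eq: "?r -` {g \<in> space triple_space. Q (g 0) (g 1) (g 2)} \<inter> space (config_space N) = {f \<in> space (config_space N). Q (f i) (f j) (f k)}"
    using measurable_space[OF m] h by auto
  show "{f \<in> space (config_space N). Q (f i) (f j) (f k)} \<in> sets (config_space N)"
    using measurable_sets[OF m S] unfolding eq .
  show "measure (config_space N) {f \<in> space (config_space N). Q (f i) (f j) (f k)} = triple_prob (\<lambda>g. Q (g 0) (g 1) (g 2))"
    using measure_distr[OF m S] unfolding d eq by simp
qed

lemma residual_prob:
  assumes a: "a \<in> triples N" and D: "D \<in> sets borel"
  shows "{f \<in> space (config_space N). tls_residual (points \<sigma> f) a \<in> D} \<in> sets (config_space N)"
    and "measure (config_space N) {f \<in> space (config_space N). tls_residual (points \<sigma> f) a \<in> D} = triple_prob (\<lambda>g. residual \<sigma> g \<in> D)"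
proof -
  obtain i j k where a': "a = {i, j, k}" "i \<noteq> j" "j \<noteq> k" "i \<noteq> k" "i \<in> {1..N}" "j \<in> {1..N}" "k \<in> {1..N}"
    using a unfolding triples_def card_3_iff by auto
  have eq: "tls_residual (points \<sigma> f) a = tls3 (point v \<sigma> (f i), point v \<sigma> (f j), point v \<sigma> (f k))" for f
    unfolding a'(1) using a'(2-4) by (simp add: tls_residual_triple)
  have "Measurable.pred triple_space (\<lambda>g. residual \<sigma> g \<in> D)" using D by measurable
  then have "Measurable.pred triple_space (\<lambda>g. tls3 (point v \<sigma> (g 0), point v \<sigma> (g 1), point v \<sigma> (g 2)) \<in> D)"
    by (simp only: residual_def)
  from triple_transfer[where Q = "\<lambda>p q r. tls3 (point v \<sigma> p, point v \<sigma> q, point v \<sigma> r) \<in> D", OF a'(5,6,7,2,4,3) this]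
  show "{f \<in> space (config_space N). tls_residual (points \<sigma> f) a \<in> D} \<in> sets (config_space N)"
    and "measure (config_space N) {f \<in> space (config_space N). tls_residual (points \<sigma> f) a \<in> D} = triple_prob (\<lambda>g. residual \<sigma> g \<in> D)"
    by (simp_all only: eq residual_def)
qed

lemma config_indep_vars:
  assumes "1 \<le> N"
  shows "prob_space.indep_vars (config_space N) (\<lambda>_. site \<nu>) (\<lambda>i f. f i) {1..N}"
proof -
  interpret C: prob_space "config_space N" by (rule prob_space_config)
  have "distr (config_space N) (\<Pi>\<^sub>M i\<in>{1..N}. site \<nu>) (\<lambda>f. \<lambda>i\<in>{1..N}. f i) = distr (config_space N) (config_space N) (\<lambda>f. f)"
    by (intro distr_cong refl) (auto simp: space_PiM PiE_def extensional_restrict)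
  also have "\<dots> = config_space N" by simp
  also have "\<dots> = (\<Pi>\<^sub>M i\<in>{1..N}. distr (config_space N) (site \<nu>) (\<lambda>f. f i))"
    by (intro PiM_cong refl distr_PiM_component[symmetric] site.prob_space_axioms)
  finally show ?thesis
    using assms by (subst C.indep_vars_iff_distr_eq_PiM') auto
qed

lemma residuals_indep:
  assumes ab: "a \<in> triples N" "b \<in> triples N" "a \<inter> b = {}" and D: "D \<in> sets borel" and N: "1 \<le> N"
  shows "measure (config_space N) ({f \<in> space (config_space N). tls_residual (points \<sigma> f) a \<in> D} \<inter> {f \<in> space (config_space N). tls_residual (points \<sigma> f) b \<in> D})
    = triple_prob (\<lambda>g. residual \<sigma> g \<in> D) * triple_prob (\<lambda>g. residual \<sigma> g \<in> D)"
proof -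
  interpret C: prob_space "config_space N" by (rule prob_space_config)
  let ?S = "\<lambda>a. {h \<in> space (PiM a (\<lambda>_. site \<nu>)). tls_residual (points \<sigma> h) a \<in> D}"
  have S: "?S a \<in> sets (PiM a (\<lambda>_. site \<nu>))" if a: "a \<in> triples N" for a
  proof -
    have m: "(\<lambda>h. \<lambda>i\<in>a. point v \<sigma> (h i)) \<in> PiM a (\<lambda>_. site \<nu>) \<rightarrow>\<^sub>M PiM a (\<lambda>_. borel)"
      by (intro measurable_restrict) measurable
    have "(\<lambda>h. tls_residual (\<lambda>i\<in>a. point v \<sigma> (h i)) a) \<in> borel_measurable (PiM a (\<lambda>_. site \<nu>))"
      by (rule measurable_compose[OF m tls_residual_measurable]) (use a in \<open>auto simp: triples_def\<close>)
    also have "(\<lambda>h. tls_residual (\<lambda>i\<in>a. point v \<sigma> (h i)) a) = (\<lambda>h. tls_residual (points \<sigma> h) a)"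
      by (intro ext tls_residual_cong) auto
    finally have "(\<lambda>h. tls_residual (points \<sigma> h) a) \<in> borel_measurable (PiM a (\<lambda>_. site \<nu>))" .
    from measurable_sets[OF this D] show ?thesis by (simp add: vimage_def Int_def conj_commute)
  qed
  have sub: "a \<subseteq> {1..N}" "b \<subseteq> {1..N}" using ab by (auto simp: triples_def)
  have eq: "(\<lambda>f. restrict (\<lambda>i. f i) a) -` ?S a \<inter> space (config_space N) = {f \<in> space (config_space N). tls_residual (points \<sigma> f) a \<in> D}"
    if "a \<subseteq> {1..N}" for a
  proof -
    have "tls_residual (points \<sigma> (restrict f a)) a = tls_residual (points \<sigma> f) a" for f
      by (rule tls_residual_cong) auto
    moreover have "restrict f a \<in> space (PiM a (\<lambda>_. site \<nu>))" for f by (auto simp: space_PiM)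
    ultimately show ?thesis by auto
  qed
  have ind: "C.indep_var (PiM a (\<lambda>_. site \<nu>)) (\<lambda>f. restrict (\<lambda>i. f i) a) (PiM b (\<lambda>_. site \<nu>)) (\<lambda>f. restrict (\<lambda>i. f i) b)"
    by (rule C.indep_var_restrict[OF config_indep_vars[OF N] ab(3) sub])
  have "C.prob ((\<lambda>f. (restrict (\<lambda>i. f i) a, restrict (\<lambda>i. f i) b)) -` (?S a \<times> ?S b) \<inter> space (config_space N)) =
    C.prob ((\<lambda>f. restrict (\<lambda>i. f i) a) -` ?S a \<inter> space (config_space N)) * C.prob ((\<lambda>f. restrict (\<lambda>i. f i) b) -` ?S b \<inter> space (config_space N))"
    by (rule C.indep_varD[OF ind S[OF ab(1)] S[OF ab(2)]])
  also have "(\<lambda>f. (restrict (\<lambda>i. f i) a, restrict (\<lambda>i. f i) b)) -` (?S a \<times> ?S b) \<inter> space (config_space N)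
     = ((\<lambda>f. restrict (\<lambda>i. f i) a) -` ?S a \<inter> space (config_space N)) \<inter> ((\<lambda>f. restrict (\<lambda>i. f i) b) -` ?S b \<inter> space (config_space N))"
    by auto
  finally show ?thesis
    unfolding eq[OF sub(1)] eq[OF sub(2)] residual_prob(2)[OF ab(1) D] residual_prob(2)[OF ab(2) D] .
qed

abbreviation "overlap N \<tau> m m' \<equiv> \<exists>i\<in>{1..N :: nat}. i \<in> \<tau> m \<and> i \<in> \<tau> m'"

text \<open>
  For fixed sampled triples, the residuals of two of them are independent unless they share an index.
\<close>

lemma sample_deviation_given:
  assumes N: "1 \<le> N" and \<tau>: "\<And>m. m \<in> {1..M} \<Longrightarrow> \<tau> m \<in> triples N" and D: "D \<in> sets borel" and s: "0 < s"
  shows "measure (config_space N) {f \<in> space (config_space N). s \<le> \<bar>sample_count N M D (points \<sigma> f) \<tau> - M * triple_prob (\<lambda>g. residual \<sigma> g \<in> D)\<bar>}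
    \<le> real (card {(m, m') \<in> {1..M} \<times> {1..M}. overlap N \<tau> m m'}) / s\<^sup>2"
proof -
  interpret C: prob_space "config_space N" by (rule prob_space_config)
  let ?A = "\<lambda>m. {f \<in> space (config_space N). tls_residual (points \<sigma> f) (\<tau> m) \<in> D}"
  let ?p = "triple_prob (\<lambda>g. residual \<sigma> g \<in> D)"
  have "C.prob {f \<in> space (config_space N). s \<le> \<bar>real (card {m \<in> {1..M}. f \<in> ?A m}) - card {1..M} * ?p\<bar>}
     \<le> real (card {(m, m') \<in> {1..M} \<times> {1..M}. overlap N \<tau> m m'}) / s\<^sup>2"
  proof (rule C.chebyshev_dependency[OF _ _ _ _ s])
    fix m m' assume m: "m \<in> {1..M}" "m' \<in> {1..M}" and "\<not> overlap N \<tau> m m'"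
    then have "\<tau> m \<inter> \<tau> m' = {}" using \<tau>[OF m(1)] by (auto simp: triples_def)
    then show "C.prob (?A m \<inter> ?A m') = ?p * ?p"
      using \<tau> m by (intro residuals_indep D N) auto
  qed (use \<tau> residual_prob D in auto)
  moreover have "sample_count N M D (points \<sigma> f) \<tau> = real (card {m \<in> {1..M}. f \<in> ?A m})" if "f \<in> space (config_space N)" for f
  proof -
    have "sample_count N M D (points \<sigma> f) \<tau> = real (card {m \<in> {1..M}. tls_residual (points \<sigma> f) (\<tau> m) \<in> D})"
      by (rule sample_count_eq) (rule \<tau>)
    then show ?thesis using that by simp
  qed
  then have "{f \<in> space (config_space N). s \<le> \<bar>sample_count N M D (points \<sigma> f) \<tau> - M * ?p\<bar>}
     = {f \<in> space (config_space N). s \<le> \<bar>real (card {m \<in> {1..M}. f \<in> ?A m}) - card {1..M} * ?p\<bar>}"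
    by (intro Collect_cong conj_cong refl) (simp only: card_atLeastAtMost diff_Suc_1 simp_thms)
  ultimately show ?thesis by (simp only:)
qed

end

lemma sample_count_cong:
  assumes "\<And>i. i \<in> {1..N} \<Longrightarrow> x i = y i"
  shows "sample_count N M D x \<tau> = sample_count N M D y \<tau>"
proof -
  have "tls_residual x a = tls_residual y a" if "a \<in> triples N" for a
    by (rule tls_residual_cong) (use that assms in \<open>auto simp: triples_def\<close>)
  then show ?thesis unfolding sample_count_def by (intro sum.cong refl) auto
qed

context line_mixture
begin

lemma label_config: "measure (config_space N) {f \<in> space (config_space N). fst (f i) = 1} = 1 / 2"
  and label_config_sets: "{f \<in> space (config_space N). fst (f i) = 1} \<in> sets (config_space N)"
  if i: "i \<in> {1..N}"
proof -
  have d: "distr (config_space N) (site \<nu>) (\<lambda>f. f i) = site \<nu>"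
    by (rule distr_PiM_component[OF site.prob_space_axioms i])
  have m: "(\<lambda>f. f i) \<in> config_space N \<rightarrow>\<^sub>M site \<nu>" using i by (rule measurable_component_singleton)
  have S: "{p. fst p \<in> {1}} \<in> sets (site \<nu>)" by (rule site_label_sets)
  have eq: "(\<lambda>f. f i) -` {p. fst p \<in> {1}} \<inter> space (config_space N) = {f \<in> space (config_space N). fst (f i) = 1}" by auto
  show "{f \<in> space (config_space N). fst (f i) = 1} \<in> sets (config_space N)"
    using measurable_sets[OF m S] unfolding eq .
  show "measure (config_space N) {f \<in> space (config_space N). fst (f i) = 1} = 1 / 2"
    using measure_distr[OF m S] unfolding d eq site_label measure_label by simp
qed

lemma labels_indep:
  assumes ij: "i \<in> {1..N}" "j \<in> {1..N}" "i \<noteq> j"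
  shows "measure (config_space N) ({f \<in> space (config_space N). fst (f i) = 1} \<inter> {f \<in> space (config_space N). fst (f j) = 1}) = 1 / 2 * (1 / 2)"
proof -
  have d: "distr (config_space N) (site \<nu> \<Otimes>\<^sub>M site \<nu>) (\<lambda>f. (f i, f j)) = site \<nu> \<Otimes>\<^sub>M site \<nu>"
    by (rule distr_PiM_pair[OF site.prob_space_axioms _ ij]) simp
  have m: "(\<lambda>f. (f i, f j)) \<in> config_space N \<rightarrow>\<^sub>M site \<nu> \<Otimes>\<^sub>M site \<nu>" using ij by measurable
  let ?S = "{p :: nat \<times> real \<times> plane. fst p \<in> {1}}"
  have S: "?S \<in> sets (site \<nu>)" by (rule site_label_sets)
  have SS: "?S \<times> ?S \<in> sets (site \<nu> \<Otimes>\<^sub>M site \<nu>)" by (rule pair_measureI[OF S S])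
  have eq: "(\<lambda>f. (f i, f j)) -` (?S \<times> ?S) \<inter> space (config_space N) = {f \<in> space (config_space N). fst (f i) = 1} \<inter> {f \<in> space (config_space N). fst (f j) = 1}" by auto
  have "measure (site \<nu> \<Otimes>\<^sub>M site \<nu>) (?S \<times> ?S) = measure (site \<nu>) ?S * measure (site \<nu>) ?S"
    by (simp only: measure_def site.emeasure_pair_measure_Times[OF S S] enn2real_mult)
  then show ?thesis
    using measure_distr[OF m SS] unfolding d eq site_label measure_label by simp
qed

lemma label_balance:
  assumes s: "0 < s"
  shows "measure (config_space N) {f \<in> space (config_space N). s \<le> \<bar>real (card {i \<in> {1..N}. fst (f i) = 1}) - N / 2\<bar>} \<le> N / s\<^sup>2"
proof -
  interpret C: prob_space "config_space N" by (rule prob_space_config)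
  let ?A = "\<lambda>i. {f \<in> space (config_space N). fst (f i) = 1}"
  have "C.prob {f \<in> space (config_space N). s \<le> \<bar>real (card {i \<in> {1..N}. f \<in> ?A i}) - card {1..N} * (1 / 2)\<bar>}
     \<le> real (card {(i, j) \<in> {1..N} \<times> {1..N}. i = j}) / s\<^sup>2"
  proof (rule C.chebyshev_dependency[OF finite_atLeastAtMost label_config_sets label_config _ s])
    show "C.prob (?A i \<inter> ?A j) = 1 / 2 * (1 / 2)" if "i \<in> {1..N}" "j \<in> {1..N}" "i \<noteq> j" for i j
      by (rule labels_indep[OF that])
  qed
  moreover have "card {(i, j) \<in> {1..N} \<times> {1..N}. i = j} = N"
  proof -
    have "{(i, j) \<in> {1..N} \<times> {1..N}. i = j} = (\<lambda>i. (i, i)) ` {1..N}" by auto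
    then show ?thesis by (simp add: card_image inj_on_def)
  qed
  moreover have "{f \<in> space (config_space N). s \<le> \<bar>real (card {i \<in> {1..N}. fst (f i) = 1}) - N / 2\<bar>} =
     {f \<in> space (config_space N). s \<le> \<bar>real (card {i \<in> {1..N}. f \<in> ?A i}) - card {1..N} * (1 / 2)\<bar>}"
    by (intro Collect_cong conj_cong refl) simp
  ultimately show ?thesis by (simp only:)
qed

lemma card_distinct_triples_le: "real (card (distinct_triples {1..N})) \<le> real N ^ 3"
proof -
  have "card (distinct_triples {1..N}) \<le> card ({1..N} \<times> {1..N} \<times> {1..N})"
    by (rule card_mono) (auto simp: distinct_triples_def)
  then have "card (distinct_triples {1..N}) \<le> N ^ 3" by (simp add: card_cartesian_product power3_eq_cube)
  then show ?thesis by (metis of_nat_le_iff of_nat_power)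
qed

text \<open>
  Markov's inequality for the number of triples with a given property.
\<close>

lemma few_triples:
  assumes Q: "Measurable.pred triple_space (\<lambda>g. Q (g 0) (g 1) (g 2))" and c: "0 < c"
  shows "measure (config_space N) {f \<in> space (config_space N). c \<le> real (card {(i, j, k) \<in> distinct_triples {1..N}. Q (f i) (f j) (f k)})}
    \<le> real N ^ 3 * triple_prob (\<lambda>g. Q (g 0) (g 1) (g 2)) / c"
proof -
  interpret C: prob_space "config_space N" by (rule prob_space_config)
  let ?p = "triple_prob (\<lambda>g. Q (g 0) (g 1) (g 2))"
  let ?E = "\<lambda>(i, j, k). {f \<in> space (config_space N). Q (f i) (f j) (f k)}"
  let ?T = "distinct_triples {1..N}"
  have fin: "finite ?T" by (rule finite_distinct_triples) simp
  have E: "?E t \<in> C.events" and PE: "C.prob (?E t) = ?p" if t: "t \<in> ?T" for t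
  proof -
    obtain i j k where ijk: "t = (i, j, k)" by (cases t)
    have h: "i \<in> {1..N}" "j \<in> {1..N}" "k \<in> {1..N}" "i \<noteq> j" "i \<noteq> k" "j \<noteq> k"
      using t unfolding ijk distinct_triples_def by auto
    show "?E t \<in> C.events" "C.prob (?E t) = ?p"
      unfolding ijk prod.case using triple_transfer[where Q = Q, OF h Q] by auto
  qed
  let ?u = "\<lambda>f. \<Sum>t\<in>?T. indicator (?E t) f :: real"
  have int: "integrable (config_space N) (\<lambda>f. indicator (?E t) f :: real)" if "t \<in> ?T" for t
    by (rule C.integrable_const_bound[where B = 1, OF _ borel_measurable_indicator[OF E[OF that]]]) (simp add: indicator_def)
  have cnt: "real (card {(i, j, k) \<in> ?T. Q (f i) (f j) (f k)}) = ?u f" if f: "f \<in> space (config_space N)" for f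
  proof -
    have "?u f = real (card (?T \<inter> {t. f \<in> ?E t}))" using fin by (simp add: indicator_def sum.If_cases)
    also have "?T \<inter> {t. f \<in> ?E t} = {(i, j, k) \<in> ?T. Q (f i) (f j) (f k)}" using f by auto
    finally show ?thesis ..
  qed
  have "C.prob {f \<in> space (config_space N). c \<le> ?u f} \<le> (\<integral>f. ?u f \<partial>config_space N) / c"
    by (rule integral_Markov_inequality_measure[where A = "space (config_space N)"])
      (use int c in \<open>auto intro!: Bochner_Integration.integrable_sum sum_nonneg\<close>)
  also have "(\<integral>f. ?u f \<partial>config_space N) = (\<Sum>t\<in>?T. C.prob (?E t))"
    using int E by (subst Bochner_Integration.integral_sum) (auto intro!: sum.cong)
  also have "\<dots> = real (card ?T) * ?p" using PE by simp
  also have "\<dots> / c \<le> real N ^ 3 * ?p / c"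
    using c card_distinct_triples_le by (intro divide_right_mono mult_right_mono) auto
  finally have "C.prob {f \<in> space (config_space N). c \<le> ?u f} \<le> real N ^ 3 * ?p / c" .
  moreover have "{f \<in> space (config_space N). c \<le> real (card {(i, j, k) \<in> ?T. Q (f i) (f j) (f k)})} = {f \<in> space (config_space N). c \<le> ?u f}"
    using cnt by (intro Collect_cong conj_cong refl) (simp only:)
  ultimately show ?thesis by (simp only:)
qed

definition located :: "nat \<Rightarrow> real \<Rightarrow> (nat \<Rightarrow> nat \<times> real \<times> plane) \<Rightarrow> nat \<Rightarrow> plane" where
  "located N \<sigma> f = (\<lambda>i\<in>{1..N}. point v \<sigma> (f i))"

lemma located_measurable [measurable]: "located N \<sigma> \<in> config_space N \<rightarrow>\<^sub>M PiM {1..N} (\<lambda>_. borel)"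
  unfolding located_def by measurable

lemma sample_count_config_measurable:
  assumes D: "D \<in> sets borel"
  shows "(\<lambda>(f, \<tau>). sample_count N M D (points \<sigma> f) \<tau>) \<in> borel_measurable (config_space N \<Otimes>\<^sub>M random_triples N M)"
proof -
  have "(\<lambda>p. (located N \<sigma> (fst p), snd p)) \<in> config_space N \<Otimes>\<^sub>M random_triples N M \<rightarrow>\<^sub>M PiM {1..N} (\<lambda>_. borel) \<Otimes>\<^sub>M random_triples N M"
    by measurable
  from measurable_compose[OF this sample_count_measurable[OF D]]
  have "(\<lambda>p. sample_count N M D (located N \<sigma> (fst p)) (snd p)) \<in> borel_measurable (config_space N \<Otimes>\<^sub>M random_triples N M)"
    by (simp only: prod.case)
  moreover have "sample_count N M D (located N \<sigma> f) \<tau> = sample_count N M D (points \<sigma> f) \<tau>" for f \<tau>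
    by (rule sample_count_cong) (simp add: located_def)
  ultimately show ?thesis by (simp only: case_prod_unfold)
qed

text \<open>
  The diagonal contributes \<open>M\<close>, each other pair at most \<open>9 / N\<close>.
\<close>

lemma expected_overlaps:
  assumes N: "3 \<le> N"
  shows "(\<lambda>\<tau>. real (card {(m, m') \<in> {1..M} \<times> {1..M}. overlap N \<tau> m m'})) \<in> borel_measurable (random_triples N M)"
    and "(\<integral>\<tau>. real (card {(m, m') \<in> {1..M} \<times> {1..M}. overlap N \<tau> m m'}) \<partial>random_triples N M) \<le> M + 9 * (real M)\<^sup>2 / N"
proof -
  interpret RT: prob_space "random_triples N M" by (rule prob_space_random_triples)
  let ?K = "{1..M} \<times> {1..M}"
  let ?E = "\<lambda>(m, m'). {\<tau> \<in> space (random_triples N M). overlap N \<tau> m m'}"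
  have cnt: "real (card {(m, m') \<in> ?K. overlap N \<tau> m m'}) = (\<Sum>q\<in>?K. indicator (?E q) \<tau>)" if \<tau>: "\<tau> \<in> space (random_triples N M)" for \<tau>
  proof -
    have "(\<Sum>q\<in>?K. indicator (?E q) \<tau> :: real) = real (card (?K \<inter> {q. \<tau> \<in> ?E q}))" by (simp add: indicator_def sum.If_cases)
    also have "?K \<inter> {q. \<tau> \<in> ?E q} = {(m, m') \<in> ?K. overlap N \<tau> m m'}" using \<tau> by auto
    finally show ?thesis ..
  qed
  have E: "?E q \<in> RT.events" if q: "q \<in> ?K" for q
  proof -
    obtain m m' where mm: "q = (m, m')" "m \<in> {1..M}" "m' \<in> {1..M}" using q by (cases q) auto
    have S: "{\<tau> \<in> space (random_triples N M). i \<in> \<tau> m''} \<in> RT.events" if "m'' \<in> {1..M}" for i m''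
    proof -
      have "(\<lambda>\<tau>. \<tau> m'') \<in> random_triples N M \<rightarrow>\<^sub>M triple_pmf N"
        unfolding random_triples_eq using that by (rule measurable_component_singleton)
      from measurable_sets[OF this, of "{\<tau>. i \<in> \<tau>}"] show ?thesis by (simp add: vimage_def Int_def conj_commute)
    qed
    have "?E q = (\<Union>i\<in>{1..N}. {\<tau> \<in> space (random_triples N M). i \<in> \<tau> m} \<inter> {\<tau> \<in> space (random_triples N M). i \<in> \<tau> m'})"
      unfolding mm by auto
    then show ?thesis using S[OF mm(2)] S[OF mm(3)] by (simp only:) (intro sets.finite_UN sets.Int, auto)
  qed
  have PE: "RT.prob (?E q) \<le> (if fst q = snd q then 1 else 0) + 9 / N" if q: "q \<in> ?K" for q
  proof -
    obtain m m' where mm: "q = (m, m')" "m \<in> {1..M}" "m' \<in> {1..M}" using q by (cases q) auto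
    show ?thesis
    proof (cases "m = m'")
      case True
      have "(1 :: real) \<le> (if fst q = snd q then 1 else 0) + 9 / N" using True mm by simp
      then show ?thesis by (rule order_trans[OF RT.prob_le_1])
    next
      case False
      then show ?thesis using triples_meet_prob[OF N mm(2,3) False] mm by simp
    qed
  qed
  have int: "integrable (random_triples N M) (\<lambda>\<tau>. indicator (?E q) \<tau> :: real)" if "q \<in> ?K" for q
    using E[OF that] by (simp add: integrable_indicator_iff less_top[symmetric])
  have "(\<lambda>\<tau>. \<Sum>q\<in>?K. indicator (?E q) \<tau> :: real) \<in> borel_measurable (random_triples N M)"
    using E by (intro borel_measurable_sum borel_measurable_indicator)
  then show "(\<lambda>\<tau>. real (card {(m, m') \<in> ?K. overlap N \<tau> m m'})) \<in> borel_measurable (random_triples N M)"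
    by (subst measurable_cong[OF cnt])
  have "(\<integral>\<tau>. real (card {(m, m') \<in> ?K. overlap N \<tau> m m'}) \<partial>random_triples N M) = (\<integral>\<tau>. (\<Sum>q\<in>?K. indicator (?E q) \<tau>) \<partial>random_triples N M)"
    by (intro Bochner_Integration.integral_cong refl cnt)
  also have "\<dots> = (\<Sum>q\<in>?K. RT.prob (?E q))"
    using int E by (subst Bochner_Integration.integral_sum) (auto intro!: sum.cong)
  also have "\<dots> \<le> (\<Sum>q\<in>?K. (if fst q = snd q then 1 else 0) + 9 / N)" by (intro sum_mono PE)
  also have "\<dots> = (\<Sum>q\<in>?K. (if fst q = snd q then 1 else 0)) + real (card ?K) * (9 / N)"
    by (simp only: sum.distrib sum_constant)
  also have "(\<Sum>q\<in>?K. (if fst q = snd q then 1 else 0 :: real)) = (\<Sum>m\<in>{1..M}. \<Sum>m'\<in>{1..M}. if m = m' then 1 else 0)"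
    by (simp only: sum.cartesian_product case_prod_unfold)
  also have "\<dots> = M" by (simp add: sum.delta)
  also have "real (card ?K) = (real M)\<^sup>2" by (simp add: card_cartesian_product power2_eq_square)
  finally show "(\<integral>\<tau>. real (card {(m, m') \<in> ?K. overlap N \<tau> m m'}) \<partial>random_triples N M) \<le> M + 9 * (real M)\<^sup>2 / N"
    by (simp add: mult.commute)
qed

lemma deviation_event_measurable:
  assumes "D \<in> sets borel"
  shows "{(f, \<tau>) \<in> space (config_space N \<Otimes>\<^sub>M random_triples N M). s \<le> \<bar>sample_count N M D (points \<sigma> f) \<tau> - c\<bar>}
    \<in> sets (config_space N \<Otimes>\<^sub>M random_triples N M)" (is "?A \<in> sets ?P")
proof -
  have [measurable]: "(\<lambda>p. sample_count N M D (points \<sigma> (fst p)) (snd p)) \<in> borel_measurable ?P"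
    using sample_count_config_measurable[OF assms] by (simp only: case_prod_unfold)
  have "{p \<in> space ?P. s \<le> \<bar>sample_count N M D (points \<sigma> (fst p)) (snd p) - c\<bar>} \<in> sets ?P" by measurable
  then show ?thesis by (simp only: case_prod_unfold mem_Collect_eq prod.collapse)
qed

text \<open>
  Fubini: average the bound for fixed triples over the samples.
\<close>

lemma sample_deviation:
  assumes N: "3 \<le> N" and D: "D \<in> sets borel" and s: "0 < s"
  shows "measure (config_space N \<Otimes>\<^sub>M random_triples N M)
     {(f, \<tau>) \<in> space (config_space N \<Otimes>\<^sub>M random_triples N M). s \<le> \<bar>sample_count N M D (points \<sigma> f) \<tau> - M * triple_prob (\<lambda>g. residual \<sigma> g \<in> D)\<bar>}
    \<le> (M + 9 * (real M)\<^sup>2 / N) / s\<^sup>2"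
proof -
  interpret C: prob_space "config_space N" by (rule prob_space_config)
  interpret RT: prob_space "random_triples N M" by (rule prob_space_random_triples)
  interpret P: pair_prob_space "config_space N" "random_triples N M" ..
  let ?p = "triple_prob (\<lambda>g. residual \<sigma> g \<in> D)"
  let ?P = "config_space N \<Otimes>\<^sub>M random_triples N M"
  let ?F = "{(f, \<tau>) \<in> space ?P. s \<le> \<bar>sample_count N M D (points \<sigma> f) \<tau> - M * ?p\<bar>}"
  let ?o = "\<lambda>\<tau>. real (card {(m, m') \<in> {1..M} \<times> {1..M}. overlap N \<tau> m m'})"
  have F: "?F \<in> sets ?P" by (rule deviation_event_measurable[OF D])
  have bound: "emeasure (config_space N) ((\<lambda>f. (f, \<tau>)) -` ?F) \<le> ennreal (?o \<tau> / s\<^sup>2)"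
    if \<tau>: "\<tau> \<in> space (random_triples N M)" "\<forall>m\<in>{1..M}. \<tau> m \<in> triples N" for \<tau>
  proof -
    have "(\<lambda>f. (f, \<tau>)) -` ?F = {f \<in> space (config_space N). s \<le> \<bar>sample_count N M D (points \<sigma> f) \<tau> - M * ?p\<bar>}"
      using \<tau> by (auto simp: space_pair_measure)
    then have "emeasure (config_space N) ((\<lambda>f. (f, \<tau>)) -` ?F) = ennreal (C.prob {f \<in> space (config_space N). s \<le> \<bar>sample_count N M D (points \<sigma> f) \<tau> - M * ?p\<bar>})"
      by (simp only: C.emeasure_eq_measure)
    also have "\<dots> \<le> ennreal (?o \<tau> / s\<^sup>2)"
      using N \<tau> D s by (intro ennreal_leI sample_deviation_given) auto
    finally show ?thesis .
  qed
  have int: "integrable (random_triples N M) (\<lambda>\<tau>. ?o \<tau> / s\<^sup>2)"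
  proof (intro integrable_divide RT.integrable_const_bound[where B = "real (card ({1..M} \<times> {1..M}))"])
    show "AE \<tau> in random_triples N M. norm (?o \<tau>) \<le> real (card ({1..M} \<times> {1..M}))"
    proof (intro AE_I2)
      fix \<tau>
      have "card {(m, m') \<in> {1..M} \<times> {1..M}. overlap N \<tau> m m'} \<le> card ({1..M} \<times> {1..M})" by (rule card_mono) auto
      then show "norm (?o \<tau>) \<le> real (card ({1..M} \<times> {1..M}))"
        unfolding real_norm_def abs_of_nat of_nat_le_iff .
    qed
  qed (rule expected_overlaps(1)[OF N])
  have "emeasure ?P ?F = (\<integral>\<^sup>+ \<tau>. emeasure (config_space N) ((\<lambda>f. (f, \<tau>)) -` ?F) \<partial>random_triples N M)"
    by (rule P.emeasure_pair_measure_alt2[OF F])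
  also have "\<dots> \<le> (\<integral>\<^sup>+ \<tau>. ennreal (?o \<tau> / s\<^sup>2) \<partial>random_triples N M)"
    by (rule nn_integral_mono_AE) (use AE_random_triples[OF N, of M] AE_space in eventually_elim, rule bound)
  also have "\<dots> = ennreal (\<integral>\<tau>. ?o \<tau> / s\<^sup>2 \<partial>random_triples N M)"
    by (rule nn_integral_eq_integral[OF int]) auto
  also have "\<dots> = ennreal ((\<integral>\<tau>. ?o \<tau> \<partial>random_triples N M) / s\<^sup>2)" by simp
  also have "\<dots> \<le> ennreal ((M + 9 * (real M)\<^sup>2 / N) / s\<^sup>2)"
    using expected_overlaps(2)[OF N, of M] by (intro ennreal_leI divide_right_mono) auto
  finally have "emeasure ?P ?F \<le> ennreal ((M + 9 * (real M)\<^sup>2 / N) / s\<^sup>2)" .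
  moreover have "0 \<le> (M + 9 * (real M)\<^sup>2 / N) / s\<^sup>2" by simp
  ultimately show ?thesis
    by (simp only: P.emeasure_eq_measure ennreal_le_iff)
qed

end

section \<open>Atypical outcomes\<close>

lemma (in pair_prob_space) prob_fst_event:
  assumes A: "{p \<in> space (M1 \<Otimes>\<^sub>M M2). Q (fst p)} \<in> sets (M1 \<Otimes>\<^sub>M M2)"
  shows "measure (M1 \<Otimes>\<^sub>M M2) {p \<in> space (M1 \<Otimes>\<^sub>M M2). Q (fst p)} = measure M1 {x \<in> space M1. Q x}"
proof -
  obtain y where y: "y \<in> space M2" using M2.not_empty by blast
  have "(\<lambda>x. (x, y)) -` {p \<in> space (M1 \<Otimes>\<^sub>M M2). Q (fst p)} = {x \<in> space M1. Q x}"
    using y by (auto simp: space_pair_measure)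
  then have "{x \<in> space M1. Q x} \<in> sets M1" using sets_Pair2[OF A, of y] by simp
  moreover have "{p \<in> space (M1 \<Otimes>\<^sub>M M2). Q (fst p)} = {x \<in> space M1. Q x} \<times> space M2"
    by (auto simp: space_pair_measure)
  ultimately show ?thesis
    by (simp add: measure_def M2.emeasure_pair_measure_Times M2.emeasure_space_1)
qed

lemma (in pair_prob_space) prob_snd_event:
  assumes A: "{p \<in> space (M1 \<Otimes>\<^sub>M M2). Q (snd p)} \<in> sets (M1 \<Otimes>\<^sub>M M2)"
  shows "measure (M1 \<Otimes>\<^sub>M M2) {p \<in> space (M1 \<Otimes>\<^sub>M M2). Q (snd p)} = measure M2 {y \<in> space M2. Q y}"
proof -
  obtain x where x: "x \<in> space M1" using M1.not_empty by blast
  have "Pair x -` {p \<in> space (M1 \<Otimes>\<^sub>M M2). Q (snd p)} = {y \<in> space M2. Q y}"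
    using x by (auto simp: space_pair_measure)
  then have "{y \<in> space M2. Q y} \<in> sets M2" using sets_Pair1[OF A, of x] by simp
  moreover have "{p \<in> space (M1 \<Otimes>\<^sub>M M2). Q (snd p)} = space M1 \<times> {y \<in> space M2. Q y}"
    by (auto simp: space_pair_measure)
  ultimately show ?thesis
    by (simp add: measure_def M2.emeasure_pair_measure_Times M1.emeasure_space_1)
qed

abbreviation sample_space :: "nat \<Rightarrow> ((nat \<Rightarrow> nat) \<times> (nat \<Rightarrow> plane)) measure" where
  "sample_space N \<equiv> PiM {1..N} (\<lambda>_. count_space UNIV) \<Otimes>\<^sub>M PiM {1..N} (\<lambda>_. borel)"

text \<open>
  These triples include every one that is misjudged by some threshold between \<open>T\<close> and \<open>t\<close>. They
  do not refer to the sample, hence a first moment bounds their number.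
\<close>

definition wrong_triples :: "nat \<Rightarrow> real \<Rightarrow> real \<Rightarrow> (nat \<Rightarrow> nat) \<Rightarrow> (nat \<Rightarrow> plane) \<Rightarrow> (nat \<times> nat \<times> nat) set" where
  "wrong_triples N T t z x = {(i, j, k) \<in> distinct_triples {1..N}.
     (z i = z j \<and> z j = z k) \<and> T < tls3 (x i, x j, x k) \<or> \<not> (z i = z j \<and> z j = z k) \<and> tls3 (x i, x j, x k) \<le> t}"

lemma wrong_indicator_measurable:
  fixes a b c :: "'a \<Rightarrow> nat" and r :: "'a \<Rightarrow> real"
  assumes [measurable]: "a \<in> S \<rightarrow>\<^sub>M count_space UNIV" "b \<in> S \<rightarrow>\<^sub>M count_space UNIV" "c \<in> S \<rightarrow>\<^sub>M count_space UNIV"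
    "r \<in> borel_measurable S"
  shows "(\<lambda>p. of_bool ((a p = b p \<and> b p = c p) \<and> T < r p \<or> \<not> (a p = b p \<and> b p = c p) \<and> r p \<le> t) :: real) \<in> borel_measurable S"
proof -
  have eq: "Measurable.pred S (\<lambda>p. f p = g p)" if "f \<in> S \<rightarrow>\<^sub>M count_space UNIV" "g \<in> S \<rightarrow>\<^sub>M count_space UNIV" for f g :: "'a \<Rightarrow> nat"
  proof -
    have [measurable]: "(\<lambda>p. real (f p)) \<in> borel_measurable S" "(\<lambda>p. real (g p)) \<in> borel_measurable S"
      by (rule measurable_compose[OF that(1)], simp, rule measurable_compose[OF that(2)], simp)
    have "Measurable.pred S (\<lambda>p. real (f p) = real (g p))" by measurable
    then show ?thesis by simp
  qed
  note [measurable] = eq[OF assms(1,2)] eq[OF assms(2,3)]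
  show ?thesis by measurable
qed

lemma wrong_triples_measurable:
  "(\<lambda>p. real (card (wrong_triples N T t (fst p) (snd p)))) \<in> borel_measurable (sample_space N)"
proof -
  let ?Q = "\<lambda>(i, j, k) (p :: (nat \<Rightarrow> nat) \<times> (nat \<Rightarrow> plane)). (fst p i = fst p j \<and> fst p j = fst p k) \<and> T < tls3 (snd p i, snd p j, snd p k)
    \<or> \<not> (fst p i = fst p j \<and> fst p j = fst p k) \<and> tls3 (snd p i, snd p j, snd p k) \<le> t"
  have fin: "finite (distinct_triples {1..N})" by (rule finite_distinct_triples) simp
  have "card (wrong_triples N T t (fst p) (snd p)) = (\<Sum>q\<in>distinct_triples {1..N}. of_bool (?Q q p))" for p
  proof -
    have "(\<Sum>q\<in>distinct_triples {1..N}. of_bool (?Q q p)) = card (distinct_triples {1..N} \<inter> {q. ?Q q p})"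
      using fin by (simp add: of_bool_def sum.If_cases)
    also have "distinct_triples {1..N} \<inter> {q. ?Q q p} = wrong_triples N T t (fst p) (snd p)"
      by (auto simp: wrong_triples_def)
    finally show ?thesis ..
  qed
  moreover have "(\<lambda>p. of_bool (?Q q p) :: real) \<in> borel_measurable (sample_space N)" if q: "q \<in> distinct_triples {1..N}" for q
  proof -
    obtain i j k where ijk: "q = (i, j, k)" by (cases q)
    have n: "i \<in> {1..N}" "j \<in> {1..N}" "k \<in> {1..N}" using q unfolding ijk distinct_triples_def by auto
    have z: "(\<lambda>p. fst p n) \<in> sample_space N \<rightarrow>\<^sub>M count_space UNIV" and x: "(\<lambda>p. snd p n) \<in> borel_measurable (sample_space N)"
      if "n \<in> {1..N}" for n using that by measurable
    have "(\<lambda>p. (snd p i, snd p j, snd p k)) \<in> sample_space N \<rightarrow>\<^sub>M borel \<Otimes>\<^sub>M borel \<Otimes>\<^sub>M borel"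
      by (intro measurable_Pair x n)
    from measurable_compose[OF this tls3_measurable] have r: "(\<lambda>p. tls3 (snd p i, snd p j, snd p k)) \<in> borel_measurable (sample_space N)" .
    show ?thesis unfolding ijk prod.case by (rule wrong_indicator_measurable[OF z[OF n(1)] z[OF n(2)] z[OF n(3)] r])
  qed
  ultimately show ?thesis by simp
qed

abbreviation outcome_space :: "nat \<Rightarrow> nat \<Rightarrow> (((nat \<Rightarrow> nat) \<times> (nat \<Rightarrow> plane)) \<times> (nat \<Rightarrow> nat set)) measure" where
  "outcome_space N M \<equiv> sample_space N \<Otimes>\<^sub>M random_triples N M"

text \<open>
  The ways in which an outcome can fail to be typical. The first two say that the \<open>k\<close>-th smallest
  sampled residual may be less than \<open>T\<close> or greater than \<open>t\<close>; the last two have probability zero.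
\<close>

definition "low_threshold N M k T = {p \<in> space (outcome_space N M). k \<le> sample_count N M {..<T} (snd (fst p)) (snd p)}"
definition "high_threshold N M k t = {p \<in> space (outcome_space N M). sample_count N M {..t} (snd (fst p)) (snd p) < k}"
definition "many_wrong N M c T t = {p \<in> space (outcome_space N M). c \<le> real (card (wrong_triples N T t (fst (fst p)) (snd (fst p))))}"
definition "unbalanced N M c = {p \<in> space (outcome_space N M). c \<le> \<bar>real (card {i \<in> {1..N}. fst (fst p) i = 1}) - N / 2\<bar>}"
definition "bad_labels N M = {p \<in> space (outcome_space N M). \<not> (\<forall>i\<in>{1..N}. fst (fst p) i \<in> {1, 2})}"
definition "bad_sample N M = {p \<in> space (outcome_space N M). \<not> (\<forall>m\<in>{1..M}. snd p m \<in> triples N)}"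

definition failure :: "nat \<Rightarrow> nat \<Rightarrow> real \<Rightarrow> real \<Rightarrow> real \<Rightarrow> real \<Rightarrow> (((nat \<Rightarrow> nat) \<times> (nat \<Rightarrow> plane)) \<times> (nat \<Rightarrow> nat set)) set" where
  "failure N M \<gamma> k T t = low_threshold N M k T \<union> (high_threshold N M k t \<union> (many_wrong N M (\<gamma> * real N ^ 3) T t
     \<union> (unbalanced N M (\<gamma> * N) \<union> (bad_labels N M \<union> bad_sample N M))))"

lemma failure_parts_measurable:
  shows "low_threshold N M k T \<in> sets (outcome_space N M)" "high_threshold N M k t \<in> sets (outcome_space N M)"
    and "many_wrong N M c T t \<in> sets (outcome_space N M)" "unbalanced N M c \<in> sets (outcome_space N M)"
    and "bad_labels N M \<in> sets (outcome_space N M)" "bad_sample N M \<in> sets (outcome_space N M)"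
proof -
  let ?S = "outcome_space N M"
  have [measurable]: "(\<lambda>p. sample_count N M D (snd (fst p)) (snd p)) \<in> borel_measurable ?S" if "D \<in> sets borel" for D
  proof -
    have "(\<lambda>p. (snd (fst p), snd p)) \<in> ?S \<rightarrow>\<^sub>M PiM {1..N} (\<lambda>_. borel) \<Otimes>\<^sub>M random_triples N M" by measurable
    from measurable_compose[OF this sample_count_measurable[OF that]] show ?thesis by simp
  qed
  have [measurable]: "(\<lambda>p. real (card (wrong_triples N T t (fst (fst p)) (snd (fst p))))) \<in> borel_measurable ?S"
    using measurable_compose[OF measurable_fst wrong_triples_measurable] by simp
  have [measurable]: "Measurable.pred ?S (\<lambda>p. fst (fst p) i \<in> A)" if "i \<in> {1..N}" for i and A :: "nat set"
  proof -
    have "(\<lambda>p. fst (fst p) i) \<in> ?S \<rightarrow>\<^sub>M count_space UNIV" using that by measurable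
    then show ?thesis by measurable
  qed
  have [measurable]: "(\<lambda>p. real (card {i \<in> {1..N}. fst (fst p) i = 1})) \<in> borel_measurable ?S"
  proof -
    have "real (card {i \<in> {1..N}. z i = 1}) = (\<Sum>i\<in>{1..N}. of_bool (z i \<in> {1}))" for z :: "nat \<Rightarrow> nat"
      by (simp add: of_bool_def sum.If_cases Int_def)
    then show ?thesis by (simp only:) measurable
  qed
  have [measurable]: "Measurable.pred ?S (\<lambda>p. snd p m \<in> triples N)" if "m \<in> {1..M}" for m
  proof -
    have "(\<lambda>p. snd p m) \<in> ?S \<rightarrow>\<^sub>M triple_pmf N" unfolding random_triples_eq using that by measurable
    from measurable_sets[OF this, of "triples N"] show ?thesis by (simp add: pred_def vimage_def Int_def conj_commute)
  qed
  show "low_threshold N M k T \<in> sets ?S" "high_threshold N M k t \<in> sets ?S" "many_wrong N M c T t \<in> sets ?S"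
    "unbalanced N M c \<in> sets ?S" "bad_labels N M \<in> sets ?S" "bad_sample N M \<in> sets ?S"
    unfolding low_threshold_def high_threshold_def many_wrong_def unbalanced_def bad_labels_def bad_sample_def by measurable
qed

lemma failure_measurable: "failure N M \<gamma> k T t \<in> sets (outcome_space N M)"
  unfolding failure_def by (intro sets.Un failure_parts_measurable)

context line_mixture
begin

lemma triple_prob_split:
  assumes [measurable]: "Measurable.pred triple_space Q" "Measurable.pred triple_space Q'"
  shows "triple_prob Q = triple_prob (\<lambda>g. Q' g \<and> Q g) + triple_prob (\<lambda>g. \<not> Q' g \<and> Q g)"
proof -
  have "{g \<in> space triple_space. Q g} = {g \<in> space triple_space. Q' g \<and> Q g} \<union> {g \<in> space triple_space. \<not> Q' g \<and> Q g}" by auto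
  moreover have "triple_prob (\<lambda>g. Q' g \<and> Q g) + triple_prob (\<lambda>g. \<not> Q' g \<and> Q g)
    = measure triple_space ({g \<in> space triple_space. Q' g \<and> Q g} \<union> {g \<in> space triple_space. \<not> Q' g \<and> Q g})"
    by (rule triple.finite_measure_Union[symmetric], measurable) blast
  ultimately show ?thesis by (simp only:)
qed

lemma triple_prob_split':
  assumes [measurable]: "Measurable.pred triple_space Q" "Measurable.pred triple_space Q'"
  shows "triple_prob Q = triple_prob (\<lambda>g. Q g \<and> Q' g) + triple_prob (\<lambda>g. Q g \<and> \<not> Q' g)"
proof -
  have "triple_prob (\<lambda>g. Q g \<and> Q' g) = triple_prob (\<lambda>g. Q' g \<and> Q g)" "triple_prob (\<lambda>g. Q g \<and> \<not> Q' g) = triple_prob (\<lambda>g. \<not> Q' g \<and> Q g)"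
    by (intro arg_cong[of _ _ "measure triple_space"] Collect_cong; blast)+
  then show ?thesis using triple_prob_split[OF assms] by simp
qed

lemma AE_labels_config: "AE f in config_space N. \<forall>i\<in>{1..N}. fst (f i) \<in> {1, 2}"
proof (rule AE_finite_allI)
  fix i assume i: "i \<in> {1..N}"
  have "AE f in config_space N. fst (f i) \<in> {1, 2} \<and> \<bar>weight (f i)\<bar> \<le> R"
    by (rule AE_PiM_component[OF site.prob_space_axioms i AE_site])
  then show "AE f in config_space N. fst (f i) \<in> {1, 2}" by eventually_elim simp
qed simp

text \<open>
  Every part of the failure event is pulled back to independent sites, where \<open>sample_deviation\<close>,
  \<open>few_triples\<close> and \<open>label_balance\<close> apply.
\<close>

lemma failure_prob:
  assumes N: "3 \<le> N" and \<gamma>: "0 < \<gamma>" and s: "0 < s1" "0 < s2"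
    and k1: "s1 \<le> k - M * triple_prob (\<lambda>g. residual \<sigma> g \<in> {..<T})"
    and k2: "s2 \<le> M * triple_prob (\<lambda>g. residual \<sigma> g \<in> {..t}) - k"
  shows "measure (GLMM N v \<nu> \<sigma> \<Otimes>\<^sub>M random_triples N M) (failure N M \<gamma> k T t)
    \<le> (M + 9 * (real M)\<^sup>2 / N) / s1\<^sup>2 + ((M + 9 * (real M)\<^sup>2 / N) / s2\<^sup>2
     + ((triple_prob (\<lambda>g. pure g \<and> T < residual \<sigma> g) + triple_prob (\<lambda>g. \<not> pure g \<and> residual \<sigma> g \<le> t)) / \<gamma>
     + N / (\<gamma> * N)\<^sup>2))"
proof -
  interpret C: prob_space "config_space N" by (rule prob_space_config)
  interpret RT: prob_space "random_triples N M" by (rule prob_space_random_triples)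
  interpret P: pair_prob_space "config_space N" "random_triples N M" ..
  let ?P = "config_space N \<Otimes>\<^sub>M random_triples N M"
  let ?S = "outcome_space N M"
  let ?G = "GLMM N v \<nu> \<sigma> \<Otimes>\<^sub>M random_triples N M"
  let ?\<Phi> = "\<lambda>(f, \<tau>). (unzip_points N v \<sigma> f, \<tau>)"
  note um = unzip_points_measurable[OF sets_nu, of N v \<sigma>]
  have \<Phi>: "?\<Phi> \<in> ?P \<rightarrow>\<^sub>M ?S" using um by measurable
  have law: "?G = distr ?P ?S ?\<Phi>"
  proof -
    have "?G = distr (config_space N) (sample_space N) (unzip_points N v \<sigma>) \<Otimes>\<^sub>M distr (random_triples N M) (random_triples N M) (\<lambda>x. x)"
      unfolding GLMM_eq_distr_site[OF prob_nu sets_nu] by simp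
    also have "\<dots> = distr ?P ?S (\<lambda>(x, y). (unzip_points N v \<sigma> x, y))"
      by (rule pair_measure_distr[OF um measurable_ident_sets[OF refl]]) (simp add: RT.sigma_finite_measure_axioms)
    finally show ?thesis .
  qed
  have pull: "measure ?G {p \<in> space ?S. Q p} = measure ?P {p \<in> space ?P. H p}" "{p \<in> space ?P. H p} \<in> sets ?P"
    if Q: "{p \<in> space ?S. Q p} \<in> sets ?S" and eq: "\<And>f \<tau>. Q (unzip_points N v \<sigma> f, \<tau>) \<longleftrightarrow> H (f, \<tau>)" for Q H
  proof -
    have "?\<Phi> -` {p \<in> space ?S. Q p} \<inter> space ?P = {p \<in> space ?P. H p}"
      using measurable_space[OF \<Phi>] eq by auto
    with measure_distr[OF \<Phi> Q] measurable_sets[OF \<Phi> Q]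
    show "measure ?G {p \<in> space ?S. Q p} = measure ?P {p \<in> space ?P. H p}" "{p \<in> space ?P. H p} \<in> sets ?P"
      unfolding law by simp_all
  qed
  have z: "fst (unzip_points N v \<sigma> f) i = fst (f i)" and x: "snd (unzip_points N v \<sigma> f) i = point v \<sigma> (f i)"
    if "i \<in> {1..N}" for f i using that by (auto simp: unzip_points_def)
  have sc: "sample_count N M D (snd (unzip_points N v \<sigma> f)) \<tau> = sample_count N M D (points \<sigma> f) \<tau>" for D f \<tau>
    by (rule sample_count_cong) (rule x)
  let ?W = "\<lambda>p q r. (fst p = fst q \<and> fst q = fst r) \<and> T < tls3 (point v \<sigma> p, point v \<sigma> q, point v \<sigma> r)
     \<or> \<not> (fst p = fst q \<and> fst q = fst r) \<and> tls3 (point v \<sigma> p, point v \<sigma> q, point v \<sigma> r) \<le> t"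
  have w: "wrong_triples N T t (fst (unzip_points N v \<sigma> f)) (snd (unzip_points N v \<sigma> f)) = {(i, j, k) \<in> distinct_triples {1..N}. ?W (f i) (f j) (f k)}" for f
    unfolding wrong_triples_def by (intro Collect_cong) (auto simp: distinct_triples_def z x split: prod.splits)
  have W: "Measurable.pred triple_space (\<lambda>g. ?W (g 0) (g 1) (g 2))" by measurable
  have N3: "0 < \<gamma> * real N ^ 3" and N1: "0 < \<gamma> * N" using N \<gamma> by auto
  have "measure ?G (low_threshold N M k T) \<le> (M + 9 * (real M)\<^sup>2 / N) / s1\<^sup>2"
  proof -
    let ?A = "{(f, \<tau>) \<in> space ?P. s1 \<le> \<bar>sample_count N M {..<T} (points \<sigma> f) \<tau> - M * triple_prob (\<lambda>g. residual \<sigma> g \<in> {..<T})\<bar>}"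
    have "measure ?G (low_threshold N M k T) = measure ?P {p \<in> space ?P. k \<le> sample_count N M {..<T} (points \<sigma> (fst p)) (snd p)}"
      unfolding low_threshold_def by (rule pull(1)[OF failure_parts_measurable(1)[unfolded low_threshold_def]]) (simp add: sc)
    also have "\<dots> \<le> measure ?P ?A"
      by (rule P.finite_measure_mono[OF _ deviation_event_measurable]) (use k1 in \<open>auto simp: abs_le_iff\<close>)
    also have "\<dots> \<le> (M + 9 * (real M)\<^sup>2 / N) / s1\<^sup>2" by (rule sample_deviation[OF N _ s(1)]) simp
    finally show ?thesis .
  qed
  moreover have "measure ?G (high_threshold N M k t) \<le> (M + 9 * (real M)\<^sup>2 / N) / s2\<^sup>2"
  proof -
    let ?A = "{(f, \<tau>) \<in> space ?P. s2 \<le> \<bar>sample_count N M {..t} (points \<sigma> f) \<tau> - M * triple_prob (\<lambda>g. residual \<sigma> g \<in> {..t})\<bar>}"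
    have "measure ?G (high_threshold N M k t) = measure ?P {p \<in> space ?P. sample_count N M {..t} (points \<sigma> (fst p)) (snd p) < k}"
      unfolding high_threshold_def by (rule pull(1)[OF failure_parts_measurable(2)[unfolded high_threshold_def]]) (simp add: sc)
    also have "\<dots> \<le> measure ?P ?A"
      by (rule P.finite_measure_mono[OF _ deviation_event_measurable]) (use k2 in \<open>auto simp: abs_le_iff\<close>)
    also have "\<dots> \<le> (M + 9 * (real M)\<^sup>2 / N) / s2\<^sup>2" by (rule sample_deviation[OF N _ s(2)]) simp
    finally show ?thesis .
  qed
  moreover have "measure ?G (many_wrong N M (\<gamma> * real N ^ 3) T t)
    \<le> (triple_prob (\<lambda>g. pure g \<and> T < residual \<sigma> g) + triple_prob (\<lambda>g. \<not> pure g \<and> residual \<sigma> g \<le> t)) / \<gamma>"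
  proof -
    note p = pull[of _ "\<lambda>p. \<gamma> * real N ^ 3 \<le> real (card {(i, j, k) \<in> distinct_triples {1..N}. ?W (fst p i) (fst p j) (fst p k)})",
      OF failure_parts_measurable(3)[where c = "\<gamma> * real N ^ 3" and T = T and t = t, unfolded many_wrong_def]]
    have "measure ?G (many_wrong N M (\<gamma> * real N ^ 3) T t) = C.prob {f \<in> space (config_space N). \<gamma> * real N ^ 3 \<le> real (card {(i, j, k) \<in> distinct_triples {1..N}. ?W (f i) (f j) (f k)})}"
      unfolding many_wrong_def by (subst p(1)) (simp only: fst_conv snd_conv w, rule P.prob_fst_event, rule p(2), simp only: fst_conv snd_conv w)
    also have "\<dots> \<le> real N ^ 3 * triple_prob (\<lambda>g. ?W (g 0) (g 1) (g 2)) / (\<gamma> * real N ^ 3)"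
      by (rule few_triples[where Q = ?W, OF W N3])
    also have "\<dots> = triple_prob (\<lambda>g. (pure g \<and> T < residual \<sigma> g) \<or> (\<not> pure g \<and> residual \<sigma> g \<le> t)) / \<gamma>"
      using N by (simp add: pure_def residual_def)
    also have "\<dots> \<le> (triple_prob (\<lambda>g. pure g \<and> T < residual \<sigma> g) + triple_prob (\<lambda>g. \<not> pure g \<and> residual \<sigma> g \<le> t)) / \<gamma>"
    proof (intro divide_right_mono triple_prob_Or_le)
      show "0 \<le> \<gamma>" using \<gamma> by simp
    qed measurable
    finally show ?thesis .
  qed
  moreover have "measure ?G (unbalanced N M (\<gamma> * N)) \<le> N / (\<gamma> * N)\<^sup>2"
  proof -
    have c: "{i \<in> {1..N}. fst (unzip_points N v \<sigma> f) i = 1} = {i \<in> {1..N}. fst (f i) = 1}" for f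
      by (intro Collect_cong conj_cong refl) (simp only: z)
    note p = pull[of _ "\<lambda>p. \<gamma> * N \<le> \<bar>real (card {i \<in> {1..N}. fst (fst p i) = 1}) - N / 2\<bar>",
      OF failure_parts_measurable(4)[unfolded unbalanced_def]]
    have "measure ?G (unbalanced N M (\<gamma> * N)) = C.prob {f \<in> space (config_space N). \<gamma> * N \<le> \<bar>real (card {i \<in> {1..N}. fst (f i) = 1}) - N / 2\<bar>}"
      unfolding unbalanced_def by (subst p(1)) (simp only: fst_conv c, rule P.prob_fst_event, rule p(2), simp only: fst_conv c)
    also have "\<dots> \<le> N / (\<gamma> * N)\<^sup>2" by (rule label_balance[OF N1])
    finally show ?thesis .
  qed
  moreover have "measure ?G (bad_labels N M) = 0"
  proof -
    have l: "(\<forall>i\<in>{1..N}. fst (unzip_points N v \<sigma> f) i \<in> {1, 2}) \<longleftrightarrow> (\<forall>i\<in>{1..N}. fst (f i) \<in> {1, 2})" for f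
      by (intro ball_cong refl) (simp only: z)
    note p = pull[of _ "\<lambda>p. \<not> (\<forall>i\<in>{1..N}. fst (fst p i) \<in> {1, 2})",
      OF failure_parts_measurable(5)[unfolded bad_labels_def]]
    have "measure ?G (bad_labels N M) = C.prob {f \<in> space (config_space N). \<not> (\<forall>i\<in>{1..N}. fst (f i) \<in> {1, 2})}"
      unfolding bad_labels_def by (subst p(1)) (simp only: fst_conv l, rule P.prob_fst_event, rule p(2), simp only: fst_conv l)
    also have "\<dots> = 0"
    proof (rule C.prob_eq_0_AE)
      show "AE f in config_space N. \<not> \<not> (\<forall>i\<in>{1..N}. fst (f i) \<in> {1, 2})"
        using AE_labels_config by eventually_elim blast
    qed
    finally show ?thesis .
  qed
  moreover have "measure ?G (bad_sample N M) = 0"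
  proof -
    note p = pull[of _ "\<lambda>p. \<not> (\<forall>m\<in>{1..M}. snd p m \<in> triples N)",
      OF failure_parts_measurable(6)[unfolded bad_sample_def]]
    have "measure ?G (bad_sample N M) = RT.prob {\<tau> \<in> space (random_triples N M). \<not> (\<forall>m\<in>{1..M}. \<tau> m \<in> triples N)}"
      unfolding bad_sample_def by (subst p(1)) (simp only: snd_conv, rule P.prob_snd_event, rule p(2), simp only: snd_conv)
    also have "\<dots> = 0"
      by (rule RT.prob_eq_0_AE) (use AE_random_triples[OF N, of M] in \<open>eventually_elim, blast\<close>)
    finally show ?thesis .
  qed
  moreover have "measure ?G (failure N M \<gamma> k T t) \<le> measure ?G (low_threshold N M k T) + (measure ?G (high_threshold N M k t)
    + (measure ?G (many_wrong N M (\<gamma> * real N ^ 3) T t) + (measure ?G (unbalanced N M (\<gamma> * N))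
    + (measure ?G (bad_labels N M) + measure ?G (bad_sample N M)))))"
  proof -
    have U: "measure ?G (A \<union> B) \<le> measure ?G A + measure ?G B" if "A \<in> sets ?S" "B \<in> sets ?S" for A B
      unfolding law by (rule measure_Un_le) (use that in simp_all)
    show ?thesis
      unfolding failure_def
      by (intro order_trans[OF U add_left_mono] order_refl sets.Un failure_parts_measurable)
  qed
  ultimately show ?thesis by linarith
qed


text \<open>
  \<open>t\<close> is chosen such that mixed triples rarely fall below it; then \<open>T\<close> is the \<open>1/4 - \<eta>\<close> quantile of the
  residual. Since at most \<open>\<eta>\<close> of the mass below \<open>T \<le> t\<close> is mixed, at least \<open>1/4 - 2 * \<eta>\<close> of it is pure,
  which leaves at most \<open>2 * \<eta>\<close> of pure triples above \<open>T\<close>.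
\<close>

lemma threshold_window:
  assumes \<eta>: "0 < \<eta>" "\<eta> \<le> 1 / 8"
  shows "\<exists>t c \<sigma>0. 0 < c \<and> 0 < \<sigma>0 \<and> (\<forall>\<sigma>. 0 < \<sigma> \<and> \<sigma> \<le> \<sigma>0 \<longrightarrow>
    (\<exists>T. triple_prob (\<lambda>g. residual \<sigma> g \<in> {..<T}) \<le> 1 / 4 - \<eta> \<and> 1 / 4 + c \<le> triple_prob (\<lambda>g. residual \<sigma> g \<in> {..t}) \<and>
      triple_prob (\<lambda>g. pure g \<and> T < residual \<sigma> g) + triple_prob (\<lambda>g. \<not> pure g \<and> residual \<sigma> g \<le> t) \<le> 3 * \<eta>))"
proof -
  obtain t \<sigma>1 where t: "0 < t" and \<sigma>1: "0 < \<sigma>1" "\<And>\<sigma>. 0 < \<sigma> \<and> \<sigma> \<le> \<sigma>1 \<Longrightarrow> triple_prob (\<lambda>g. \<not> pure g \<and> residual \<sigma> g \<le> t) \<le> \<eta>"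
    using mixed_residual_large[OF \<eta>(1)] by blast
  obtain c \<sigma>2 where c: "0 < c" and \<sigma>2: "0 < \<sigma>2" "\<And>\<sigma>. 0 < \<sigma> \<and> \<sigma> \<le> \<sigma>2 \<Longrightarrow> c \<le> triple_prob (\<lambda>g. \<not> pure g \<and> residual \<sigma> g \<le> t)"
    using mixed_residual_small_pos[OF t] by blast
  have "0 < c / 2" using c by simp
  then obtain \<sigma>3 where \<sigma>3: "0 < \<sigma>3" "\<And>\<sigma>. 0 < \<sigma> \<and> \<sigma> \<le> \<sigma>3 \<Longrightarrow> triple_prob (\<lambda>g. pure g \<and> t < residual \<sigma> g) \<le> c / 2"
    using pure_residual_small[OF t] by blast
  let ?\<sigma>0 = "min \<sigma>1 (min \<sigma>2 \<sigma>3)"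
  have "\<exists>T. triple_prob (\<lambda>g. residual \<sigma> g \<in> {..<T}) \<le> 1 / 4 - \<eta> \<and> 1 / 4 + c / 2 \<le> triple_prob (\<lambda>g. residual \<sigma> g \<in> {..t}) \<and>
      triple_prob (\<lambda>g. pure g \<and> T < residual \<sigma> g) + triple_prob (\<lambda>g. \<not> pure g \<and> residual \<sigma> g \<le> t) \<le> 3 * \<eta>"
    if \<sigma>: "0 < \<sigma> \<and> \<sigma> \<le> ?\<sigma>0" for \<sigma>
  proof -
    have h1: "triple_prob (\<lambda>g. \<not> pure g \<and> residual \<sigma> g \<le> t) \<le> \<eta>" by (rule \<sigma>1(2)) (use \<sigma> in auto)
    have h2: "c \<le> triple_prob (\<lambda>g. \<not> pure g \<and> residual \<sigma> g \<le> t)" by (rule \<sigma>2(2)) (use \<sigma> in auto)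
    have h3: "triple_prob (\<lambda>g. pure g \<and> t < residual \<sigma> g) \<le> c / 2" by (rule \<sigma>3(2)) (use \<sigma> in auto)
    have split: "triple_prob (\<lambda>g. residual \<sigma> g \<le> s) = triple_prob (\<lambda>g. pure g \<and> residual \<sigma> g \<le> s) + triple_prob (\<lambda>g. \<not> pure g \<and> residual \<sigma> g \<le> s)" for s
      by (rule triple_prob_split) measurable
    have quarter: "1 / 4 = triple_prob (\<lambda>g. pure g \<and> residual \<sigma> g \<le> s) + triple_prob (\<lambda>g. pure g \<and> s < residual \<sigma> g)" for s
    proof -
      have "triple_prob pure = triple_prob (\<lambda>g. pure g \<and> residual \<sigma> g \<le> s) + triple_prob (\<lambda>g. pure g \<and> \<not> residual \<sigma> g \<le> s)"
        by (rule triple_prob_split') measurable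
      then show ?thesis by (simp only: pure_prob not_le)
    qed
    have G: "1 / 4 + c / 2 \<le> triple_prob (\<lambda>g. residual \<sigma> g \<le> t)"
      using split[of t] quarter[of t] h2 h3 by linarith
    have q: "0 < 1 / 4 - \<eta>" "1 / 4 - \<eta> \<le> triple_prob (\<lambda>g. residual \<sigma> g \<le> t)"
      using \<eta> G c by linarith+
    have nn: "0 \<le> residual \<sigma> g" for g unfolding residual_def by (rule tls3_nonneg)
    obtain T where T: "T \<le> t" "triple_prob (\<lambda>g. residual \<sigma> g < T) \<le> 1 / 4 - \<eta>" "1 / 4 - \<eta> \<le> triple_prob (\<lambda>g. residual \<sigma> g \<le> T)"
      using triple.lower_quantile[OF residual_measurable nn q] .
    have "triple_prob (\<lambda>g. \<not> pure g \<and> residual \<sigma> g \<le> T) \<le> triple_prob (\<lambda>g. \<not> pure g \<and> residual \<sigma> g \<le> t)"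
      by (rule triple_prob_mono_AE) (use T(1) in auto)
    then have "triple_prob (\<lambda>g. pure g \<and> T < residual \<sigma> g) \<le> 2 * \<eta>"
      using split[of T] quarter[of T] h1 T(3) by linarith
    then have "triple_prob (\<lambda>g. pure g \<and> T < residual \<sigma> g) + triple_prob (\<lambda>g. \<not> pure g \<and> residual \<sigma> g \<le> t) \<le> 3 * \<eta>"
      using h1 by linarith
    then show ?thesis using T(2) G by (intro exI[of _ T]) (simp only: lessThan_iff atMost_iff simp_thms)
  qed
  moreover have "0 < ?\<sigma>0" using \<sigma>1 \<sigma>2 \<sigma>3 by simp
  ultimately show ?thesis using \<open>0 < c / 2\<close> by blast
qed

text \<open>
  The window leaves a gap of order \<open>M\<close> between the rank \<open>k\<close>, about \<open>M/4\<close>, and the expected counts at \<open>T\<close> and \<open>t\<close>,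
  whereas the standard deviations are of order \<open>sqrt M + M / sqrt N\<close>.
\<close>

lemma failure_unlikely:
  assumes \<sigma>: "\<And>N. 0 < \<sigma> N" "\<sigma> \<longlonglongrightarrow> 0" and M: "\<And>N. 1 \<le> M N" "(\<lambda>N. 1 / real (M N)) \<longlonglongrightarrow> 0" and \<gamma>: "0 < \<gamma>"
  shows "\<exists>t. \<forall>\<^sub>F N in sequentially. \<exists>T. measure (GLMM N v \<nu> (\<sigma> N) \<Otimes>\<^sub>M random_triples N (M N))
     (failure N (M N) \<gamma> (real (nat (round (1 / 4 * real (M N))))) T t) \<le> \<gamma>"
proof -
  \<comment> \<open>\<open>\<gamma>\<^sup>2/12\<close> because Markov's inequality divides \<open>3 * \<eta>\<close> by \<open>\<gamma>\<close>; at most \<open>1/8\<close> to keep the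
    quantile level \<open>1/4 - \<eta>\<close> positive\<close>
  define \<eta> where "\<eta> = min (\<gamma>\<^sup>2 / 12) (1 / 8)"
  have \<eta>: "0 < \<eta>" "\<eta> \<le> 1 / 8" "3 * \<eta> / \<gamma> \<le> \<gamma> / 4"
  proof -
    have "3 * \<eta> \<le> \<gamma> / 4 * \<gamma>" by (auto simp: \<eta>_def power2_eq_square)
    then show "3 * \<eta> / \<gamma> \<le> \<gamma> / 4" using \<gamma> by (simp add: pos_divide_le_eq)
  qed (use \<gamma> in \<open>auto simp: \<eta>_def\<close>)
  obtain t c \<sigma>0 where c: "0 < c" and \<sigma>0: "0 < \<sigma>0" and win: "\<And>s. 0 < s \<and> s \<le> \<sigma>0 \<Longrightarrow>
    (\<exists>T. triple_prob (\<lambda>g. residual s g \<in> {..<T}) \<le> 1 / 4 - \<eta> \<and> 1 / 4 + c \<le> triple_prob (\<lambda>g. residual s g \<in> {..t}) \<and>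
      triple_prob (\<lambda>g. pure g \<and> T < residual s g) + triple_prob (\<lambda>g. \<not> pure g \<and> residual s g \<le> t) \<le> 3 * \<eta>)"
    using threshold_window[OF \<eta>(1,2)] by blast
  let ?dev = "\<lambda>r N. (1 / real (M N) + 9 * (1 / real N)) * (1 / (r / 2)\<^sup>2)"
  have dev: "\<forall>\<^sub>F N in sequentially. ?dev r N < \<gamma> / 4" for r
  proof -
    have "(\<lambda>N. ?dev r N) \<longlonglongrightarrow> (0 + 9 * 0) * (1 / (r / 2)\<^sup>2)"
      by (intro tendsto_intros M lim_1_over_n)
    then show ?thesis by (rule order_tendstoD) (use \<gamma> in simp)
  qed
  have small: "\<forall>\<^sub>F N in sequentially. 1 / real (M N) < r" if "0 < r" for r
    using order_tendstoD(2)[OF M(2) that] .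
  \<comment> \<open>this gives \<open>2 \<le> M N\<close>, so that the rounded rank is at least \<open>1\<close>\<close>
  have small34: "\<forall>\<^sub>F N in sequentially. 1 / real (M N) < 3 / 4" by (rule small) simp
  have bal: "\<forall>\<^sub>F N in sequentially. 1 / real N * (1 / \<gamma>\<^sup>2) < \<gamma> / 4"
  proof -
    have "(\<lambda>N. 1 / real N * (1 / \<gamma>\<^sup>2)) \<longlonglongrightarrow> 0 * (1 / \<gamma>\<^sup>2)"
      by (intro tendsto_intros lim_1_over_n)
    then show ?thesis by (rule order_tendstoD) (use \<gamma> in simp)
  qed
  have sig: "\<forall>\<^sub>F N in sequentially. \<sigma> N < \<sigma>0" using order_tendstoD(2)[OF \<sigma>(2) \<sigma>0] .
  have "\<forall>\<^sub>F N in sequentially. \<exists>T. measure (GLMM N v \<nu> (\<sigma> N) \<Otimes>\<^sub>M random_triples N (M N))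
     (failure N (M N) \<gamma> (real (nat (round (1 / 4 * real (M N))))) T t) \<le> \<gamma>"
    using dev[of \<eta>] dev[of c] small[OF \<eta>(1)] small[OF c] small34 bal sig eventually_ge_at_top[of 3]
  proof eventually_elim
    case (elim N)
    let ?M = "M N" and ?k = "real (nat (round (1 / 4 * real (M N))))"
    have M0: "0 < real ?M" using M(1)[of N] by simp
    have N: "3 \<le> N" "0 < real N" using elim by auto
    have "1 / real ?M < 3 / 4" using elim by simp
    then have "2 \<le> ?M" using M(1)[of N] by (cases "?M = 1") auto
    from selected_threshold_bounds(3)[OF this] have k: "\<bar>?k - ?M / 4\<bar> \<le> 1 / 2" .
    obtain T where T: "triple_prob (\<lambda>g. residual (\<sigma> N) g \<in> {..<T}) \<le> 1 / 4 - \<eta>"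
      "1 / 4 + c \<le> triple_prob (\<lambda>g. residual (\<sigma> N) g \<in> {..t})"
      "triple_prob (\<lambda>g. pure g \<and> T < residual (\<sigma> N) g) + triple_prob (\<lambda>g. \<not> pure g \<and> residual (\<sigma> N) g \<le> t) \<le> 3 * \<eta>"
      using win[of "\<sigma> N"] \<sigma>(1)[of N] elim by auto
    have M\<eta>: "1 < \<eta> * ?M" and Mc: "1 < c * ?M" using elim M0 by (simp_all add: pos_divide_less_eq)
    \<comment> \<open>the rounding error of \<open>k\<close> uses up half of each gap\<close>
    let ?s1 = "\<eta> / 2 * ?M" and ?s2 = "c / 2 * ?M"
    have s: "0 < ?s1" "0 < ?s2" using \<eta> c M0 by auto
    have k1: "?s1 \<le> ?k - ?M * triple_prob (\<lambda>g. residual (\<sigma> N) g \<in> {..<T})"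
    proof -
      have "?M * triple_prob (\<lambda>g. residual (\<sigma> N) g \<in> {..<T}) \<le> ?M * (1 / 4 - \<eta>)"
        using T(1) by (intro mult_left_mono) auto
      also have "\<dots> = ?M / 4 - \<eta> * ?M" by (simp add: algebra_simps)
      finally show ?thesis using k M\<eta> by linarith
    qed
    have k2: "?s2 \<le> ?M * triple_prob (\<lambda>g. residual (\<sigma> N) g \<in> {..t}) - ?k"
    proof -
      have "?M / 4 + c * ?M = ?M * (1 / 4 + c)" by (simp add: algebra_simps)
      also have "\<dots> \<le> ?M * triple_prob (\<lambda>g. residual (\<sigma> N) g \<in> {..t})"
        using T(2) by (intro mult_left_mono) auto
      finally show ?thesis using k Mc by linarith
    qed
    have dv: "(?M + 9 * (real ?M)\<^sup>2 / N) / (r / 2 * ?M)\<^sup>2 = ?dev r N" for r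
    proof -
      have "(?M + 9 * (real ?M)\<^sup>2 / N) / (real ?M)\<^sup>2 = 1 / real ?M + 9 * (1 / real N)"
        using M0 by (simp add: power2_eq_square field_simps)
      moreover have "x / (r / 2 * ?M)\<^sup>2 = x / (real ?M)\<^sup>2 * (1 / (r / 2)\<^sup>2)" for x :: real
        by (simp only: power_mult_distrib times_divide_times_eq mult_1_right mult.commute)
      ultimately show ?thesis by (simp only:)
    qed
    have "measure (GLMM N v \<nu> (\<sigma> N) \<Otimes>\<^sub>M random_triples N ?M) (failure N ?M \<gamma> ?k T t)
      \<le> (?M + 9 * (real ?M)\<^sup>2 / N) / ?s1\<^sup>2 + ((?M + 9 * (real ?M)\<^sup>2 / N) / ?s2\<^sup>2
     + ((triple_prob (\<lambda>g. pure g \<and> T < residual (\<sigma> N) g) + triple_prob (\<lambda>g. \<not> pure g \<and> residual (\<sigma> N) g \<le> t)) / \<gamma>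
     + N / (\<gamma> * N)\<^sup>2))"
      by (rule failure_prob[OF N(1) \<gamma> s k1 k2])
    also have "\<dots> \<le> \<gamma> / 4 + (\<gamma> / 4 + (\<gamma> / 4 + \<gamma> / 4))"
    proof (intro add_mono)
      show "(?M + 9 * (real ?M)\<^sup>2 / N) / ?s1\<^sup>2 \<le> \<gamma> / 4" "(?M + 9 * (real ?M)\<^sup>2 / N) / ?s2\<^sup>2 \<le> \<gamma> / 4"
        unfolding dv by (rule elim(1)[THEN less_imp_le], rule elim(2)[THEN less_imp_le])
      show "(triple_prob (\<lambda>g. pure g \<and> T < residual (\<sigma> N) g) + triple_prob (\<lambda>g. \<not> pure g \<and> residual (\<sigma> N) g \<le> t)) / \<gamma> \<le> \<gamma> / 4"
        using T(3) \<gamma> by (intro order_trans[OF divide_right_mono \<eta>(3)]) auto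
      have "N / (\<gamma> * N)\<^sup>2 = 1 / real N * (1 / \<gamma>\<^sup>2)" using N by (simp add: power2_eq_square)
      then show "N / (\<gamma> * N)\<^sup>2 \<le> \<gamma> / 4" using elim(6) by linarith
    qed
    finally show ?case by (intro exI[of _ T]) simp
  qed
  then show ?thesis by blast
qed

end

lemma line_mixture_of_tails:
  fixes v :: "nat \<Rightarrow> plane"
  assumes angle: "0 < \<alpha>" "\<alpha> < pi" and v: "norm (v 1) = 1" "norm (v 2) = 1" "meet_at_angle \<alpha> (span {v 1}) (span {v 2})"
    and nu: "prob_space \<nu>" "sets \<nu> = sets borel" and supp: "\<exists>K. compact K \<and> measure \<nu> K = 1"
    and \<rho>: "0 < \<rho>"
    and low: "Liminf (at_right 0) (\<lambda>u. ereal (measure \<nu> {- u..u} / u powr \<rho>)) > 0"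
    and up: "(SUP I\<in>{I :: real set. is_interval I \<and> bounded I \<and> measure lborel I > 0}.
            ereal (measure \<nu> I / measure lborel I powr \<rho>)) < \<infinity>"
  shows "\<exists>R C. line_mixture \<nu> v R C \<rho>"
proof -
  interpret nu: prob_space \<nu> by (rule nu)
  let ?J = "{I :: real set. is_interval I \<and> bounded I \<and> measure lborel I > 0}"
  let ?S = "SUP I\<in>?J. ereal (measure \<nu> I / measure lborel I powr \<rho>)"
  obtain K where K: "compact K" "measure \<nu> K = 1" using supp by blast
  then obtain R where R: "\<And>x. x \<in> K \<Longrightarrow> \<bar>x\<bar> \<le> R" using compact_imp_bounded bounded_iff real_norm_def by metis
  have bdd: "AE w in \<nu>. \<bar>w\<bar> \<le> R"
    using nu.AE_prob_1[OF K(2)] by eventually_elim (rule R)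
  obtain c where c: "0 < c" "?S \<le> ereal c"
  proof -
    obtain c where "?S < ereal c" using less_PInf_Ex_of_nat[of ?S] up by auto
    then have "?S \<le> ereal (max c 1)" by (meson ereal_less_eq(3) less_imp_le max.cobounded1 order_trans)
    then show ?thesis by (intro that[of "max c 1"]) auto
  qed
  have spread: "measure \<nu> {x - r..x + r} \<le> c * 2 powr \<rho> * r powr \<rho>" if r: "0 < r" for x r
  proof -
    have len: "measure lborel {x - r..x + r} = 2 * r" using r by simp
    then have "{x - r..x + r} \<in> ?J" using r by (simp add: is_interval_cc)
    then have "ereal (measure \<nu> {x - r..x + r} / (2 * r) powr \<rho>) \<le> ?S"
      using len by (intro SUP_upper2[of "{x - r..x + r}"]) auto
    from order_trans[OF this c(2)] have "measure \<nu> {x - r..x + r} / (2 * r) powr \<rho> \<le> c" by simp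
    then show ?thesis using r by (simp add: pos_divide_le_eq powr_mult mult.assoc)
  qed
  have origin: "0 < measure \<nu> {- u..u}" if u: "0 < u" for u
  proof -
    have "\<forall>\<^sub>F u in at_right 0. 0 < ereal (measure \<nu> {- u..u} / u powr \<rho>)"
      using less_LiminfD[OF low] .
    moreover have "\<forall>\<^sub>F w in at_right 0. w < u" using u by (auto simp: eventually_at_right_field)
    ultimately have "\<forall>\<^sub>F w in at_right 0. 0 < w \<and> w < u \<and> 0 < ereal (measure \<nu> {- w..w} / w powr \<rho>)"
      using eventually_at_right_less[of "0 :: real"] by eventually_elim simp
    from eventually_happens'[OF trivial_limit_at_right_real this]
    obtain w where "0 < w \<and> w < u \<and> 0 < ereal (measure \<nu> {- w..w} / w powr \<rho>)" by (elim exE)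
    then have w: "0 < w" "w < u" "0 < measure \<nu> {- w..w} / w powr \<rho>" by simp_all
    then have "0 < measure \<nu> {- w..w}" by (simp add: zero_less_divide_iff)
    also have "\<dots> \<le> measure \<nu> {- u..u}" using w by (intro nu.finite_measure_mono) (auto simp: nu(2))
    finally show ?thesis .
  qed
  have "line_mixture \<nu> v R (c * 2 powr \<rho>) \<rho>"
    by standard (use nu v bdd spread origin \<rho> cross_nonzero_of_angle[OF angle v] in auto)
  then show ?thesis by blast
qed

section \<open>Almost exact recovery\<close>

text \<open>
  Outside the failure event the threshold lies between \<open>T\<close> and \<open>t\<close>, so that the misjudged triples are
  among the few wrong ones.
\<close>

lemma recovery_outside_failure:
  fixes \<gamma> :: real
  assumes nf: "((z, x), \<tau>) \<notin> failure N M \<gamma> (real (nat (round (1 / 4 * real M)))) T t"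
    and sp: "((z, x), \<tau>) \<in> space (sample_space N \<Otimes>\<^sub>M random_triples N M)"
    and alg: "spectral_method_threshold_selection N x \<tau> M (1 / 4) \<epsilon> lab"
    and M: "2 \<le> M" "3 * real M \<le> \<gamma> * N" and eps: "0 < \<epsilon>" and N: "6 \<le> \<gamma> * N"
    and small: "51200 * (2 + \<epsilon>) * (13 * \<gamma>) \<le> 1 / 4"
  shows "ham_star N lab z \<le> (51200 * (2 + \<epsilon>) * 13 + 1) * \<gamma> * N"
proof -
  let ?k = "nat (round (1 / 4 * real M))" and ?t = "selected_threshold x \<tau> M (1 / 4)"
  let ?S = "{1..N} - (\<Union>m\<in>{1..M}. \<tau> m)"
  have F: "sample_count N M {..<T} x \<tau> < real ?k" "real ?k \<le> sample_count N M {..t} x \<tau>"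
    "real (card (wrong_triples N T t z x)) < \<gamma> * real N ^ 3"
    "\<bar>real (card {i \<in> {1..N}. z i = 1}) - N / 2\<bar> < \<gamma> * N"
    and z: "\<And>i. i \<in> {1..N} \<Longrightarrow> z i \<in> {1, 2}" and \<tau>: "\<And>m. m \<in> {1..M} \<Longrightarrow> \<tau> m \<in> triples N"
    using nf sp unfolding failure_def low_threshold_def high_threshold_def many_wrong_def unbalanced_def bad_labels_def bad_sample_def
      Un_iff mem_Collect_eq fst_conv snd_conv by (auto simp only: not_le not_less de_Morgan_disj not_not)
  have sc: "sample_count N M D x \<tau> = real (card {m \<in> {1..M}. tls_residual x (\<tau> m) \<in> D})" for D
    by (rule sample_count_eq) (rule \<tau>)
  have "?k \<le> card {m \<in> {1..M}. tls_residual x (\<tau> m) \<le> t}" using F(2) unfolding sc by simp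
  then have tt: "?t \<le> t" by (rule selected_threshold_bounds(1)[OF M(1)])
  have "card {m \<in> {1..M}. tls_residual x (\<tau> m) < T} < ?k" using F(1) unfolding sc by simp
  then have tT: "T \<le> ?t" by (rule selected_threshold_bounds(2)[OF M(1)])
  have fin\<tau>: "finite (\<tau> m)" "card (\<tau> m) = 3" if "m \<in> {1..M}" for m
    using \<tau>[OF that] by (auto simp: triples_def intro: finite_subset)
  have "card (\<Union>m\<in>{1..M}. \<tau> m) \<le> (\<Sum>m\<in>{1..M}. card (\<tau> m))" by (rule card_UN_le) simp
  also have "\<dots> = (\<Sum>m\<in>{1..M}. 3)" using fin\<tau>(2) by (intro sum.cong refl) auto
  finally have cU: "card (\<Union>m\<in>{1..M}. \<tau> m) \<le> 3 * M" by simp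
  have "card {1..N} \<le> card (?S \<union> (\<Union>m\<in>{1..M}. \<tau> m))"
    using fin\<tau>(1) by (intro card_mono) auto
  also have "\<dots> \<le> card ?S + card (\<Union>m\<in>{1..M}. \<tau> m)" by (rule card_Un_le)
  finally have cS: "N \<le> card ?S + 3 * M" using cU by simp
  have nS: "real (N - card ?S) \<le> \<gamma> * N"
  proof -
    have "N - card ?S \<le> 3 * M" using cS by simp
    then have "real (N - card ?S) \<le> 3 * real M" by (metis of_nat_le_iff of_nat_mult of_nat_numeral)
    then show ?thesis using M(2) by linarith
  qed
  have "0 < \<gamma> * N" using N by linarith
  then have g0: "0 < \<gamma>" by (auto simp: zero_less_mult_iff)
  have "51200 * (2 + \<epsilon>) * (13 * \<gamma>) \<ge> 51200 * 2 * (13 * \<gamma>)"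
    using eps g0 by (intro mult_right_mono mult_left_mono) auto
  then have "\<gamma> \<le> 1 / 2" using small by linarith
  then have "\<gamma> * N \<le> 1 / 2 * N" by (intro mult_right_mono) auto
  then have "2 \<le> card ?S" using nS N by linarith
  then have sm: "spectral_method x ?S ?t \<epsilon> lab" and lab: "\<And>i. i \<in> {1..N} \<Longrightarrow> lab i \<in> {1, 2}"
    using alg unfolding spectral_method_threshold_selection_def Let_def by blast+
  have bad: "{(i, j, k) \<in> distinct_triples {1..N}. (tls_residual x {i, j, k} \<le> ?t) \<noteq> (z i = z j \<and> z j = z k)} \<subseteq> wrong_triples N T t z x"
  proof clarify
    fix i j k assume d: "(i, j, k) \<in> distinct_triples {1..N}" and m: "(tls_residual x {i, j, k} \<le> ?t) \<noteq> (z i = z j \<and> z j = z k)"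
    have "tls_residual x {i, j, k} = tls3 (x i, x j, x k)"
      using d by (intro tls_residual_triple) (auto simp: distinct_triples_def)
    then show "(i, j, k) \<in> wrong_triples N T t z x"
      using d m tt tT unfolding wrong_triples_def by auto
  qed
  have "card {(i, j, k) \<in> distinct_triples {1..N}. (tls_residual x {i, j, k} \<le> ?t) \<noteq> (z i = z j \<and> z j = z k)} \<le> card (wrong_triples N T t z x)"
    by (rule card_mono[OF finite_subset[OF _ finite_distinct_triples[of "{1..N}"]] bad]) (auto simp: wrong_triples_def)
  then have "real (card {(i, j, k) \<in> distinct_triples {1..N}. (tls_residual x {i, j, k} \<le> ?t) \<noteq> (z i = z j \<and> z j = z k)}) \<le> \<gamma> * real N ^ 3"
    using F(3) by linarith
  then show ?thesis
    by (intro spectral_method_recovers[OF sm _ nS lab z _ _ eps N small]) (use F(4) in auto)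
qed

lemma ham_star_le: "ham_star N z w \<le> N"
proof -
  have "ham N z w \<le> card {1..N}" unfolding ham_card by (rule card_mono) auto
  then show ?thesis by (simp add: ham_star_def)
qed

text \<open>
  The expected fraction of errors is at most the deterministic bound outside the failure event plus
  the probability of that event, and both are multiples of an arbitrary \<open>\<gamma>\<close>.
\<close>

theorem theorem3:
  fixes \<alpha> \<rho> \<epsilon> :: real and v :: "nat \<Rightarrow> real ^ 2" and \<nu> :: "real measure"
    and \<sigma> :: "nat \<Rightarrow> real" and M :: "nat \<Rightarrow> nat"
    and P :: "nat \<Rightarrow> 'w measure"
    and Z Zhat :: "nat \<Rightarrow> 'w \<Rightarrow> nat \<Rightarrow> nat" and X :: "nat \<Rightarrow> 'w \<Rightarrow> nat \<Rightarrow> real ^ 2"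
    and \<tau> :: "nat \<Rightarrow> 'w \<Rightarrow> nat \<Rightarrow> nat set"
  assumes "0 < \<alpha>" "\<alpha> < pi"
    and "norm (v 1) = 1" "norm (v 2) = 1" "meet_at_angle \<alpha> (span {v 1}) (span {v 2})"
    and "prob_space \<nu>" "sets \<nu> = sets borel"
    and "\<exists>K. compact K \<and> measure \<nu> K = 1"
    and "distr \<nu> borel (\<lambda>x. - x) = \<nu>"
    and "\<And>N. \<sigma> N > 0" "\<And>N. M N \<ge> 1"
    and "0 < \<rho>" "\<rho> \<le> 1"
    and "Liminf (at_right 0) (\<lambda>u. ereal (measure \<nu> {- u..u} / u powr \<rho>)) > 0"
    and "(SUP I\<in>{I :: real set. is_interval I \<and> bounded I \<and> measure lborel I > 0}.
            ereal (measure \<nu> I / measure lborel I powr \<rho>)) < \<infinity>"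
    and "\<epsilon> > 0"
    and "much_less \<sigma> (\<lambda>_. 1)"
    and "much_less (\<lambda>_. 1) (\<lambda>N. real (M N))"
    and "much_less (\<lambda>N. real (M N)) (\<lambda>N. real N powr (1/2))"
    and "\<And>N. N \<ge> 3 \<Longrightarrow> prob_space (P N)"
    and "\<And>N. N \<ge> 3 \<Longrightarrow> has_law (P N) (\<lambda>\<omega>. ((Z N \<omega>, X N \<omega>), \<tau> N \<omega>))
           (GLMM N v \<nu> (\<sigma> N) \<Otimes>\<^sub>M random_triples N (M N))"
    and "\<And>N. N \<ge> 3 \<Longrightarrow> Zhat N \<in> P N \<rightarrow>\<^sub>M PiM {1..N} (\<lambda>_. count_space UNIV)"
    and "\<And>N. N \<ge> 3 \<Longrightarrow> AE \<omega> in P N.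
           spectral_method_threshold_selection N (X N \<omega>) (\<tau> N \<omega>) (M N) (1/4) \<epsilon> (Zhat N \<omega>)"
  shows "almost_exact_recovery P Zhat Z"
proof -
  note prob = assms(20) and law = assms(21) and alg = assms(23) and eps = assms(16)
  obtain R C where "line_mixture \<nu> v R C \<rho>"
    using line_mixture_of_tails[OF assms(1-8) assms(12,14,15)] by blast
  then interpret line_mixture \<nu> v R C \<rho> .
  have \<sigma>0: "\<sigma> \<longlonglongrightarrow> 0" using assms(17) by (simp add: much_less_def)
  have M0: "(\<lambda>N. 1 / real (M N)) \<longlonglongrightarrow> 0" using assms(18) by (simp add: much_less_def)
  have MN: "(\<lambda>N. real (M N) / real N) \<longlonglongrightarrow> 0"
  proof -
    have "(\<lambda>N. real (M N) / real N powr (1/2) * real N powr (- (1/2))) \<longlonglongrightarrow> 0 * 0"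
    proof (intro tendsto_mult)
      show "(\<lambda>N. real (M N) / real N powr (1/2)) \<longlonglongrightarrow> 0" using assms(19) by (simp add: much_less_def)
      show "(\<lambda>N. real N powr (- (1/2))) \<longlonglongrightarrow> 0"
        by (rule tendsto_neg_powr[OF _ filterlim_real_sequentially]) simp
    qed
    moreover have "real (M N) / real N powr (1/2) * real N powr (- (1/2)) = real (M N) / real N" for N
      by (cases "N = 0") (simp_all add: powr_minus field_simps flip: powr_add)
    ultimately show ?thesis by simp
  qed
  let ?L = "51200 * (2 + \<epsilon>) * 13 + 1"
  have L: "0 < ?L" using eps by simp
  let ?e = "\<lambda>N. (\<integral>\<omega>. real (ham_star N (Zhat N \<omega>) (Z N \<omega>)) \<partial>P N) / real N"
  have key: "\<forall>\<^sub>F N in sequentially. ?e N \<le> (?L + 1) * \<gamma>"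
    if \<gamma>: "0 < \<gamma>" and small: "51200 * (2 + \<epsilon>) * (13 * \<gamma>) \<le> 1 / 4" for \<gamma>
  proof -
    obtain t where fail: "\<forall>\<^sub>F N in sequentially. \<exists>T. measure (GLMM N v \<nu> (\<sigma> N) \<Otimes>\<^sub>M random_triples N (M N))
       (failure N (M N) \<gamma> (real (nat (round (1 / 4 * real (M N))))) T t) \<le> \<gamma>"
      using failure_unlikely[OF assms(10) \<sigma>0 assms(11) M0 \<gamma>] by blast
    have e1: "\<forall>\<^sub>F N in sequentially. real (M N) / real N < \<gamma> / 3"
      by (rule order_tendstoD(2)[OF MN]) (use \<gamma> in simp)
    have e2: "\<forall>\<^sub>F N in sequentially. 1 / real (M N) < 3 / 4"
      by (rule order_tendstoD(2)[OF M0]) simp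
    have e3: "\<forall>\<^sub>F N in sequentially. 1 / real N < \<gamma> / 6"
      by (rule order_tendstoD(2)[OF lim_1_over_n]) (use \<gamma> in simp)
    show ?thesis using fail e1 e2 e3 eventually_ge_at_top[of 3]
    proof eventually_elim
      case (elim N)
      then obtain T where T: "measure (GLMM N v \<nu> (\<sigma> N) \<Otimes>\<^sub>M random_triples N (M N))
       (failure N (M N) \<gamma> (real (nat (round (1 / 4 * real (M N))))) T t) \<le> \<gamma>" by blast
      have N: "3 \<le> N" "0 < real N" using elim by auto
      interpret P: prob_space "P N" by (rule prob[OF N(1)])
      let ?G = "GLMM N v \<nu> (\<sigma> N) \<Otimes>\<^sub>M random_triples N (M N)"
      let ?F = "failure N (M N) \<gamma> (real (nat (round (1 / 4 * real (M N))))) T t"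
      let ?Y = "\<lambda>\<omega>. ((Z N \<omega>, X N \<omega>), \<tau> N \<omega>)"
      have Y: "?Y \<in> P N \<rightarrow>\<^sub>M ?G" and d: "distr (P N) ?G ?Y = ?G" using law[OF N(1)] by (auto simp: has_law_def)
      have "sets (GLMM N v \<nu> (\<sigma> N)) = sets (sample_space N)" by (simp add: GLMM_def)
      then have sG: "sets ?G = sets (sample_space N \<Otimes>\<^sub>M random_triples N (M N))" by (rule sets_pair_measure_cong) simp
      have FG: "?F \<in> sets ?G" unfolding sG by (rule failure_measurable)
      have sp: "space ?G = space (sample_space N \<Otimes>\<^sub>M random_triples N (M N))" by (rule sets_eq_imp_space_eq[OF sG])
      let ?B = "?Y -` ?F \<inter> space (P N)"
      have B: "?B \<in> P.events" by (rule measurable_sets[OF Y FG])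
      have PB: "P.prob ?B \<le> \<gamma>" using measure_distr[OF Y FG] T unfolding d by simp
      have "1 / real (M N) < 3 / 4" using elim by simp
      then have M2: "2 \<le> M N" using assms(11)[of N] by (cases "M N = 1") auto
      have M3: "3 * real (M N) \<le> \<gamma> * N" using elim(2) N by (simp add: pos_divide_less_eq)
      have N6: "6 \<le> \<gamma> * N" using elim(4) N by (simp add: pos_divide_less_eq)
      have "(\<integral>\<omega>. real (ham_star N (Zhat N \<omega>) (Z N \<omega>)) \<partial>P N) \<le> (\<integral>\<omega>. ?L * \<gamma> * N + real N * indicat_real ?B \<omega> \<partial>P N)"
      proof (rule integral_mono_AE')
        show "integrable (P N) (\<lambda>\<omega>. ?L * \<gamma> * N + real N * indicat_real ?B \<omega>)"
          using B by (intro Bochner_Integration.integrable_add integrable_mult_right) (auto simp: integrable_indicator_iff less_top[symmetric])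
        show "AE \<omega> in P N. real (ham_star N (Zhat N \<omega>) (Z N \<omega>)) \<le> ?L * \<gamma> * N + real N * indicat_real ?B \<omega>"
          using alg[OF N(1)] AE_space
        proof eventually_elim
          case (elim \<omega>)
          show ?case
          proof (cases "\<omega> \<in> ?B")
            case True
            have "0 \<le> ?L * \<gamma> * N" using L \<gamma> by simp
            moreover have "real (ham_star N (Zhat N \<omega>) (Z N \<omega>)) \<le> N" using ham_star_le by simp
            ultimately show ?thesis using True by simp
          next
            case False
            then have nf: "?Y \<omega> \<notin> ?F" using elim(2) by blast
            have "?Y \<omega> \<in> space (sample_space N \<Otimes>\<^sub>M random_triples N (M N))"
              using measurable_space[OF Y elim(2)] unfolding sp .
            from recovery_outside_failure[OF nf this elim(1) M2 M3 eps N6 small] False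
            show ?thesis by simp
          qed
        qed
        show "AE \<omega> in P N. 0 \<le> ?L * \<gamma> * N + real N * indicat_real ?B \<omega>"
          using eps \<gamma> by (intro AE_I2 add_nonneg_nonneg mult_nonneg_nonneg) auto
      qed
      also have "\<dots> = ?L * \<gamma> * N + N * P.prob ?B"
        using B by (subst Bochner_Integration.integral_add) (auto simp: P.prob_space integrable_indicator_iff less_top[symmetric])
      also have "\<dots> \<le> ?L * \<gamma> * N + N * \<gamma>"
        using PB by (intro add_left_mono mult_left_mono) auto
      also have "\<dots> = (?L + 1) * \<gamma> * N" by (simp add: algebra_simps)
      finally show ?case using N by (simp add: pos_divide_le_eq)
    qed
  qed
  have "?e \<longlonglongrightarrow> 0"
  proof (rule order_tendstoI)
    fix a :: real assume "a < 0"
    moreover have "0 \<le> ?e N" for N by (intro divide_nonneg_nonneg integral_nonneg) auto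
    ultimately show "\<forall>\<^sub>F N in sequentially. a < ?e N" by (intro always_eventually) (meson less_le_trans)
  next
    fix a :: real assume a: "0 < a"
    \<comment> \<open>the first bound makes the limit at most \<open>a/2\<close>, the second is required by the deterministic part\<close>
    define \<gamma> where "\<gamma> = min (a / (2 * (?L + 1))) (1 / (4 * (51200 * (2 + \<epsilon>) * 13)))"
    have \<gamma>: "0 < \<gamma>" using a eps L by (simp add: \<gamma>_def)
    have "\<gamma> \<le> 1 / (4 * (51200 * (2 + \<epsilon>) * 13))" by (simp add: \<gamma>_def)
    then have s: "51200 * (2 + \<epsilon>) * (13 * \<gamma>) \<le> 1 / 4" using eps by (simp add: field_simps)
    have "(?L + 1) * \<gamma> \<le> (?L + 1) * (a / (2 * (?L + 1)))" using L by (intro mult_left_mono) (auto simp: \<gamma>_def)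
    also have "\<dots> = a / 2"
    proof -
      have "x * (a / (2 * x)) = a / 2" if "0 < x" for x using that by simp
      from this[of "?L + 1"] L show ?thesis by argo
    qed
    also have "\<dots> < a" using a by simp
    finally have "(?L + 1) * \<gamma> < a" .
    then show "\<forall>\<^sub>F N in sequentially. ?e N < a" using key[OF \<gamma> s] by (elim eventually_mono) simp
  qed
  then show ?thesis by (simp add: almost_exact_recovery_def)
qed

end
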